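(* Let $L_1,\dots,L_H\in\mathcal{S}$. Assume there are $\sigma_0\in(1/2,1)$ and $\alpha\in(0,1)$ such that $\sum_{h\le H}N_{L_h}(\sigma_0,T)=o(T^{1-\alpha})$ as $T\to\infty$. Assume also that there are $\kappa_h>0$, $h\le H$, with \[ \frac{\log x}{x}\sum_{p\le x}|a_{L_h}(p)|^{\mathrm{i}(h)}\longrightarrow\kappa_h\quad(x\to+\infty), \] where $\mathrm{i}(h)\in\{1,2\}$ if $L_h\in\mathcal{S}_{\text{poly}}$ and satisfies the Ramanujan Hypothesis, and $\mathrm{i}(h)=1$ otherwise. Then for any $\phi_1,\dots,\phi_H\in\mathbb{R}$ and all sufficiently large $T$ there are $t_1,\dots,t_H\in[T,2T]$ such that \[ \min_{h\le H}\mathrm{Re}\left(e^{-i\phi_h}\log L_h(\sigma_0+it_h)\right)\gg\frac{(\log T)^{1-\sigma_0}}{\log\log T}, \] with $|t_h-t_g|\le 2(\log T)^{(1+\sigma_0)/2}\sqrt{\log\log T}$ for all $g,h\le H$, where the implied constant does not depend on $T$.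
   Context: The class $\mathcal{S}$ consists of Dirichlet series $L(s)=\sum_{n\ge1}a_L(n)n^{-s}$ with $a_L(1)=1$, absolutely convergent for $\mathrm{Re}\,s>1$, such that: (I) for some integer $m\ge0$, $(s-1)^mL(s)$ is entire of finite order; (II) $L(s)\gamma(s)=\omega\overline{\gamma(1-\bar s)L(1-\bar s)}$ with $\gamma(s)=Q^s\prod_{k\le K}\Gamma(\lambda_ks+\mu_k)$, $Q,\lambda_k>0$, $\mu_k\in\mathbb{C}$, $|\omega|=1$; (III) $L(s)=\prod_p\exp(\sum_{\nu\ge1}b(p^\nu)p^{-\nu s})$ for $\mathrm{Re}\,s>1$ with $b(p^\nu)\ll p^{\nu\theta_L}$ for some $\theta_L<1/2$. The subclass $\mathcal{S}_{\text{poly}}$ consists of those $L\in\mathcal{S}$ with $L(s)=\prod_p\prod_{j\le\partial_L}(1-a_{L,j}(p)p^{-s})^{-1}$ for some integer $\partial_L\ge0$ and $a_{L,j}(p)\ll p^{\theta_L}$, $\theta_L<1/4$. Ramanujan Hypothesis: $a_L(n)\ll_\epsilon n^\epsilon$ for all $\epsilon>0$. $N_L(\sigma,T)=\#\{\rho:L(\rho)=0,\ T\le\mathrm{Im}\rho\le2T,\ \mathrm{Re}\rho\ge\sigma\}$. The branch of $\log L(s)$: on $\mathrm{Re}\,s>1$ it is the branch with $\log L(\sigma)\to0$ as $\sigma\to+\infty$; it is extended to $\Omega_L=\{s:|t|\ge C_L\}\setminus\bigcup_{\rho}(-\infty+i\mathrm{Im}\rho,\rho]$ (union over zeros $\rho$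 of $L$, $C_L$ large enough to exclude the trivial zeros) by continuous variation along the segments $[2,2+it]$ and $[2+it,s]$. *)

theory Defs
  imports "HOL-Complex_Analysis.Complex_Analysis" "HOL-Library.Landau_Symbols"
    "HOL-Computational_Algebra.Primes"
begin

text \<open>Selberg class: the pair (a, L) of Dirichlet coefficients a (a n = a_L(n), n \<ge> 1;
  the value a 0 plays no role) and the function L.\<close>

definition selberg_class :: "(nat \<Rightarrow> complex) \<Rightarrow> (complex \<Rightarrow> complex) \<Rightarrow> bool" where
"selberg_class a L \<longleftrightarrow>
   a 1 = 1 \<and>
   (\<forall>s. Re s > 1 \<longrightarrow> summable (\<lambda>n. norm (a n / of_nat n powr s)) \<and>
                       L s = (\<Sum>n. a n / of_nat n powr s)) \<and>
   (\<exists>m::nat. \<exists>F::complex \<Rightarrow> complex. F holomorphic_on UNIV \<and>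
        (\<forall>s. s \<noteq> 1 \<longrightarrow> F s = (s - 1) ^ m * L s) \<and>
        (\<exists>A B::real. \<forall>s. norm (F s) \<le> A * exp (norm s powr B))) \<and>
   (\<exists>Q::real. \<exists>K::nat. \<exists>lam::nat \<Rightarrow> real. \<exists>mu::nat \<Rightarrow> complex. \<exists>\<omega>::complex.
        Q > 0 \<and> (\<forall>k<K. lam k > 0) \<and> norm \<omega> = 1 \<and>
        (\<forall>s. s \<noteq> 0 \<and> s \<noteq> 1 \<and>
             (\<forall>k<K. of_real (lam k) * s + mu k \<notin> \<int>\<^sub>\<le>\<^sub>0 \<and>
                    of_real (lam k) * (1 - cnj s) + mu k \<notin> \<int>\<^sub>\<le>\<^sub>0) \<longrightarrow>
           L s * (of_real Q powr s * (\<Prod>k<K. Gamma (of_real (lam k) * s + mu k)))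
           = \<omega> * cnj ((of_real Q powr (1 - cnj s) *
                  (\<Prod>k<K. Gamma (of_real (lam k) * (1 - cnj s) + mu k))) * L (1 - cnj s)))) \<and>
   (\<exists>b::nat \<Rightarrow> complex. \<exists>\<theta>::real. \<theta> < 1/2 \<and>
        (\<exists>C::real. \<forall>p \<nu>. prime p \<and> \<nu> \<ge> 1 \<longrightarrow> norm (b (p ^ \<nu>)) \<le> C * real p powr (real \<nu> * \<theta>)) \<and>
        (\<forall>s. Re s > 1 \<longrightarrow>
           (\<lambda>p. if prime p then exp (\<Sum>\<nu>. b (p ^ Suc \<nu>) / of_nat p powr (of_nat (Suc \<nu>) * s))
                 else 1) has_prod L s))"

definition selberg_poly :: "(nat \<Rightarrow> complex) \<Rightarrow> (complex \<Rightarrow> complex) \<Rightarrow> bool" where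
"selberg_poly a L \<longleftrightarrow> selberg_class a L \<and>
   (\<exists>d::nat. \<exists>\<alpha>::nat \<Rightarrow> nat \<Rightarrow> complex. \<exists>\<theta>::real. \<theta> < 1/4 \<and>
      (\<exists>C::real. \<forall>p j. prime p \<and> j < d \<longrightarrow> norm (\<alpha> p j) \<le> C * real p powr \<theta>) \<and>
      (\<forall>s. Re s > 1 \<longrightarrow>
         (\<lambda>p. if prime p then (\<Prod>j<d. inverse (1 - \<alpha> p j / of_nat p powr s)) else 1)
           has_prod L s))"

definition ramanujan :: "(nat \<Rightarrow> complex) \<Rightarrow> bool" where
"ramanujan a \<longleftrightarrow> (\<forall>\<epsilon>>0. \<exists>C::real. \<forall>n\<ge>1. norm (a n) \<le> C * real n powr \<epsilon>)"

definition zero_count :: "(complex \<Rightarrow> complex) \<Rightarrow> real \<Rightarrow> real \<Rightarrow> nat" where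
"zero_count L \<sigma> T = card {\<rho>. L \<rho> = 0 \<and> T \<le> Im \<rho> \<and> Im \<rho> \<le> 2 * T \<and> Re \<rho> \<ge> \<sigma>}"

definition lift_log_along :: "(complex \<Rightarrow> complex) \<Rightarrow> (real \<Rightarrow> complex) \<Rightarrow> complex \<Rightarrow> complex" where
"lift_log_along L \<gamma> v = (THE w. \<exists>g::real \<Rightarrow> complex. continuous_on {0..1} g \<and>
     (\<forall>u\<in>{0..1}. exp (g u) = L (\<gamma> u)) \<and> g 0 = v \<and> g 1 = w)"

definition log_L_at_2 :: "(complex \<Rightarrow> complex) \<Rightarrow> complex" where
"log_L_at_2 L = (THE v. \<exists>g::real \<Rightarrow> complex. continuous_on {2..} g \<and>
     (\<forall>\<sigma>\<ge>2. exp (g \<sigma>) = L (of_real \<sigma>)) \<and> (g \<longlongrightarrow> 0) at_top \<and> g 2 = v)"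

definition log_L :: "(complex \<Rightarrow> complex) \<Rightarrow> complex \<Rightarrow> complex" where
"log_L L s = lift_log_along L (linepath (2 + \<i> * of_real (Im s)) s)
               (lift_log_along L (linepath 2 (2 + \<i> * of_real (Im s))) (log_L_at_2 L))"

end

theory Submission
  imports Defs "HOL-Real_Asymp.Real_Asymp" "HOL-Number_Theory.Prime_Powers"
begin

text \<open>
  Fix $U = (\log T)^{3/4}$ and frequencies $N_h = 3^h c_0 \log T$. If $L_h$ has no zeros with real part
  at least $\sigma_0$ near height $t$, then $\log L_h(\sigma_0 + i(t+u))$ is integrated over
  $|u| \le U$ against the nonnegative kernel $(\sin(u/16)/(u/16))^4 (1 - u^2/U^2)(1 + \cos(u \log N_h))$.
  Moving the contour to real part 2, where $\log L_h$ is an absolutely convergent Dirichlet series,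
  turns the average into half a Dirichlet polynomial over the primes $p$ with
  $|\log p - \log N_h| < 1/2$. The factor $1 - u^2/U^2$ vanishes at the two corners on the line
  $\sigma_0$; it compensates the bound $|\log L_h(s)| \ll \log T / (\mathrm{Re}\, s - \sigma_0)$ of
  Borel and Caratheodory, so that zeros to the left of that line need not be counted.

  The prime windows for different $h$ are disjoint. Integrating over $t \in [T, 2T]$ against the Fejer
  type product $k^{-|P|} \prod_{p \in P} |\sum_{j<k} e^{ij(t \log p + \theta_p)}|^2$, under which each
  $\cos(t \log p + \theta_p)$ has mean $1 - 1/k$, produces a single $t$ at which all these Dirichlet
  polynomials are at least half of their trivial bounds, with prescribed phases. The product never
  exceeds $T^{\alpha/4}$, and therefore the $t$ near the few zeros may be discarded.
\<close>

section \<open>Dirichlet series\<close>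

text \<open>The size of \<open>U\<close> is dictated by two errors. Against a main term
  N^(1-\<sigma>)/log N, with N comparable to log T, the frequencies outside the window cost
  N^(2-\<sigma>)/U^3 and the horizontal edges N^(2-\<sigma>) log T / U^5. Any power of log T above
  2/5 would beat both; the exponent 3/4 lies below (1+\<sigma>)/2 for \<sigma> > 1/2 and so also
  meets the required distance between the points t_h. The scale 1/16 gives the kernel exponential
  type 1/4, less than the half-width 1/2 of a prime window, and the ratio 3 of the N_h works because
  log 3 exceeds the width 1.

  The Borel-Caratheodory bound needs |L| to be polynomially bounded to the right of Re s = -1. This
  comes from the functional equation, a monotonicity of Gamma quotients in place of Stirling's
  formula, and Phragmen-Lindelof.

  Only first moments of |a(p)| enter the construction. For i(h) = 2 the Ramanujan hypothesis forces
  the local roots into the closed unit disc, so |a(p)| is bounded and the second moment bounds the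
  first from below.\<close>

definition dirichlet_series :: "(nat \<Rightarrow> complex) \<Rightarrow> complex \<Rightarrow> complex" where
  "dirichlet_series f s = (\<Sum>n. f n / of_nat n powr s)"

definition dirichlet_abs_conv :: "(nat \<Rightarrow> complex) \<Rightarrow> real \<Rightarrow> bool" where
  "dirichlet_abs_conv f \<sigma> \<longleftrightarrow> summable (\<lambda>n. norm (f n) / real n powr \<sigma>)"

text \<open>At n = 0 every d divides n, the index set is infinite and the sum is 0 by convention.
  The series term at 0 is 0 as well, since \<open>0 powr s = 0\<close> and division by 0 gives
  0.\<close>

definition dirichlet_conv :: "(nat \<Rightarrow> complex) \<Rightarrow> (nat \<Rightarrow> complex) \<Rightarrow> nat \<Rightarrow> complex" where
  "dirichlet_conv f g n = (\<Sum>d | d dvd n. f d * g (n div d))"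

lemma norm_of_nat_powr: "norm (of_nat n powr s :: complex) = real n powr Re s"
  by (subst norm_powr_real_powr) auto

lemma norm_dirichlet_term: "norm (f n / of_nat n powr s) = norm (f n :: complex) / real n powr Re s"
  by (simp add: norm_divide norm_of_nat_powr)

lemma of_nat_powr_mult: "of_nat (m * n) powr (s :: complex) = of_nat m powr s * of_nat n powr s"
  unfolding of_nat_mult by (rule powr_times_real) auto

lemma of_nat_power_powr:
  assumes "p > 0" shows "of_nat (p ^ k) powr (s :: complex) = of_nat p powr (of_nat k * s)"
proof -
  have "Ln (of_nat p ^ k) = Ln (of_real (real p ^ k))" by simp
  also have "\<dots> = of_real (ln (real p ^ k))" using assms by (intro Ln_of_real) auto
  also have "\<dots> = of_nat k * of_real (ln (real p))" using assms by (simp add: ln_realpow)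
  also have "of_real (ln (real p)) = Ln (of_nat p :: complex)"
    using assms by (subst Ln_of_real[symmetric]) auto
  finally show ?thesis using assms by (simp add: powr_def mult_ac)
qed

lemma dirichlet_abs_conv_mono:
  assumes "dirichlet_abs_conv f \<sigma>" "\<sigma> \<le> \<tau>" shows "dirichlet_abs_conv f \<tau>"
  unfolding dirichlet_abs_conv_def
proof (rule summable_comparison_test')
  show "summable (\<lambda>n. norm (f n) / real n powr \<sigma>)" using assms by (simp add: dirichlet_abs_conv_def)
  fix n :: nat assume "n \<ge> 1"
  thus "norm (norm (f n) / real n powr \<tau>) \<le> norm (f n) / real n powr \<sigma>"
    using assms by (auto intro!: divide_left_mono powr_mono)
qed

lemma dirichlet_abs_conv_bounded:
  assumes "\<And>n. n \<ge> 1 \<Longrightarrow> norm (f n) \<le> C * real n powr e" "\<sigma> > e + 1"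
  shows "dirichlet_abs_conv f \<sigma>"
  unfolding dirichlet_abs_conv_def
proof (rule summable_comparison_test')
  show "summable (\<lambda>n. C * real n powr (e - \<sigma>))"
    using assms by (intro summable_mult) (simp add: summable_real_powr_iff)
  fix n :: nat assume "n \<ge> 1"
  thus "norm (norm (f n) / real n powr \<sigma>) \<le> C * real n powr (e - \<sigma>)"
    using assms(1)[of n] by (simp add: powr_diff divide_right_mono)
qed

lemma dirichlet_abs_conv_summable:
  assumes "dirichlet_abs_conv f \<sigma>" "\<sigma> \<le> Re s"
  shows "summable (\<lambda>n. norm (f n / of_nat n powr s))" "summable (\<lambda>n. f n / of_nat n powr s)"
proof -
  show *: "summable (\<lambda>n. norm (f n / of_nat n powr s))"
    using dirichlet_abs_conv_mono[OF assms] unfolding norm_dirichlet_term dirichlet_abs_conv_def .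
  show "summable (\<lambda>n. f n / of_nat n powr s)" by (rule summable_norm_cancel[OF *])
qed

text \<open>Each N > 0 has finitely many factorizations, one for each divisor d, so a sum over pairs
  can be taken along the fibres of (m, n) -> m * n. The fibre over 0 is infinite, hence the
  assumption that \<open>h\<close> vanishes there.\<close>

lemma has_sum_regroup_mult:
  fixes h :: "nat \<times> nat \<Rightarrow> 'a :: {topological_comm_monoid_add, t3_space}"
  assumes "(h has_sum S) UNIV" "\<And>m n. m * n = 0 \<Longrightarrow> h (m, n) = 0"
  shows "((\<lambda>N. if N = 0 then 0 else \<Sum>d | d dvd N. h (d, N div d)) has_sum S) UNIV"
proof (rule has_sum_SigmaD)
  let ?B = "\<lambda>N. {q::nat\<times>nat. fst q * snd q = N}"
  have "bij_betw (\<lambda>q. (fst q * snd q, q)) UNIV (Sigma UNIV ?B)"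
    by (rule bij_betwI[where g = snd]) auto
  from has_sum_reindex_bij_betw[OF this, of "\<lambda>x. h (snd x)" S]
  show "((\<lambda>x. h (snd x)) has_sum S) (Sigma UNIV ?B)" using assms(1) by simp
  fix N :: nat
  show "((\<lambda>y. h (snd (N, y))) has_sum (if N = 0 then 0 else \<Sum>d | d dvd N. h (d, N div d))) (?B N)"
  proof (cases "N = 0")
    case True
    have "((\<lambda>y. h y) has_sum 0) (?B N)" by (rule has_sum_0) (use assms(2) True in auto)
    thus ?thesis using True by simp
  next
    case False
    have B: "?B N = (\<lambda>d. (d, N div d)) ` {d. d dvd N}"
      using False by (auto simp: image_iff)
    have fin: "finite (?B N)" unfolding B using False by auto
    have "(h has_sum (\<Sum>q\<in>?B N. h q)) (?B N)" by (rule has_sum_finite[OF fin])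
    also have "(\<Sum>q\<in>?B N. h q) = (\<Sum>d | d dvd N. h (d, N div d))"
      unfolding B by (subst sum.reindex) (auto simp: inj_on_def)
    finally show ?thesis using False by simp
  qed
qed

lemma dirichlet_series_mult:
  assumes f: "dirichlet_abs_conv f (Re s)" and g: "dirichlet_abs_conv g (Re s)"
  shows "dirichlet_abs_conv (dirichlet_conv f g) (Re s)"
    and "dirichlet_series (dirichlet_conv f g) s = dirichlet_series f s * dirichlet_series g s"
proof -
  define F where "F n = f n / of_nat n powr s" for n
  define G where "G n = g n / of_nat n powr s" for n
  define h where "h = (\<lambda>(m,n). F m * G n)"
  have sF: "summable (\<lambda>n. norm (F n))" "F sums dirichlet_series f s"
    using dirichlet_abs_conv_summable[OF f order_refl] unfolding F_def dirichlet_series_def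
    by (auto intro: summable_sums)
  have sG: "summable (\<lambda>n. norm (G n))" "G sums dirichlet_series g s"
    using dirichlet_abs_conv_summable[OF g order_refl] unfolding G_def dirichlet_series_def
    by (auto intro: summable_sums)
  have F: "(F has_sum dirichlet_series f s) UNIV" by (rule norm_summable_imp_has_sum[OF sF])
  have G: "(G has_sum dirichlet_series g s) UNIV" by (rule norm_summable_imp_has_sum[OF sG])
  have nF: "((\<lambda>n. norm (F n)) has_sum (\<Sum>n. norm (F n))) UNIV"
    by (rule norm_summable_imp_has_sum) (use sF in \<open>auto intro: summable_sums\<close>)
  have nG: "((\<lambda>n. norm (G n)) has_sum (\<Sum>n. norm (G n))) UNIV"
    by (rule norm_summable_imp_has_sum) (use sG in \<open>auto intro: summable_sums\<close>)
  have nh: "(\<lambda>q. norm (h q)) summable_on (UNIV \<times> UNIV)"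
  proof (rule summable_on_SigmaI)
    show "((\<lambda>y. norm (h (x, y))) has_sum norm (F x) * (\<Sum>n. norm (G n))) UNIV" for x
      unfolding h_def by (simp add: norm_mult) (rule has_sum_cmult_right[OF nG])
    show "(\<lambda>x. norm (F x) * (\<Sum>n. norm (G n))) summable_on UNIV"
      by (rule summable_on_cmult_left) (use nF in \<open>auto intro: has_sum_imp_summable\<close>)
  qed auto
  have h: "(h has_sum dirichlet_series f s * dirichlet_series g s) (UNIV \<times> UNIV)"
  proof (rule has_sum_SigmaI)
    show "((\<lambda>y. h (x, y)) has_sum F x * dirichlet_series g s) UNIV" for x
      unfolding h_def by simp (rule has_sum_cmult_right[OF G])
    show "((\<lambda>x. F x * dirichlet_series g s) has_sum dirichlet_series f s * dirichlet_series g s) UNIV"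
      by (rule has_sum_cmult_left[OF F])
    show "h summable_on UNIV \<times> UNIV" by (rule abs_summable_summable[OF nh])
  qed
  have h0: "h (m, n) = 0" if "m * n = 0" for m n
    using that by (auto simp: h_def F_def G_def)
  have hc: "(\<Sum>d | d dvd N. h (d, N div d)) = dirichlet_conv f g N / of_nat N powr s" if "N > 0" for N
    unfolding dirichlet_conv_def sum_divide_distrib
  proof (intro sum.cong refl)
    fix d assume "d \<in> {d. d dvd N}"
    hence "N = d * (N div d)" by auto
    hence "of_nat N powr s = of_nat d powr s * (of_nat (N div d) powr s :: complex)"
      using of_nat_powr_mult[of d "N div d" s] by metis
    thus "h (d, N div d) = f d * g (N div d) / of_nat N powr s" by (simp add: h_def F_def G_def)
  qed
  have "((\<lambda>N. if N = 0 then 0 else \<Sum>d | d dvd N. h (d, N div d)) has_sum dirichlet_series f s * dirichlet_series g s) UNIV"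
    by (rule has_sum_regroup_mult) (use h h0 in auto)
  also have "(\<lambda>N. if N = 0 then 0 else \<Sum>d | d dvd N. h (d, N div d)) = (\<lambda>N. dirichlet_conv f g N / of_nat N powr s)"
    using hc by (auto simp: fun_eq_iff)
  finally show "dirichlet_series (dirichlet_conv f g) s = dirichlet_series f s * dirichlet_series g s"
    unfolding dirichlet_series_def[of "dirichlet_conv f g"] by (metis has_sum_imp_sums sums_unique)
  \<comment> \<open>The same regrouping, applied to the norms, dominates the coefficients of the
    convolution.\<close>
  obtain S where S: "((\<lambda>q. norm (h q)) has_sum S) UNIV" using nh by (auto simp: summable_on_def)
  have "((\<lambda>N. if N = 0 then 0 else \<Sum>d | d dvd N. norm (h (d, N div d))) has_sum S) UNIV"
    by (rule has_sum_regroup_mult[OF S]) (use h0 in auto)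
  hence sm: "summable (\<lambda>N. if N = 0 then 0 else \<Sum>d | d dvd N. norm (h (d, N div d)))"
    by (rule sums_summable[OF has_sum_imp_sums])
  show "dirichlet_abs_conv (dirichlet_conv f g) (Re s)" unfolding dirichlet_abs_conv_def
  proof (rule summable_comparison_test'[OF sm])
    fix N :: nat assume "N \<ge> 1"
    have "norm (norm (dirichlet_conv f g N) / real N powr Re s) = norm (\<Sum>d | d dvd N. h (d, N div d))"
      using \<open>N \<ge> 1\<close> by (simp add: hc norm_divide norm_of_nat_powr)
    also have "\<dots> \<le> (\<Sum>d | d dvd N. norm (h (d, N div d)))" by (rule norm_sum)
    finally show "norm (norm (dirichlet_conv f g N) / real N powr Re s) \<le> (if N = 0 then 0 else \<Sum>d | d dvd N. norm (h (d, N div d)))"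
      using \<open>N \<ge> 1\<close> by simp
  qed
qed

text \<open>From ln n \<le> n. Losing a whole unit in the abscissa is harmless, because coefficient
  identities can be read off in any right half-plane.\<close>

lemma dirichlet_abs_conv_ln:
  assumes "dirichlet_abs_conv f \<sigma>"
  shows "dirichlet_abs_conv (\<lambda>n. f n * of_real (ln (real n))) (\<sigma> + 1)"
  unfolding dirichlet_abs_conv_def
proof (rule summable_comparison_test')
  show "summable (\<lambda>n. norm (f n) / real n powr \<sigma>)" using assms by (simp add: dirichlet_abs_conv_def)
  fix n :: nat assume n: "n \<ge> 1"
  have "ln (real n) \<le> real n" using n ln_le_minus_one[of "real n"] by simp
  hence "norm (f n) * ln (real n) / (real n powr \<sigma> * real n) \<le> norm (f n) * real n / (real n powr \<sigma> * real n)"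
    using n by (intro divide_right_mono mult_left_mono) auto
  thus "norm (norm (f n * of_real (ln (real n))) / real n powr (\<sigma> + 1)) \<le> norm (f n) / real n powr \<sigma>"
    using n by (simp add: norm_mult powr_add abs_mult)
qed

lemma dirichlet_series_uniform_limit:
  assumes "dirichlet_abs_conv f \<sigma>"
  shows "uniform_limit {s. Re s \<ge> \<sigma>} (\<lambda>n s. \<Sum>i<n. f i / of_nat i powr s) (dirichlet_series f) sequentially"
  unfolding dirichlet_series_def
proof (rule Weierstrass_m_test)
  show "summable (\<lambda>n. norm (f n) / real n powr \<sigma>)" using assms by (simp add: dirichlet_abs_conv_def)
  fix n s assume "s \<in> {s. \<sigma> \<le> Re s}"
  thus "norm (f n / of_nat n powr s) \<le> norm (f n) / real n powr \<sigma>"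
    unfolding norm_dirichlet_term by (cases "n = 0") (auto intro!: divide_left_mono powr_mono)
qed

lemma continuous_on_dirichlet_series:
  assumes "dirichlet_abs_conv f \<sigma>"
  shows "continuous_on {s. Re s \<ge> \<sigma>} (dirichlet_series f)"
proof (rule uniform_limit_theorem[OF _ dirichlet_series_uniform_limit[OF assms]])
  have "continuous_on {s. Re s \<ge> \<sigma>} (\<lambda>s. f i / of_nat i powr s)" for i :: nat
    by (cases "i = 0") (auto intro!: continuous_intros)
  thus "\<forall>\<^sub>F n in sequentially. continuous_on {s. \<sigma> \<le> Re s} (\<lambda>s. \<Sum>i<n. f i / of_nat i powr s)"
    by (intro always_eventually allI continuous_on_sum)
qed auto

lemma has_field_derivative_dirichlet_series:
  assumes f: "dirichlet_abs_conv f \<sigma>" and s: "Re s > \<sigma> + 1"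
  shows "(dirichlet_series f has_field_derivative - dirichlet_series (\<lambda>n. f n * of_real (ln (real n))) s) (at s)"
proof -
  let ?S = "{s. Re s \<ge> \<sigma> + 1}"
  let ?f' = "\<lambda>n s. - (f n * of_real (ln (real n)) / of_nat n powr s)"
  note ln = dirichlet_abs_conv_ln[OF f]
  have int: "s \<in> interior ?S" by (rule interiorI[of "{s. Re s > \<sigma> + 1}"]) (use s in \<open>auto simp: open_halfspace_Re_gt\<close>)
  have "((\<lambda>s. \<Sum>n. f n / of_nat n powr s) has_field_derivative (\<Sum>n. ?f' n s)) (at s)"
  proof (rule has_field_derivative_series'(2)[where S = ?S and ?x0.0 = s])
    show "convex ?S" by (rule convex_halfspace_Re_ge)
    show "((\<lambda>s. f n / of_nat n powr s) has_field_derivative ?f' n x) (at x within ?S)" for n x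
    proof (cases "n = 0")
      case False
      have "Ln (of_nat n) = of_real (ln (real n))" using False Ln_of_real[of "real n"] by simp
      hence pw: "f n / of_nat n powr s = f n * exp (- (s * of_real (ln (real n))))" for s
        using False by (simp add: powr_def exp_minus divide_inverse)
      have "((\<lambda>s. f n * exp (- (s * of_real (ln (real n))))) has_field_derivative
         f n * (exp (- (x * of_real (ln (real n)))) * - of_real (ln (real n)))) (at x within ?S)"
        by (auto intro!: derivative_eq_intros)
      moreover have "?f' n x = f n * (exp (- (x * of_real (ln (real n)))) * - of_real (ln (real n)))"
      proof -
        have "?f' n x = - of_real (ln (real n)) * (f n / of_nat n powr x)" by (simp add: mult_ac)
        also have "\<dots> = f n * (exp (- (x * of_real (ln (real n)))) * - of_real (ln (real n)))"
          unfolding pw by (simp add: mult_ac)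
        finally show ?thesis .
      qed
      ultimately show ?thesis unfolding pw by simp
    qed auto
    show "uniformly_convergent_on ?S (\<lambda>n s. \<Sum>i<n. ?f' i s)"
      using uniform_limit_uminus[OF dirichlet_series_uniform_limit[OF ln]]
      unfolding uniformly_convergent_on_def sum_negf by blast
    show "summable (\<lambda>n. f n / of_nat n powr s)"
      by (rule dirichlet_abs_conv_summable(2)[OF f]) (use s in auto)
  qed (use s int in auto)
  moreover have "(\<Sum>n. ?f' n s) = - dirichlet_series (\<lambda>n. f n * of_real (ln (real n))) s"
    unfolding dirichlet_series_def
    by (rule suminf_minus[OF dirichlet_abs_conv_summable(2)[OF ln]]) (use s in auto)
  ultimately show ?thesis unfolding dirichlet_series_def by simp
qed

section \<open>Uniqueness of coefficients and logarithms of Euler products\<close>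

text \<open>If m is the least index \<ge> 1 with \<open>f m\<close> nonzero, its term is minus the
  tail of the series. Multiplying by m^x bounds |f m| by a constant times (m/(m+1))^x, which tends
  to 0 as x grows.\<close>

lemma dirichlet_series_zero_imp:
  assumes f: "dirichlet_abs_conv f \<sigma>" and zero: "\<And>x::real. x > \<sigma>' \<Longrightarrow> dirichlet_series f (of_real x) = 0"
    and "n \<ge> 1"
  shows "f n = 0"
proof (rule ccontr)
  assume "f n \<noteq> 0"
  define m where "m = (LEAST n. n \<ge> 1 \<and> f n \<noteq> 0)"
  have m: "m \<ge> 1" "f m \<noteq> 0" using LeastI[of "\<lambda>n. n \<ge> 1 \<and> f n \<noteq> 0" n] \<open>f n \<noteq> 0\<close> \<open>n \<ge> 1\<close> by (auto simp: m_def)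
  have small: "f i = 0" if "i \<ge> 1" "i < m" for i
    using not_less_Least[of i "\<lambda>n. n \<ge> 1 \<and> f n \<noteq> 0"] that by (auto simp: m_def)
  define A where "A = (\<Sum>n. norm (f n) / real n powr \<sigma>)"
  have sA: "summable (\<lambda>n. norm (f n) / real n powr \<sigma>)" using f by (simp add: dirichlet_abs_conv_def)
  have key: "norm (f m) \<le> real m powr \<sigma> * A * (real m / real (m + 1)) powr (x - \<sigma>)" if x: "x > \<sigma>'" "x \<ge> \<sigma>" for x
  proof -
    define u where "u i = (if i \<le> m then 0 else f i / of_nat i powr of_real x)" for i :: nat
    have su: "summable (\<lambda>n. f n / of_nat n powr of_real x)"
      by (rule dirichlet_abs_conv_summable(2)[OF f]) (use x in auto)
    have dec: "f i / of_nat i powr of_real x = (if i = m then f m / of_nat m powr of_real x else 0) + u i" for i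
      using small[of i] by (cases "i = 0") (auto simp: u_def not_le)
    have "(\<lambda>i. (if i = m then f m / of_nat m powr of_real x else 0)) sums (f m / of_nat m powr of_real x)"
      using sums_single[of m "\<lambda>_. f m / of_nat m powr of_real x"] by (simp add: eq_commute)
    moreover have s0: "(\<lambda>n. f n / of_nat n powr of_real x) sums 0"
      using summable_sums[OF su] zero[OF x(1)] by (simp add: dirichlet_series_def)
    ultimately have "(\<lambda>i. f i / of_nat i powr of_real x - (if i = m then f m / of_nat m powr of_real x else 0)) sums (0 - f m / of_nat m powr of_real x)"
      by (intro sums_diff)
    moreover have "u i = f i / of_nat i powr of_real x - (if i = m then f m / of_nat m powr of_real x else 0)" for i
      using dec[of i] by (metis add_diff_cancel_left')
    ultimately have us: "u sums (- (f m / of_nat m powr of_real x))" by (simp add: sums_def)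
    have ub: "norm (u i) \<le> norm (f i) / real i powr \<sigma> * real (m+1) powr (-(x-\<sigma>))" for i
    proof (cases "i \<le> m")
      case False
      hence "real i powr (-(x-\<sigma>)) \<le> real (m+1) powr (-(x-\<sigma>))"
        using x by (intro powr_mono2') auto
      hence "norm (f i) / real i powr \<sigma> * real i powr (-(x-\<sigma>)) \<le> norm (f i) / real i powr \<sigma> * real (m+1) powr (-(x-\<sigma>))"
        by (intro mult_left_mono) auto
      moreover have "norm (f i) / real i powr \<sigma> * real i powr (-(x-\<sigma>)) = norm (u i)"
        using False by (simp add: u_def norm_divide norm_of_nat_powr powr_diff powr_minus field_simps)
      ultimately show ?thesis by simp
    qed (auto simp: u_def)
    have "norm (f m / of_nat m powr of_real x) = norm (suminf u)" using us by (simp add: sums_iff)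
    also have "\<dots> \<le> (\<Sum>i. norm (f i) / real i powr \<sigma> * real (m+1) powr (-(x-\<sigma>)))"
      by (rule norm_suminf_le[OF ub]) (rule summable_mult2[OF sA])
    also have "\<dots> = A * real (m+1) powr (-(x-\<sigma>))" unfolding A_def by (rule suminf_mult2[OF sA, symmetric])
    finally have "norm (f m) \<le> A * real (m+1) powr (-(x-\<sigma>)) * real m powr x"
      using m by (simp add: norm_dirichlet_term field_simps)
    also have "real m powr x = real m powr \<sigma> * real m powr (x - \<sigma>)" by (simp flip: powr_add)
    also have "A * real (m+1) powr (-(x-\<sigma>)) * (real m powr \<sigma> * real m powr (x - \<sigma>)) =
       real m powr \<sigma> * A * (real m / real (m + 1)) powr (x - \<sigma>)"
      using m by (subst powr_divide) (auto simp: powr_minus powr_diff field_simps)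
    finally show ?thesis .
  qed
  let ?r = "real m / real (m + 1)"
  have r: "0 < ?r" "?r < 1" using m by auto
  have "(\<lambda>k. real m powr \<sigma> * A * ?r ^ k) \<longlonglongrightarrow> real m powr \<sigma> * A * 0"
    by (intro tendsto_intros LIMSEQ_realpow_zero) (use r in auto)
  moreover have "\<forall>\<^sub>F k in sequentially. norm (f m) \<le> real m powr \<sigma> * A * ?r ^ k"
    using eventually_gt_at_top[of "nat \<lceil>\<bar>\<sigma>' - \<sigma>\<bar>\<rceil>"]
  proof eventually_elim
    case (elim k)
    have "real k > \<sigma>' - \<sigma>" using elim by linarith
    hence "norm (f m) \<le> real m powr \<sigma> * A * ?r powr (\<sigma> + real k - \<sigma>)" by (intro key) auto
    thus ?case using r by (simp add: powr_realpow)
  qed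
  ultimately have "norm (f m) \<le> 0"
    by (intro tendsto_lowerbound[where F = sequentially and f = "\<lambda>k. real m powr \<sigma> * A * ?r ^ k"]) auto
  thus False using m by simp
qed

text \<open>Differentiating a = exp g gives a' = g' a. Since -a' has coefficients
  \<open>a n * ln n\<close>, uniqueness turns this into a convolution identity, which relates the
  coefficients of a and g without expanding an exponential series.\<close>

lemma dirichlet_exp_coeffs:
  assumes a: "dirichlet_abs_conv a \<sigma>" and g: "dirichlet_abs_conv g \<sigma>"
    and eq: "\<And>s. Re s > \<sigma> \<Longrightarrow> dirichlet_series a s = exp (dirichlet_series g s)" and "n \<ge> 1"
  shows "a n * of_real (ln (real n)) = (\<Sum>d | d dvd n. g d * of_real (ln (real d)) * a (n div d))"
proof -
  let ?la = "\<lambda>n. a n * of_real (ln (real n))" and ?lg = "\<lambda>n. g n * of_real (ln (real n))"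
  define f where "f n = ?la n - dirichlet_conv ?lg a n" for n
  have ac: "dirichlet_abs_conv a (\<sigma> + 1)" by (rule dirichlet_abs_conv_mono[OF a]) simp
  have c1: "dirichlet_abs_conv ?la (\<sigma> + 1)" "dirichlet_abs_conv ?lg (\<sigma> + 1)"
    by (intro dirichlet_abs_conv_ln a g)+
  have c2: "dirichlet_abs_conv (dirichlet_conv ?lg a) (\<sigma> + 1)"
    using dirichlet_series_mult(1)[of ?lg "of_real (\<sigma> + 1)" a] c1 ac by simp
  have fc: "dirichlet_abs_conv f (\<sigma> + 1)" unfolding dirichlet_abs_conv_def
  proof (rule summable_comparison_test')
    show "summable (\<lambda>n. norm (?la n) / real n powr (\<sigma> + 1) + norm (dirichlet_conv ?lg a n) / real n powr (\<sigma> + 1))"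
      by (intro summable_add) (use c1 c2 in \<open>simp_all add: dirichlet_abs_conv_def\<close>)
    fix n :: nat
    show "norm (norm (f n) / real n powr (\<sigma> + 1)) \<le> norm (?la n) / real n powr (\<sigma> + 1) + norm (dirichlet_conv ?lg a n) / real n powr (\<sigma> + 1)"
      unfolding add_divide_distrib[symmetric] f_def
      by (simp add: divide_right_mono norm_triangle_ineq4 del: norm_mult)
  qed
  have "f n = 0"
  proof (rule dirichlet_series_zero_imp[OF fc _ \<open>n \<ge> 1\<close>])
    fix x :: real assume x: "x > \<sigma> + 1"
    let ?s = "complex_of_real x"
    have "(dirichlet_series a has_field_derivative exp (dirichlet_series g ?s) * (- dirichlet_series ?lg ?s)) (at ?s)"
    proof (rule has_field_derivative_transform_within_open)
      show "((\<lambda>s. exp (dirichlet_series g s)) has_field_derivative exp (dirichlet_series g ?s) * (- dirichlet_series ?lg ?s)) (at ?s)"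
        by (rule DERIV_chain2[OF DERIV_exp has_field_derivative_dirichlet_series[OF g]]) (use x in auto)
      show "open {s. Re s > \<sigma>}" by (rule open_halfspace_Re_gt)
    qed (use x eq in auto)
    moreover have "(dirichlet_series a has_field_derivative - dirichlet_series ?la ?s) (at ?s)"
      by (rule has_field_derivative_dirichlet_series[OF a]) (use x in auto)
    ultimately have "- dirichlet_series ?la ?s = exp (dirichlet_series g ?s) * (- dirichlet_series ?lg ?s)"
      by (metis DERIV_unique)
    hence "dirichlet_series ?la ?s = dirichlet_series ?lg ?s * dirichlet_series a ?s"
      using eq[of ?s] x by simp
    also have "\<dots> = dirichlet_series (dirichlet_conv ?lg a) ?s"
      by (rule dirichlet_series_mult(2)[symmetric]) (use x in \<open>auto intro: dirichlet_abs_conv_mono[OF c1(2)] dirichlet_abs_conv_mono[OF ac]\<close>)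
    finally have "dirichlet_series ?la ?s = dirichlet_series (dirichlet_conv ?lg a) ?s" .
    moreover have "dirichlet_series f ?s = dirichlet_series ?la ?s - dirichlet_series (dirichlet_conv ?lg a) ?s"
      unfolding dirichlet_series_def f_def diff_divide_distrib
      by (rule suminf_diff[symmetric]) (use x in \<open>auto intro!: dirichlet_abs_conv_summable(2)[OF c1(1)] dirichlet_abs_conv_summable(2)[OF c2]\<close>)
    ultimately show "dirichlet_series f ?s = 0" by simp
  qed
  thus ?thesis unfolding f_def dirichlet_conv_def by simp
qed

text \<open>By unique factorization the sum over prime powers is a double sum over primes and
  exponents. Its partial sums over p exponentiate to the partial products, so the limits
  agree.\<close>

lemma euler_product_exp:
  assumes supp: "\<And>n. \<not> primepow n \<Longrightarrow> g n = 0" and ac: "dirichlet_abs_conv g (Re s)"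
    and prod: "(\<lambda>p. if prime p then exp (\<Sum>\<nu>. g (p ^ Suc \<nu>) / of_nat p powr (of_nat (Suc \<nu>) * s)) else 1) has_prod P"
  shows "P = exp (dirichlet_series g s)"
proof -
  define c where "c p = (\<Sum>\<nu>. g (p ^ Suc \<nu>) / of_nat p powr (of_nat (Suc \<nu>) * s))" for p
  define h where "h = (\<lambda>(p,\<nu>). g (p ^ Suc \<nu>) / of_nat (p ^ Suc \<nu>) powr s)"
  have "((\<lambda>n. g n / of_nat n powr s) has_sum dirichlet_series g s) UNIV"
    by (rule norm_summable_imp_has_sum)
       (use dirichlet_abs_conv_summable[OF ac order_refl] in \<open>auto simp: dirichlet_series_def intro: summable_sums\<close>)
  hence "((\<lambda>n. g n / of_nat n powr s) has_sum dirichlet_series g s) (Collect primepow)"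
    by (subst has_sum_cong_neutral[where T = UNIV and g = "\<lambda>n. g n / of_nat n powr s"]) (use supp in auto)
  hence h: "(h has_sum dirichlet_series g s) (Collect prime \<times> UNIV)"
    using has_sum_reindex_bij_betw[OF bij_betw_primepows, of "\<lambda>n. g n / of_nat n powr s" "dirichlet_series g s"]
    by (simp add: h_def case_prod_unfold)
  have inner: "((\<lambda>\<nu>. h (p, \<nu>)) has_sum c p) UNIV" if p: "p \<in> Collect prime" for p
  proof -
    have "(\<lambda>\<nu>. h (p, \<nu>)) summable_on UNIV"
      using summable_on_SigmaD1[of "\<lambda>x y. h (x, y)" "Collect prime" "\<lambda>_. UNIV" p] h p
      by (auto simp: case_prod_unfold intro: has_sum_imp_summable)
    hence *: "((\<lambda>\<nu>. h (p, \<nu>)) has_sum infsum (\<lambda>\<nu>. h (p, \<nu>)) UNIV) UNIV" by simp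
    have "h (p, \<nu>) = g (p ^ Suc \<nu>) / of_nat p powr (of_nat (Suc \<nu>) * s)" for \<nu>
      unfolding h_def using of_nat_power_powr[of p "Suc \<nu>" s] p prime_gt_0_nat by simp
    hence "(\<Sum>\<nu>. h (p, \<nu>)) = c p" unfolding c_def by simp
    thus ?thesis using * sums_unique[OF has_sum_imp_sums[OF *]] by simp
  qed
  have "(c has_sum dirichlet_series g s) (Collect prime)" by (rule has_sum_SigmaD[OF h inner])
  hence "((\<lambda>p. if prime p then c p else 0) has_sum dirichlet_series g s) UNIV"
    by (subst has_sum_cong_neutral[where T = "Collect prime" and g = c]) auto
  hence "(\<lambda>p. if prime p then c p else 0) sums dirichlet_series g s" by (rule has_sum_imp_sums)
  hence "(\<lambda>n. \<Sum>p\<le>n. if prime p then c p else 0) \<longlonglongrightarrow> dirichlet_series g s"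
    unfolding sums_def_le .
  hence "(\<lambda>n. exp (\<Sum>p\<le>n. if prime p then c p else 0)) \<longlonglongrightarrow> exp (dirichlet_series g s)"
    by (rule tendsto_exp)
  moreover have "exp (\<Sum>p\<le>n. if prime p then c p else 0) = (\<Prod>p\<le>n. if prime p then exp (c p) else 1)" for n
    by (subst exp_sum) (auto intro!: prod.cong)
  moreover have "(\<lambda>n. \<Prod>p\<le>n. if prime p then exp (c p) else 1) \<longlonglongrightarrow> P"
    using has_prod_imp_tendsto[OF prod] unfolding c_def .
  ultimately show ?thesis by (simp add: LIMSEQ_unique)
qed

section \<open>The logarithmic coefficients of the Selberg class\<close>

text \<open>A bound n^\<theta> with \<theta> < 1/2 makes the logarithm an absolutely convergent
  series from Re s = 3/2 on. This covers the line Re s = 2, where the series will replace log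
  L.\<close>

lemma selberg_class_log_coeffs:
  assumes "selberg_class a L"
  obtains g C \<theta> where "0 \<le> \<theta>" "\<theta> < 1/2" "C \<ge> 0" "\<And>n. n \<ge> 1 \<Longrightarrow> norm (g n) \<le> C * real n powr \<theta>"
    "\<And>n. \<not> primepow n \<Longrightarrow> g n = 0" "\<And>s. Re s > 3/2 \<Longrightarrow> L s = exp (dirichlet_series g s)"
    "\<And>p. prime p \<Longrightarrow> g p = a p"
proof -
  obtain b \<theta>0 C0 where t0: "\<theta>0 < 1/2"
    and b: "\<And>p \<nu>. prime p \<and> \<nu> \<ge> 1 \<Longrightarrow> norm (b (p ^ \<nu>)) \<le> C0 * real p powr (real \<nu> * \<theta>0)"
    and prod: "\<And>s. Re s > 1 \<Longrightarrow> (\<lambda>p. if prime p then exp (\<Sum>\<nu>. b (p ^ Suc \<nu>) / of_nat p powr (of_nat (Suc \<nu>) * s))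
                 else 1) has_prod L s"
    using assms unfolding selberg_class_def by blast
  have a1: "a 1 = 1" and sm: "\<And>s. Re s > 1 \<Longrightarrow> summable (\<lambda>n. norm (a n / of_nat n powr s)) \<and> L s = (\<Sum>n. a n / of_nat n powr s)"
    using assms unfolding selberg_class_def by blast+
  \<comment> \<open>The Euler product specifies \<open>b\<close> only at prime powers; other values
    are set to 0. Raising the exponent to at least 0 keeps n^\<theta> nondecreasing in n.\<close>
  define g where "g n = (if primepow n then b n else 0)" for n
  define \<theta> where "\<theta> = max \<theta>0 0"
  define C where "C = max C0 0"
  have supp: "g n = 0" if "\<not> primepow n" for n using that by (simp add: g_def)
  have bd: "norm (g n) \<le> C * real n powr \<theta>" if "n \<ge> 1" for n
  proof (cases "primepow n")
    case True
    then obtain p k where pk: "prime p" "k > 0" "n = p ^ k" unfolding primepow_def by blast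
    have p0: "real p > 0" using pk prime_gt_0_nat by auto
    have "norm (g n) \<le> C0 * real p powr (real k * \<theta>0)" using True b[of p k] pk by (simp add: g_def)
    also have "real p powr (real k * \<theta>0) = real n powr \<theta>0"
      using pk p0 by (simp add: powr_powr[symmetric] powr_realpow)
    also have "C0 * real n powr \<theta>0 \<le> C * real n powr \<theta>"
      using that by (intro mult_mono powr_mono) (auto simp: C_def \<theta>_def)
    finally show ?thesis .
  qed (auto simp: g_def C_def)
  have ac: "dirichlet_abs_conv g \<sigma>" if "\<sigma> \<ge> 3/2" for \<sigma>
    by (rule dirichlet_abs_conv_bounded[where e = \<theta>, OF bd]) (use t0 that in \<open>auto simp: \<theta>_def\<close>)
  have Lg: "L s = exp (dirichlet_series g s)" if "Re s > 3/2" for s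
  proof (rule euler_product_exp[OF supp ac])
    have "(\<lambda>p. if prime p then exp (\<Sum>\<nu>. g (p ^ Suc \<nu>) / of_nat p powr (of_nat (Suc \<nu>) * s)) else 1)
       = (\<lambda>p. if prime p then exp (\<Sum>\<nu>. b (p ^ Suc \<nu>) / of_nat p powr (of_nat (Suc \<nu>) * s)) else 1)"
      unfolding g_def by (intro ext if_cong refl) (simp del: power_Suc)
    thus "(\<lambda>p. if prime p then exp (\<Sum>\<nu>. g (p ^ Suc \<nu>) / of_nat p powr (of_nat (Suc \<nu>) * s)) else 1) has_prod L s"
      using prod[of s] that by simp
  qed (use that in auto)
  have aca: "dirichlet_abs_conv a (3/2)"
    using sm[of "of_real (3/2)"] unfolding dirichlet_abs_conv_def norm_dirichlet_term by simp
  have eqp: "g p = a p" if p: "prime p" for p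
  proof -
    have p1: "p \<ge> 1" "ln (real p) > 0" using prime_gt_1_nat[OF p] by auto
    have "a p * of_real (ln (real p)) = (\<Sum>d | d dvd p. g d * of_real (ln (real d)) * a (p div d))"
    proof (rule dirichlet_exp_coeffs[OF aca ac[of "3/2"]])
      fix s :: complex assume "Re s > 3/2"
      thus "dirichlet_series a s = exp (dirichlet_series g s)"
        using Lg[of s] sm[of s] by (simp add: dirichlet_series_def)
    qed (use p1 in auto)
    \<comment> \<open>The divisor 1 drops out because ln 1 = 0; with a(1) = 1 only
      \<open>g p\<close> is left.\<close>
    also have "{d. d dvd p} = {1, p}" using p by (auto simp: prime_nat_iff)
    also have "(\<Sum>d\<in>{1,p}. g d * of_real (ln (real d)) * a (p div d)) = g p * of_real (ln (real p))"
      using prime_gt_1_nat[OF p] a1 by (simp)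
    finally show ?thesis using p1 by simp
  qed
  show ?thesis by (rule that[of \<theta> C g]) (use t0 bd supp Lg eqp in \<open>auto simp: \<theta>_def C_def\<close>)
qed

section \<open>Local roots, Newton's identities and the Ramanujan hypothesis\<close>

text \<open>This is cX/(1 - cX), that is, minus X times the logarithmic derivative of 1 - cX. Summed
  over the roots it generates their power sums.\<close>

definition geometric_tail_fps :: "complex \<Rightarrow> complex fps" where
  "geometric_tail_fps c = Abs_fps (\<lambda>i. if i = 0 then 0 else c ^ i)"

lemma geometric_tail_fps_mult: "geometric_tail_fps c * (1 - fps_const c * fps_X) = fps_const c * fps_X"
proof (rule fps_ext)
  fix n
  have "geometric_tail_fps c * (1 - fps_const c * fps_X) = geometric_tail_fps c - fps_const c * (fps_X * geometric_tail_fps c)"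
    by (simp add: algebra_simps)
  thus "fps_nth (geometric_tail_fps c * (1 - fps_const c * fps_X)) n = fps_nth (fps_const c * fps_X) n"
    by (cases n) (auto simp: geometric_tail_fps_def)
qed

text \<open>Logarithmic differentiation of the product, with denominators cleared: Newton's
  identities in the form of a generating function.\<close>

lemma linear_factors_fps_deriv:
  fixes c :: "nat \<Rightarrow> complex"
  shows "fps_X * fps_deriv (\<Prod>j<d. 1 - fps_const (c j) * fps_X) =
    - (\<Sum>j<d. geometric_tail_fps (c j)) * (\<Prod>j<d. 1 - fps_const (c j) * fps_X)"
proof (induction d)
  case (Suc d)
  define h where "h = (\<Prod>j<d. 1 - fps_const (c j) * fps_X)"
  define S where "S = (\<Sum>j<d. geometric_tail_fps (c j))"
  let ?q = "1 - fps_const (c d) * fps_X" and ?g = "geometric_tail_fps (c d)"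
  define q where "q = ?q"
  have q: "fps_deriv q = fps_const (- c d)" "fps_const (c d) * fps_X = ?g * q"
    using geometric_tail_fps_mult[of "c d"] by (simp_all add: q_def)
  have "fps_X * fps_deriv (h * q) = (fps_X * fps_deriv h) * q - h * (fps_const (c d) * fps_X)"
    by (simp add: algebra_simps q fps_const_neg[symmetric] del: fps_const_neg)
  also have "fps_X * fps_deriv h = - S * h" using Suc.IH by (simp add: h_def S_def)
  also have "- S * h * q - h * (fps_const (c d) * fps_X) = - (S + ?g) * (h * q)" unfolding q(2) by (simp add: algebra_simps)
  finally show ?case by (simp add: h_def S_def q_def)
qed auto

lemma linear_factors_fps_eval:
  fixes c :: "nat \<Rightarrow> complex"
  shows "fps_conv_radius (\<Prod>j<d. 1 - fps_const (c j) * fps_X) = \<infinity> \<and>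
    eval_fps (\<Prod>j<d. 1 - fps_const (c j) * fps_X) z = (\<Prod>j<d. 1 - c j * z)"
proof (induction d)
  case (Suc d)
  have 1: "fps_conv_radius (fps_const (c d) * fps_X) = \<infinity>"
    using fps_conv_radius_mult[of "fps_const (c d)" fps_X] by simp
  have 2: "fps_conv_radius (1 - fps_const (c d) * fps_X) = \<infinity>"
    using fps_conv_radius_diff[of 1 "fps_const (c d) * fps_X"] 1 by simp
  have 3: "eval_fps (1 - fps_const (c d) * fps_X) z = 1 - c d * z"
    using 1 by (subst eval_fps_diff) (auto simp: eval_fps_mult)
  have "fps_conv_radius ((\<Prod>j<d. 1 - fps_const (c j) * fps_X) * (1 - fps_const (c d) * fps_X)) = \<infinity>"
    using fps_conv_radius_mult[of "\<Prod>j<d. 1 - fps_const (c j) * fps_X" "1 - fps_const (c d) * fps_X"] Suc.IH 2 by simp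
  moreover have "eval_fps ((\<Prod>j<d. 1 - fps_const (c j) * fps_X) * (1 - fps_const (c d) * fps_X)) z
     = (\<Prod>j<d. 1 - c j * z) * (1 - c d * z)"
    using Suc.IH 2 3 by (subst eval_fps_mult) auto
  ultimately show ?case by simp
qed auto

text \<open>The recursion says X F' = S F, where S generates the power sums, while h = prod (1 - c_j
  X) satisfies X h' = -S h. Hence F h is constant, equal to 1. As F converges in the unit disc, h
  cannot vanish at a point 1/c_j inside it.\<close>

lemma newton_recursion_root_bound:
  fixes c :: "nat \<Rightarrow> complex" and f :: "nat \<Rightarrow> complex"
  assumes f0: "f 0 = 1"
    and rec: "\<And>k. of_nat k * f k = (\<Sum>i=1..k. (\<Sum>j<d. c j ^ i) * f (k - i))"
    and sm: "\<And>r. 0 < r \<Longrightarrow> r < 1 \<Longrightarrow> summable (\<lambda>k. f k * of_real r ^ k)"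
    and j: "j < d"
  shows "norm (c j) \<le> 1"
proof (rule ccontr)
  assume nj: "\<not> norm (c j) \<le> 1"
  define F where "F = Abs_fps f"
  define S where "S = (\<Sum>j<d. geometric_tail_fps (c j))"
  define h where "h = (\<Prod>j<d. 1 - fps_const (c j) * fps_X)"
  have Snth: "fps_nth S i = (if i = 0 then 0 else \<Sum>j<d. c j ^ i)" for i
    unfolding S_def fps_sum_nth by (auto simp: geometric_tail_fps_def)
  have F': "fps_X * fps_deriv F = S * F"
  proof (rule fps_ext)
    fix k
    have "fps_nth (fps_X * fps_deriv F) k = of_nat k * f k"
      by (cases k) (auto simp: F_def)
    also have "\<dots> = (\<Sum>i=1..k. fps_nth S i * f (k - i))" unfolding rec by (intro sum.cong) (auto simp: Snth)
    also have "\<dots> = (\<Sum>i=0..k. fps_nth S i * f (k - i))"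
      by (rule sum.mono_neutral_left) (auto simp: Snth)
    also have "\<dots> = fps_nth (S * F) k" by (simp add: fps_mult_nth F_def)
    finally show "fps_nth (fps_X * fps_deriv F) k = fps_nth (S * F) k" .
  qed
  have h': "fps_X * fps_deriv h = - S * h" unfolding h_def S_def by (rule linear_factors_fps_deriv)
  have "fps_X * fps_deriv (F * h) = F * (fps_X * fps_deriv h) + (fps_X * fps_deriv F) * h"
    by (simp add: algebra_simps)
  also have "\<dots> = 0" unfolding F' h' by (simp add: algebra_simps)
  finally have "fps_deriv (F * h) = 0" by simp
  hence Fh: "F * h = fps_const (fps_nth (F * h) 0)" by (simp only: fps_deriv_eq_0_iff)
  have "fps_nth h 0 = 1" unfolding h_def by (induction d) auto
  hence "fps_nth (F * h) 0 = 1" by (simp add: F_def f0)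
  hence Fh1: "F * h = 1" using Fh by (metis fps_const_1_eq_1)
  define z where "z = 1 / c j"
  have cj: "c j \<noteq> 0" using nj by auto
  have z: "norm z < 1" using nj by (simp add: z_def norm_divide not_le divide_less_eq)
  have "conv_radius f \<ge> 1"
  proof (rule conv_radius_geI_ex)
    fix r :: real assume "0 < r" "ereal r < 1"
    thus "\<exists>z. norm z = r \<and> summable (\<lambda>n. f n * z ^ n)" using sm[of r] by (intro exI[of _ "of_real r"]) auto
  qed
  hence rF: "fps_conv_radius F \<ge> 1" by (simp add: fps_conv_radius_def F_def)
  have rF: "ereal (norm z) < fps_conv_radius F" using rF z by (metis ereal_less(3) less_le_trans)
  have rh: "fps_conv_radius h = \<infinity>" "eval_fps h z = (\<Prod>j<d. 1 - c j * z)"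
    using linear_factors_fps_eval[of c d z] by (auto simp: h_def)
  have "eval_fps (F * h) z = eval_fps F z * (\<Prod>j<d. 1 - c j * z)"
    using rF rh by (subst eval_fps_mult) auto
  moreover have "(\<Prod>j<d. 1 - c j * z) = 0" using j cj by (auto simp: z_def intro!: bexI[of _ j])
  ultimately show False using Fh1 by simp
qed

text \<open>The Ramanujan bound at the powers p^k makes each local series converge in the unit disc.
  The local roots therefore have modulus at most 1, and a(p) is the sum of d of them. Applied at p
  alone, the hypothesis would give only p^\<epsilon>, too weak to compare a second moment with a
  first one.\<close>

lemma ramanujan_poly_bounded:
  assumes "selberg_poly a L" "ramanujan a"
  shows "\<exists>B>0. \<forall>p. prime p \<longrightarrow> norm (a p) \<le> B"
proof -
  have "selberg_class a L" using assms by (simp add: selberg_poly_def)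
  hence a1: "a 1 = 1" and sm: "\<And>s. Re s > 1 \<Longrightarrow> summable (\<lambda>n. norm (a n / of_nat n powr s)) \<and> L s = (\<Sum>n. a n / of_nat n powr s)"
    unfolding selberg_class_def by blast+
  obtain d :: nat and \<alpha> :: "nat \<Rightarrow> nat \<Rightarrow> complex" and \<theta> where t: "\<theta> < 1/4" and "\<exists>C. \<forall>p j. prime p \<and> j < d \<longrightarrow> norm (\<alpha> p j) \<le> C * real p powr \<theta>"
    and prod: "\<forall>s. Re s > 1 \<longrightarrow> (\<lambda>p. if prime p then (\<Prod>j<d. inverse (1 - \<alpha> p j / of_nat p powr s)) else 1) has_prod L s"
    using assms(1) unfolding selberg_poly_def by blast
  then obtain C where al: "\<forall>p j. prime p \<and> j < d \<longrightarrow> norm (\<alpha> p j) \<le> C * real p powr \<theta>" by blast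
  \<comment> \<open>Chosen so that C p^\<theta> \<le> p^E for every prime: otherwise the constant C
    would be raised to the power k at p^k.\<close>
  define E where "E = log 2 (max C 1) + 1/4"
  have E0: "E \<ge> 0" by (simp add: E_def)
  have alE: "norm (\<alpha> p j) \<le> real p powr E" if "prime p" "j < d" for p j
  proof -
    have p: "real p \<ge> 2" using prime_ge_2_nat[OF that(1)] by simp
    have "norm (\<alpha> p j) \<le> C * real p powr \<theta>" using al that by blast
    also have "\<dots> \<le> max C 1 * real p powr (1/4)" using p t by (intro mult_mono powr_mono) auto
    also have "max C 1 = 2 powr log 2 (max C 1)" by simp
    also have "\<dots> \<le> real p powr log 2 (max C 1)" using p by (intro powr_mono2) auto
    finally show ?thesis using p by (simp add: E_def powr_add mult_right_mono)
  qed
  \<comment> \<open>The coefficients of the sum over j of -log(1 - \<alpha>_j(p) p^-s): at p^k the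
    k-th power sum of the local roots, divided by k.\<close>
  define g where "g n = (if primepow n then (\<Sum>j<d. \<alpha> (aprimedivisor n) j ^ multiplicity (aprimedivisor n) n)
      / of_nat (multiplicity (aprimedivisor n) n) else 0)" for n :: nat
  have gpk: "g (p ^ k) = (\<Sum>j<d. \<alpha> p j ^ k) / of_nat k" if "prime p" "k > 0" for p k
  proof -
    have "aprimedivisor (p ^ k) = p" using that by (simp add: aprimedivisor_prime_power)
    moreover have "multiplicity p (p ^ k) = k" using that by (simp add: prime_nat_iff multiplicity_same_power prime_gt_0_nat)
    ultimately show ?thesis using that by (simp add: g_def)
  qed
  have supp: "g n = 0" if "\<not> primepow n" for n using that by (simp add: g_def)
  have gbd: "norm (g n) \<le> real d * real n powr E" if "n \<ge> 1" for n
  proof (cases "primepow n")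
    case True
    then obtain p k where pk: "prime p" "k > 0" "n = p ^ k" unfolding primepow_def by blast
    have p0: "real p > 0" using pk prime_gt_0_nat by auto
    have "norm (g n) \<le> norm (\<Sum>j<d. \<alpha> p j ^ k)"
    proof -
      have "norm (g n) = norm (\<Sum>j<d. \<alpha> p j ^ k) / real k" using pk gpk[of p k] by (simp add: norm_divide)
      also have "\<dots> \<le> norm (\<Sum>j<d. \<alpha> p j ^ k) / 1" using pk by (intro divide_left_mono) auto
      finally show ?thesis by simp
    qed
    also have "\<dots> \<le> (\<Sum>j<d. (real p powr E) ^ k)"
      by (rule sum_norm_le) (use alE pk in \<open>auto simp: norm_power intro!: power_mono\<close>)
    also have "(real p powr E) ^ k = real n powr E" using pk p0
      by (simp add: powr_realpow[symmetric] powr_powr mult.commute)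
    finally show ?thesis by simp
  qed (auto simp: g_def)
  \<comment> \<open>E may be large, but the recursion for the coefficients can be read off in any
    right half-plane.\<close>
  define \<sigma> where "\<sigma> = E + 2"
  have ac: "dirichlet_abs_conv g \<sigma>'" if "\<sigma>' \<ge> \<sigma>" for \<sigma>'
    by (rule dirichlet_abs_conv_bounded[where e = E, OF gbd]) (use that in \<open>auto simp: \<sigma>_def\<close>)
  have aca: "dirichlet_abs_conv a \<sigma>"
    using sm[of "of_real \<sigma>"] E0 unfolding dirichlet_abs_conv_def norm_dirichlet_term by (simp add: \<sigma>_def)
  have Lg: "L s = exp (dirichlet_series g s)" if s: "Re s > \<sigma>" for s
  proof (rule euler_product_exp[OF supp ac])
    have "exp (\<Sum>\<nu>. g (p ^ Suc \<nu>) / of_nat p powr (of_nat (Suc \<nu>) * s)) = (\<Prod>j<d. inverse (1 - \<alpha> p j / of_nat p powr s))"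
      if p: "prime p" for p
    proof -
      let ?z = "\<lambda>j. \<alpha> p j / of_nat p powr s"
      have p2: "real p \<ge> 2" "p > 0" using prime_ge_2_nat[OF p] by auto
      have z: "norm (?z j) < 1" if "j < d" for j
      proof -
        have "norm (?z j) \<le> real p powr E / real p powr Re s"
          unfolding norm_divide norm_of_nat_powr by (intro divide_right_mono alE p that) auto
        also have "\<dots> = real p powr (E - Re s)" by (simp add: powr_diff)
        also have "\<dots> < 1" using p2 s by (simp add: powr_less_one \<sigma>_def)
        finally show ?thesis .
      qed
      have ser: "(\<lambda>\<nu>. ?z j ^ Suc \<nu> / of_nat (Suc \<nu>)) sums (- ln (1 - ?z j))" if "j < d" for j
      proof -
        have "(\<lambda>n. (-1) ^ Suc n / of_nat n * (- ?z j) ^ n) sums ln (1 + - ?z j)"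
          by (rule Ln_series) (use z[OF that] in simp)
        hence "(\<lambda>n. - ((-1) ^ Suc n / of_nat n * (- ?z j) ^ n)) sums - ln (1 - ?z j)"
          using sums_minus by fastforce
        moreover have "- ((-1) ^ Suc n / of_nat n * (- ?z j) ^ n) = ?z j ^ n / of_nat n" for n
          by (simp add: power_minus[of "?z j"])
        ultimately have "(\<lambda>n. ?z j ^ n / of_nat n) sums - ln (1 - ?z j)" by (simp only:)
        thus ?thesis by (subst sums_Suc_iff) simp
      qed
      have "(\<lambda>\<nu>. \<Sum>j<d. ?z j ^ Suc \<nu> / of_nat (Suc \<nu>)) sums (\<Sum>j<d. - ln (1 - ?z j))"
        by (rule sums_sum) (use ser in auto)
      moreover have "(\<Sum>j<d. ?z j ^ Suc \<nu> / of_nat (Suc \<nu>)) = g (p ^ Suc \<nu>) / of_nat p powr (of_nat (Suc \<nu>) * s)" for \<nu>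
      proof -
        have "of_nat p powr (of_nat (Suc \<nu>) * s) = (of_nat p powr s) ^ Suc \<nu>"
          using p2 by (simp add: powr_def exp_of_nat_mult[symmetric] mult_ac flip: exp_add)
             (simp add: algebra_simps flip: exp_add exp_of_nat_mult)
        thus ?thesis unfolding gpk[OF p zero_less_Suc] power_divide sum_divide_distrib by (simp add: mult_ac del: power_Suc of_nat_Suc)
      qed
      ultimately have "(\<Sum>\<nu>. g (p ^ Suc \<nu>) / of_nat p powr (of_nat (Suc \<nu>) * s)) = (\<Sum>j<d. - ln (1 - ?z j))"
        by (simp add: sums_iff del: power_Suc of_nat_Suc)
      also have "exp \<dots> = (\<Prod>j<d. exp (- ln (1 - ?z j)))" by (rule exp_sum) simp
      also have "\<dots> = (\<Prod>j<d. inverse (1 - ?z j))"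
      proof (rule prod.cong[OF refl])
        fix j assume "j \<in> {..<d}"
        hence "1 - ?z j \<noteq> 0" using z[of j] by fastforce
        thus "exp (- ln (1 - ?z j)) = inverse (1 - ?z j)" by (simp add: exp_minus)
      qed
      finally show ?thesis .
    qed
    hence "(\<lambda>p. if prime p then exp (\<Sum>\<nu>. g (p ^ Suc \<nu>) / of_nat p powr (of_nat (Suc \<nu>) * s)) else 1)
       = (\<lambda>p. if prime p then (\<Prod>j<d. inverse (1 - \<alpha> p j / of_nat p powr s)) else 1)" by auto
    thus "(\<lambda>p. if prime p then exp (\<Sum>\<nu>. g (p ^ Suc \<nu>) / of_nat p powr (of_nat (Suc \<nu>) * s)) else 1) has_prod L s"
      using prod s E0 by (simp add: \<sigma>_def)
  qed (use s in auto)
  have coeffs: "a n * of_real (ln (real n)) = (\<Sum>e | e dvd n. g e * of_real (ln (real e)) * a (n div e))" if "n \<ge> 1" for n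
  proof (rule dirichlet_exp_coeffs[OF aca ac[OF order_refl] _ that])
    fix s :: complex assume "Re s > \<sigma>"
    thus "dirichlet_series a s = exp (dirichlet_series g s)"
      using Lg[of s] sm[of s] E0 by (simp add: dirichlet_series_def \<sigma>_def)
  qed
  have rec: "of_nat k * a (p ^ k) = (\<Sum>i=1..k. (\<Sum>j<d. \<alpha> p j ^ i) * a (p ^ (k - i)))" if p: "prime p" for p k
  proof -
    have p1: "p > 1" "ln (real p) > 0" using prime_gt_1_nat[OF p] by auto
    have "{e. e dvd p ^ k} = (\<lambda>i. p ^ i) ` {0..k}"
      using p by (auto simp: divides_primepow_nat le_imp_power_dvd)
    hence "a (p ^ k) * of_real (ln (real (p ^ k))) = (\<Sum>e\<in>(\<lambda>i. p ^ i) ` {0..k}. g e * of_real (ln (real e)) * a (p ^ k div e))"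
      using coeffs[of "p ^ k"] p1 by (simp add: Suc_le_eq)
    also have "\<dots> = (\<Sum>i=0..k. g (p ^ i) * of_real (ln (real (p ^ i))) * a (p ^ k div p ^ i))"
      by (subst sum.reindex) (use p1 in \<open>auto simp: inj_on_def\<close>)
    also have "\<dots> = (\<Sum>i=1..k. g (p ^ i) * of_real (ln (real (p ^ i))) * a (p ^ k div p ^ i))"
      by (rule sum.mono_neutral_right) (auto simp: not_less_eq_eq[symmetric])
    also have "\<dots> = (\<Sum>i=1..k. (\<Sum>j<d. \<alpha> p j ^ i) * a (p ^ (k - i)) * of_real (ln (real p)))"
    proof (rule sum.cong[OF refl])
      fix i assume i: "i \<in> {1..k}"
      have "p ^ k div p ^ i = p ^ (k - i)" using i p1 by (simp add: power_diff)
      thus "g (p ^ i) * of_real (ln (real (p ^ i))) * a (p ^ k div p ^ i) = (\<Sum>j<d. \<alpha> p j ^ i) * a (p ^ (k - i)) * of_real (ln (real p))"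
        using gpk[OF p, of i] i p1 by (simp add: ln_realpow)
    qed
    also have "\<dots> = (\<Sum>i=1..k. (\<Sum>j<d. \<alpha> p j ^ i) * a (p ^ (k - i))) * of_real (ln (real p))"
      by (rule sum_distrib_right[symmetric])
    also have "a (p ^ k) * of_real (ln (real (p ^ k))) = (of_nat k * a (p ^ k)) * of_real (ln (real p))"
      using p1 by (simp add: ln_realpow)
    finally have "(of_nat k * a (p ^ k)) * of_real (ln (real p)) = (\<Sum>i=1..k. (\<Sum>j<d. \<alpha> p j ^ i) * a (p ^ (k - i))) * of_real (ln (real p))" .
    thus ?thesis using p1 by simp
  qed
  have al1: "norm (\<alpha> p j) \<le> 1" if p: "prime p" and j: "j < d" for p j
  proof (rule newton_recursion_root_bound[where f = "\<lambda>k. a (p ^ k)" and d = d and c = "\<alpha> p", OF _ rec[OF p] _ j])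
    show "a (p ^ 0) = 1" using a1 by simp
    fix r :: real assume r: "0 < r" "r < 1"
    have p1: "real p > 1" using prime_gt_1_nat[OF p] by auto
    \<comment> \<open>With this choice p^\<epsilon> = r^(-1/2), so a(p^k) r^k is O(r^(k/2)).\<close>
    define \<epsilon> where "\<epsilon> = - ln r / (2 * ln (real p))"
    have e: "\<epsilon> > 0" using r p1 unfolding \<epsilon>_def by (intro divide_pos_pos) auto
    obtain C' where C': "\<And>n. n \<ge> 1 \<Longrightarrow> norm (a n) \<le> C' * real n powr \<epsilon>"
      using assms(2) e unfolding ramanujan_def by blast
    have pe: "real p powr \<epsilon> = exp (- ln r / 2)" using p1 by (simp add: powr_def \<epsilon>_def)
    have q: "real p powr \<epsilon> * r = exp (ln r / 2)"
    proof -
      have "r = exp (ln r)" using r by simp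
      hence "real p powr \<epsilon> * r = exp (- ln r / 2 + ln r)" unfolding pe exp_add by simp
      thus ?thesis by (simp add: field_simps)
    qed
    have q1: "0 \<le> real p powr \<epsilon> * r" "real p powr \<epsilon> * r < 1" using r unfolding q by auto
    show "summable (\<lambda>k. a (p ^ k) * of_real r ^ k)"
    proof (rule summable_comparison_test')
      show "summable (\<lambda>k. C' * (real p powr \<epsilon> * r) ^ k)"
        by (intro summable_mult summable_geometric) (use q1 in auto)
      fix k :: nat
      have "norm (a (p ^ k)) \<le> C' * real (p ^ k) powr \<epsilon>" using C'[of "p ^ k"] p1 by simp
      also have "real (p ^ k) powr \<epsilon> = (real p powr \<epsilon>) ^ k"
        using p1 by (simp add: powr_realpow[symmetric] powr_powr mult.commute)
      finally have "norm (a (p ^ k)) * r ^ k \<le> C' * (real p powr \<epsilon>) ^ k * r ^ k"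
        using r by (intro mult_right_mono) auto
      thus "norm (a (p ^ k) * of_real r ^ k) \<le> C' * (real p powr \<epsilon> * r) ^ k"
        using r by (simp add: norm_mult norm_power power_mult_distrib mult_ac)
    qed
  qed
  have "norm (a p) \<le> real d + 1" if p: "prime p" for p
  proof -
    have "a p = (\<Sum>j<d. \<alpha> p j)" using rec[OF p, of 1] a1 by simp
    also have "norm \<dots> \<le> (\<Sum>j<d. 1)" by (rule sum_norm_le) (use al1 p in auto)
    finally show ?thesis by simp
  qed
  thus ?thesis by (intro exI[of _ "real d + 1"]) auto
qed

section \<open>Polynomial growth in vertical strips\<close>

text \<open>In Euler's limit the quotient |Gamma(x + iy)| / Gamma(x) becomes a product of factors (x
  + j)/|x + j + iy|, the powers of n cancelling. Each factor is nondecreasing in x > 0. This takes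
  the place of Stirling's formula.\<close>

lemma Gamma_vertical_ratio:
  fixes x1 x2 y :: real
  assumes "0 < x1" "x1 \<le> x2"
  shows "norm (Gamma (Complex x1 y)) * Gamma x2 \<le> norm (Gamma (Complex x2 y)) * Gamma x1"
proof -
  have npole: "Complex x y \<notin> \<int>\<^sub>\<le>\<^sub>0" if "x > 0" for x
    using that by (auto elim!: nonpos_Ints_cases simp: complex_eq_iff)
  have lim: "(\<lambda>n. norm (Gamma_series (Complex x y) n)) \<longlonglongrightarrow> norm (Gamma (Complex x y))" for x
    by (intro tendsto_norm Gamma_series_LIMSEQ)
  have limr: "(\<lambda>n. Gamma_series x n) \<longlonglongrightarrow> Gamma x" for x :: real
    by (rule Gamma_series_LIMSEQ)
  have ns: "norm (Gamma_series (Complex x y) n) = fact n * exp (x * ln (real n)) / norm (pochhammer (Complex x y) (n + 1))" for x n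
    unfolding Gamma_series_def by (simp add: norm_divide norm_mult)
  have pc: "pochhammer x (n + 1) > 0" if "x > 0" for x :: real and n using that by (rule pochhammer_pos)
  have pn: "norm (pochhammer (Complex x y) (n + 1)) > 0" if "x > 0" for x n
    using npole[OF that] pochhammer_eq_0_iff[of "Complex x y" "n+1"] by (auto simp: complex_eq_iff) (use that in auto)
  have key: "norm (pochhammer (Complex x2 y) m) * pochhammer x1 m \<le> norm (pochhammer (Complex x1 y) m) * pochhammer x2 m" for m
  proof -
    have "norm (Complex x2 y + of_nat i) * (x1 + real i) \<le> norm (Complex x1 y + of_nat i) * (x2 + real i)" for i
    proof -
      define u v where "u = x1 + real i" and "v = x2 + real i"
      have uv: "0 < u" "u \<le> v" using assms by (auto simp: u_def v_def)
      have "(v\<^sup>2 + y\<^sup>2) * u\<^sup>2 \<le> (u\<^sup>2 + y\<^sup>2) * v\<^sup>2"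
      proof -
        have "u\<^sup>2 * y\<^sup>2 \<le> v\<^sup>2 * y\<^sup>2" using uv by (intro mult_right_mono power_mono) auto
        thus ?thesis by (simp add: algebra_simps)
      qed
      hence "sqrt ((v\<^sup>2 + y\<^sup>2) * u\<^sup>2) \<le> sqrt ((u\<^sup>2 + y\<^sup>2) * v\<^sup>2)" by (rule real_sqrt_le_mono)
      hence "sqrt (v\<^sup>2 + y\<^sup>2) * u \<le> sqrt (u\<^sup>2 + y\<^sup>2) * v"
        using uv by (simp add: real_sqrt_mult)
      thus ?thesis by (simp add: u_def v_def cmod_def)
    qed
    hence "(\<Prod>i=0..<m. norm (Complex x2 y + of_nat i) * (x1 + real i)) \<le> (\<Prod>i=0..<m. norm (Complex x1 y + of_nat i) * (x2 + real i))"
      using assms by (intro prod_mono conjI mult_nonneg_nonneg) auto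
    thus ?thesis by (simp add: pochhammer_prod prod.distrib prod_norm[symmetric] atLeast0LessThan)
  qed
  have "norm (Gamma_series (Complex x1 y) n) * Gamma_series x2 n \<le> norm (Gamma_series (Complex x2 y) n) * Gamma_series x1 n" for n
  proof -
    let ?E = "fact n * exp (x1 * ln (real n)) * (fact n * exp (x2 * ln (real n)))"
    have "?E / (norm (pochhammer (Complex x1 y) (n+1)) * pochhammer x2 (n+1)) \<le> ?E / (norm (pochhammer (Complex x2 y) (n+1)) * pochhammer x1 (n+1))"
      using key[of "n+1"] pn[of x1 n] pn[of x2 n] pc[of x1 n] pc[of x2 n] assms by (intro divide_left_mono mult_pos_pos) auto
    moreover have "norm (Gamma_series (Complex x1 y) n) * Gamma_series x2 n = ?E / (norm (pochhammer (Complex x1 y) (n+1)) * pochhammer x2 (n+1))"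
      unfolding ns by (simp add: Gamma_series_def)
    moreover have "norm (Gamma_series (Complex x2 y) n) * Gamma_series x1 n = ?E / (norm (pochhammer (Complex x2 y) (n+1)) * pochhammer x1 (n+1))"
      unfolding ns by (simp add: Gamma_series_def)
    ultimately show ?thesis by simp
  qed
  thus ?thesis by (intro LIMSEQ_le[OF tendsto_mult[OF lim limr] tendsto_mult[OF lim limr]]) auto
qed

text \<open>Step right from \<open>z\<close> into the half-plane of positive real part, compare
  there with a right shift of \<open>w\<close>, and return to \<open>w\<close>. Since |y| \<ge> 1,
  the steps away from z only increase the modulus, and each of the n steps back to w costs a factor
  linear in |y|.\<close>

lemma Gamma_quotient_poly_bound:
  fixes x0 a :: real
  shows "\<exists>C n. C > 0 \<and> (\<forall>y. \<bar>y\<bar> \<ge> 1 \<longrightarrow> norm (Gamma (Complex (x0 + a) y)) \<le> C * (1 + \<bar>y\<bar>) ^ n * norm (Gamma (Complex x0 y)))"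
proof -
  obtain j :: nat where j: "x0 + a + real j > 0"
  proof -
    obtain j :: nat where "- (x0 + a) < real j" using reals_Archimedean2 by blast
    thus ?thesis by (intro that[of j]) linarith
  qed
  \<comment> \<open>This n puts w + n on or to the right of z + j, as the monotonicity
    requires.\<close>
  obtain n :: nat where n: "real n \<ge> a + real j" using real_arch_simple by blast
  have n0: "x0 + real n > 0" using j n by linarith
  define D where "D = Gamma (x0 + a + real j) / Gamma (x0 + real n)"
  have D: "D > 0" unfolding D_def using j n0 by simp
  define C where "C = D * (\<bar>x0\<bar> + real n + 1) ^ n"
  have "C > 0" unfolding C_def using D by (intro mult_pos_pos zero_less_power) auto
  moreover have "norm (Gamma (Complex (x0 + a) y)) \<le> C * (1 + \<bar>y\<bar>) ^ n * norm (Gamma (Complex x0 y))" if y: "\<bar>y\<bar> \<ge> 1" for y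
  proof -
    define z w where "z = Complex (x0 + a) y" and "w = Complex x0 y"
    have np: "z \<notin> \<int>\<^sub>\<le>\<^sub>0" "w \<notin> \<int>\<^sub>\<le>\<^sub>0" using y by (auto elim!: nonpos_Ints_cases simp: complex_eq_iff z_def w_def)
    have zj: "z + of_nat j = Complex (x0 + a + real j) y" and wn: "w + of_nat n = Complex (x0 + real n) y"
      by (auto simp: z_def w_def complex_eq_iff)
    have Gz: "Gamma z \<noteq> 0" "Gamma w \<noteq> 0" using np by (auto simp: Gamma_eq_zero_iff)
    have 1: "norm (Gamma z) \<le> norm (Gamma (z + of_nat j))"
    proof -
      have "1 \<le> (\<Prod>i=0..<j. norm (z + of_nat i))"
      proof (rule prod_ge_1)
        fix i assume "i \<in> {0..<j}"
        show "1 \<le> norm (z + of_nat i)" using abs_Im_le_cmod[of "z + of_nat i"] y by (simp add: z_def)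
      qed
      hence "1 \<le> norm (pochhammer z j)" by (simp add: pochhammer_prod prod_norm[symmetric] atLeast0LessThan)
      moreover have "Gamma (z + of_nat j) = pochhammer z j * Gamma z" using pochhammer_Gamma[OF np(1), of j] Gz by simp
      ultimately show ?thesis by (simp add: norm_mult mult_le_cancel_right1)
    qed
    have 2: "norm (Gamma (z + of_nat j)) \<le> D * norm (Gamma (w + of_nat n))"
    proof -
      have "norm (Gamma (Complex (x0 + a + real j) y)) * Gamma (x0 + real n) \<le> norm (Gamma (Complex (x0 + real n) y)) * Gamma (x0 + a + real j)"
        by (rule Gamma_vertical_ratio) (use j n in auto)
      thus ?thesis unfolding zj wn D_def using n0 by (simp add: field_simps)
    qed
    have 3: "norm (Gamma (w + of_nat n)) \<le> ((\<bar>x0\<bar> + real n + 1) * (1 + \<bar>y\<bar>)) ^ n * norm (Gamma w)"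
    proof -
      have "(\<Prod>i=0..<n. norm (w + of_nat i)) \<le> (\<Prod>i=0..<n. (\<bar>x0\<bar> + real n + 1) * (1 + \<bar>y\<bar>))"
      proof (intro prod_mono conjI)
        fix i assume i: "i \<in> {0..<n}"
        have "norm (w + of_nat i) \<le> norm w + real i" using norm_triangle_ineq[of w "of_nat i"] by simp
        also have "norm w \<le> \<bar>x0\<bar> + \<bar>y\<bar>" using cmod_le[of w] by (simp add: w_def)
        finally have "norm (w + of_nat i) \<le> \<bar>x0\<bar> + \<bar>y\<bar> + real n" using i by simp
        also have "\<dots> \<le> (\<bar>x0\<bar> + real n + 1) * (1 + \<bar>y\<bar>)" by (simp add: algebra_simps)
        finally show "norm (w + of_nat i) \<le> (\<bar>x0\<bar> + real n + 1) * (1 + \<bar>y\<bar>)" .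
      qed auto
      hence "norm (pochhammer w n) \<le> ((\<bar>x0\<bar> + real n + 1) * (1 + \<bar>y\<bar>)) ^ n"
        by (simp add: pochhammer_prod prod_norm[symmetric] atLeast0LessThan)
      moreover have "Gamma (w + of_nat n) = pochhammer w n * Gamma w" using pochhammer_Gamma[OF np(2), of n] Gz by simp
      ultimately show ?thesis by (simp add: norm_mult mult_right_mono)
    qed
    have "norm (Gamma z) \<le> D * (((\<bar>x0\<bar> + real n + 1) * (1 + \<bar>y\<bar>)) ^ n * norm (Gamma w))"
      using 1 2 3 D by (meson mult_left_mono order_trans less_imp_le)
    thus ?thesis unfolding C_def z_def w_def by (simp add: power_mult_distrib mult_ac)
  qed
  ultimately show ?thesis by blast
qed

section \<open>Convexity in the strip and the functional equation\<close>

text \<open>The function is damped by exp(-\<epsilon> cos w(s)), where w(s) = (s - 1/2)/2 maps the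
  strip into |Re w| \<le> 3/4 < pi/2. There Re cos w grows like exp(|Im s|/2), which beats finite
  order. Dividing by (s + 2)^M, of modulus at least 1 in the strip, reduces to a constant bound on
  the boundary; finally \<epsilon> tends to 0.\<close>

lemma phragmen_lindelof_strip:
  fixes F :: "complex \<Rightarrow> complex" and A B C :: real and M :: nat
  assumes hol: "F holomorphic_on UNIV" and fin: "\<And>s. norm (F s) \<le> A * exp (norm s powr B)"
    and "C > 0" and bd: "\<And>s. Re s = -1 \<or> Re s = 2 \<Longrightarrow> norm (F s) \<le> C * norm (s + 2) ^ M"
    and s0: "-1 \<le> Re s0" "Re s0 \<le> 2"
  shows "norm (F s0) \<le> C * norm (s0 + 2) ^ M"
proof -
  define w where "w s = (s - 1/2) / 2" for s :: complex
  have Recos: "Re (cos (w s)) = cos ((Re s - 1/2) / 2) * cosh (Im s / 2)" for s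
    unfolding Re_cos by (simp add: w_def cosh_def)
  have c34: "cos (3/4 :: real) > 0" by (rule cos_gt_zero_pi) (use pi_gt3 in auto)
  have cge: "cos ((Re s - 1/2) / 2) \<ge> cos (3/4)" if "-1 \<le> Re s" "Re s \<le> 2" for s :: complex
  proof -
    have "cos (3/4) \<le> cos \<bar>(Re s - 1/2) / 2\<bar>"
    proof (rule cos_monotone_0_pi_le)
      show "\<bar>(Re s - 1/2) / 2\<bar> \<le> 3/4" unfolding abs_le_iff using that by (auto simp: field_simps)
    qed (use pi_gt3 in auto)
    thus ?thesis by (simp only: cos_abs_real)
  qed
  have s2: "norm (s + 2) \<ge> 1" if "-1 \<le> Re s" for s :: complex
    using complex_Re_le_cmod[of "s + 2"] that by simp
  have main: "norm (F s0) \<le> C * norm (s0 + 2) ^ M * exp (\<epsilon> * Re (cos (w s0)))" if e: "\<epsilon> > 0" for \<epsilon>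
  proof -
    define \<Phi> where "\<Phi> s = F s / (s + 2) ^ M * exp (- of_real \<epsilon> * cos (w s))" for s
    have n\<Phi>: "norm (\<Phi> s) = norm (F s) / norm (s + 2) ^ M * exp (- \<epsilon> * Re (cos (w s)))" for s
      unfolding \<Phi>_def by (simp add: norm_mult norm_divide norm_power)
    \<comment> \<open>The 2 comes from \<open>cosh (R/2)\<close> being at least exp(R/2)/2. The
      exponent b below is positive and at least B, so \<open>(R + 2) powr b\<close> dominates
      \<open>norm s powr B\<close> on the horizontal edges.\<close>
    define d where "d = \<epsilon> * cos (3/4) / 2"
    have d: "d > 0" using e c34 by (simp add: d_def)
    define b where "b = \<bar>B\<bar> + 1"
    have b: "b > 0" "B \<le> b" by (auto simp: b_def)
    have "((\<lambda>R. exp ((R + 2) powr b) * exp (- d * exp (R / 2))) \<longlongrightarrow> 0) at_top"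
    proof (rule tendsto_sandwich[where f = "\<lambda>_. 0" and h = "\<lambda>R. exp (- ((d / 2) * exp (R / 2)))"])
      have "((\<lambda>R. (R + 2) powr b / exp (R / 2)) \<longlongrightarrow> 0) at_top" by real_asymp
      hence "\<forall>\<^sub>F R in at_top. (R + 2) powr b / exp (R / 2) < d / 2"
        by (rule order_tendstoD) (use d in auto)
      thus "\<forall>\<^sub>F R in at_top. exp ((R + 2) powr b) * exp (- d * exp (R / 2)) \<le> exp (- ((d / 2) * exp (R / 2)))"
        by eventually_elim (simp add: exp_add[symmetric] field_simps)
      show "((\<lambda>R. exp (- ((d / 2) * exp (R / 2)))) \<longlongrightarrow> 0) at_top" using d by real_asymp
    qed auto
    hence "((\<lambda>R. A * (exp ((R + 2) powr b) * exp (- d * exp (R / 2)))) \<longlongrightarrow> 0) at_top"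
      by (rule tendsto_mult_right_zero)
    hence "((\<lambda>R. A * exp ((R + 2) powr b) * exp (- d * exp (R / 2))) \<longlongrightarrow> 0) at_top"
      by (simp only: mult.assoc)
    hence "\<forall>\<^sub>F R in at_top. A * exp ((R + 2) powr b) * exp (- d * exp (R / 2)) < C"
      by (rule order_tendstoD) (use \<open>C > 0\<close> in auto)
    hence "\<forall>\<^sub>F R in at_top. A * exp ((R + 2) powr b) * exp (- d * exp (R / 2)) < C \<and> R \<ge> 1 + \<bar>Im s0\<bar>"
      by (intro eventually_conj eventually_ge_at_top)
    then obtain R where R: "A * exp ((R + 2) powr b) * exp (- d * exp (R / 2)) < C" "R \<ge> 1 + \<bar>Im s0\<bar>"
      by (auto simp: eventually_at_top_linorder)
    define S where "S = cbox (Complex (-1) (-R)) (Complex 2 R)"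
    have S: "s \<in> S \<longleftrightarrow> -1 \<le> Re s \<and> Re s \<le> 2 \<and> -R \<le> Im s \<and> Im s \<le> R" for s
      by (auto simp: S_def in_cbox_complex_iff)
    have FS: "F holomorphic_on S" using hol holomorphic_on_subset by blast
    have ne: "s + 2 \<noteq> 0" if "s \<in> S" for s using s2[of s] that S by force
    have hol\<Phi>: "\<Phi> holomorphic_on S" unfolding \<Phi>_def w_def
      by (intro holomorphic_intros FS) (use ne in auto)
    have "norm (\<Phi> s0) \<le> C"
    proof (rule maximum_modulus_frontier[where S = S and f = \<Phi>])
      show "\<Phi> holomorphic_on interior S" using hol\<Phi> interior_subset holomorphic_on_subset by blast
      show "continuous_on (closure S) \<Phi>" using holomorphic_on_imp_continuous_on[OF hol\<Phi>] by (simp add: S_def)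
      show "bounded S" by (simp add: S_def)
      show "s0 \<in> S" using s0 R(2) by (auto simp: S)
      fix s assume "s \<in> frontier S"
      hence sf: "s \<in> S" "s \<notin> box (Complex (-1) (-R)) (Complex 2 R)"
        unfolding S_def frontier_cbox by auto
      have cosn: "Re (cos (w s)) \<ge> cos (3/4) * cosh (Im s / 2)" "cos (3/4) * cosh (Im s / 2) \<ge> 0"
        using cge[of s] sf S c34 unfolding Recos by (auto intro!: mult_right_mono simp: less_imp_le)
      have sn: "norm (s + 2) ^ M \<ge> 1" using s2[of s] sf S by (intro one_le_power) auto
      consider "Re s = -1 \<or> Re s = 2" | "\<bar>Im s\<bar> = R"
        using sf S by (auto simp: in_box_complex_iff)
      thus "norm (\<Phi> s) \<le> C"
      proof cases
        case 1
        have "norm (F s) / norm (s + 2) ^ M \<le> C" using bd[OF 1] sn by (simp add: field_simps)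
        moreover have "exp (- \<epsilon> * Re (cos (w s))) \<le> 1" using e cosn by simp
        ultimately show ?thesis unfolding n\<Phi> using mult_mono[of "norm (F s) / norm (s + 2) ^ M" C "exp (- \<epsilon> * Re (cos (w s)))" 1] \<open>C > 0\<close> by simp
      next
        case 2
        have ns: "norm s \<le> R + 2" using cmod_le[of s] 2 sf S by auto
        have ns1: "norm s \<ge> 1" using abs_Im_le_cmod[of s] 2 R(2) by linarith
        have "norm s powr B \<le> norm s powr b" using ns1 b by (intro powr_mono) auto
        also have "\<dots> \<le> (R + 2) powr b" using ns ns1 b by (intro powr_mono2) auto
        finally have e1: "exp (norm s powr B) \<le> exp ((R + 2) powr b)" by simp
        have A0: "A \<ge> 0" using fin[of 0] by (smt (verit) exp_gt_zero norm_ge_zero zero_le_mult_iff)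
        have "norm (F s) / norm (s + 2) ^ M \<le> norm (F s)" using sn by (simp add: divide_le_eq mult_le_cancel_left1)
        also have "\<dots> \<le> A * exp ((R + 2) powr b)" using fin[of s] mult_left_mono[OF e1 A0] by linarith
        finally have f1: "norm (F s) / norm (s + 2) ^ M \<le> A * exp ((R + 2) powr b)" .
        have "cosh (Im s / 2) = cosh (R / 2)" using 2 by (metis abs_divide abs_numeral cosh_real_abs)
        also have "\<dots> \<ge> exp (R / 2) / 2" by (simp add: cosh_def)
        finally have "cos (3/4) * (exp (R / 2) / 2) \<le> Re (cos (w s))" using cosn(1) c34 by (smt (verit) mult_left_mono)
        hence "\<epsilon> * (cos (3/4) * (exp (R / 2) / 2)) \<le> \<epsilon> * Re (cos (w s))" using e by (intro mult_left_mono) auto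
        hence "exp (- \<epsilon> * Re (cos (w s))) \<le> exp (- d * exp (R / 2))" by (simp add: d_def)
        hence "norm (\<Phi> s) \<le> A * exp ((R + 2) powr b) * exp (- d * exp (R / 2))"
          unfolding n\<Phi> by (intro mult_mono f1) (use A0 in auto)
        thus ?thesis using R(1) by linarith
      qed
    qed
    hence "norm (F s0) / norm (s0 + 2) ^ M * exp (- \<epsilon> * Re (cos (w s0))) * exp (\<epsilon> * Re (cos (w s0))) \<le> C * exp (\<epsilon> * Re (cos (w s0)))"
      unfolding n\<Phi> by (rule mult_right_mono) simp
    moreover have "exp (- \<epsilon> * Re (cos (w s0))) * exp (\<epsilon> * Re (cos (w s0))) = 1" by (simp flip: exp_add)
    ultimately have "norm (F s0) / norm (s0 + 2) ^ M \<le> C * exp (\<epsilon> * Re (cos (w s0)))"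
      by (metis mult.assoc mult.right_neutral)
    moreover have "norm (s0 + 2) ^ M > 0" using s2[OF s0(1)] by (intro zero_less_power) linarith
    ultimately show ?thesis by (simp add: pos_divide_le_eq mult_ac)
  qed
  have "((\<lambda>\<epsilon>. C * norm (s0 + 2) ^ M * exp (\<epsilon> * Re (cos (w s0)))) \<longlongrightarrow> C * norm (s0 + 2) ^ M * exp (0 * Re (cos (w s0)))) (at_right 0)"
    by (intro tendsto_intros)
  moreover have "\<forall>\<^sub>F \<epsilon> in at_right 0. norm (F s0) \<le> C * norm (s0 + 2) ^ M * exp (\<epsilon> * Re (cos (w s0)))"
    using eventually_at_right_less[of 0] by eventually_elim (rule main)
  ultimately show ?thesis using tendsto_lowerbound[OF _ _ trivial_limit_at_right_real] by fastforce
qed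

text \<open>For s = -1 + it the reflected point 1 - cnj s is 2 + it. The functional equation thus
  expresses |L(-1 + it)| through |L(2 + it)| and quotients of Gamma values with equal imaginary
  parts and real parts 3 \<open>lam k\<close> apart.\<close>

lemma selberg_left_line_growth:
  assumes "selberg_class a L"
  shows "\<exists>C M t0. C > 0 \<and> (\<forall>t. \<bar>t\<bar> \<ge> t0 \<longrightarrow> norm (L (Complex (-1) t)) \<le> C * (1 + \<bar>t\<bar>) ^ M * norm (L (Complex 2 t)))"
proof -
  obtain Q :: real and K :: nat and lam :: "nat \<Rightarrow> real" and mu :: "nat \<Rightarrow> complex" and \<omega> where
    Q: "Q > 0" and lam: "\<forall>k<K. lam k > 0" and om: "norm \<omega> = 1"
    and FE: "\<forall>s. s \<noteq> 0 \<and> s \<noteq> 1 \<and>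
             (\<forall>k<K. of_real (lam k) * s + mu k \<notin> \<int>\<^sub>\<le>\<^sub>0 \<and>
                    of_real (lam k) * (1 - cnj s) + mu k \<notin> \<int>\<^sub>\<le>\<^sub>0) \<longrightarrow>
           L s * (of_real Q powr s * (\<Prod>k<K. Gamma (of_real (lam k) * s + mu k)))
           = \<omega> * cnj ((of_real Q powr (1 - cnj s) *
                  (\<Prod>k<K. Gamma (of_real (lam k) * (1 - cnj s) + mu k))) * L (1 - cnj s))"
    using assms unfolding selberg_class_def by blast
  have "\<forall>k. \<exists>Cn. fst Cn > 0 \<and> (\<forall>y. \<bar>y\<bar> \<ge> 1 \<longrightarrow> norm (Gamma (Complex ((Re (mu k) - lam k) + 3 * lam k) y))
      \<le> fst Cn * (1 + \<bar>y\<bar>) ^ snd Cn * norm (Gamma (Complex (Re (mu k) - lam k) y)))"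
    using Gamma_quotient_poly_bound by (metis fst_conv snd_conv)
  then obtain Cn where Cn: "\<And>k. fst (Cn k) > 0" "\<And>k y. \<bar>y\<bar> \<ge> 1 \<Longrightarrow> norm (Gamma (Complex ((Re (mu k) - lam k) + 3 * lam k) y))
      \<le> fst (Cn k) * (1 + \<bar>y\<bar>) ^ snd (Cn k) * norm (Gamma (Complex (Re (mu k) - lam k) y))"
    by metis
  \<comment> \<open>Beyond t0 all Gamma arguments have imaginary part of modulus at least 1, which
    keeps them off the poles and in the range of the quotient bound.\<close>
  define t0 where "t0 = 1 + (\<Sum>k<K. (1 + \<bar>Im (mu k)\<bar>) / lam k)"
  define D where "D k = fst (Cn k) * (1 + lam k + \<bar>Im (mu k)\<bar>) ^ snd (Cn k)" for k
  \<comment> \<open>Q^3 is the quotient of |Q^s| at real parts 2 and -1.\<close>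
  define C where "C = Q ^ 3 * (\<Prod>k<K. D k)"
  define M where "M = (\<Sum>k<K. snd (Cn k))"
  have D: "D k > 0" if "k < K" for k unfolding D_def
    using Cn(1)[of k] lam that by (intro mult_pos_pos zero_less_power) (auto intro!: add_pos_nonneg)
  have "C > 0" unfolding C_def using Q D by (intro mult_pos_pos prod_pos) auto
  moreover have "norm (L (Complex (-1) t)) \<le> C * (1 + \<bar>t\<bar>) ^ M * norm (L (Complex 2 t))" if t: "\<bar>t\<bar> \<ge> t0" for t
  proof -
    let ?s = "Complex (-1) t"
    define y where "y k = lam k * t + Im (mu k)" for k
    have s': "1 - cnj ?s = Complex 2 t" by (simp add: complex_eq_iff)
    have e1: "of_real (lam k) * ?s + mu k = Complex (Re (mu k) - lam k) (y k)" for k by (simp add: complex_eq_iff y_def)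
    have e2: "of_real (lam k) * Complex 2 t + mu k = Complex ((Re (mu k) - lam k) + 3 * lam k) (y k)" for k by (simp add: complex_eq_iff y_def)
    have y1: "\<bar>y k\<bar> \<ge> 1" if k: "k < K" for k
    proof -
      have "(1 + \<bar>Im (mu k)\<bar>) / lam k \<le> (\<Sum>k<K. (1 + \<bar>Im (mu k)\<bar>) / lam k)"
        by (rule member_le_sum) (use k lam in \<open>auto intro!: divide_nonneg_pos\<close>)
      hence "(1 + \<bar>Im (mu k)\<bar>) / lam k \<le> \<bar>t\<bar>" using t by (simp add: t0_def)
      hence "1 + \<bar>Im (mu k)\<bar> \<le> lam k * \<bar>t\<bar>" using lam k by (simp add: field_simps)
      also have "\<dots> = \<bar>lam k * t\<bar>" using lam k by (simp add: abs_mult less_imp_le)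
      finally show ?thesis unfolding y_def by linarith
    qed
    have yup: "1 + \<bar>y k\<bar> \<le> (1 + lam k + \<bar>Im (mu k)\<bar>) * (1 + \<bar>t\<bar>)" if "k < K" for k
    proof -
      have "\<bar>y k\<bar> \<le> lam k * \<bar>t\<bar> + \<bar>Im (mu k)\<bar>" unfolding y_def using lam that abs_triangle_ineq[of "lam k * t" "Im (mu k)"] by (simp add: abs_mult less_imp_le)
      moreover have "0 \<le> \<bar>Im (mu k)\<bar> * \<bar>t\<bar>" "lam k > 0" using lam that by auto
      moreover have "(1 + lam k + \<bar>Im (mu k)\<bar>) * (1 + \<bar>t\<bar>) = 1 + lam k + \<bar>Im (mu k)\<bar> + \<bar>t\<bar> + lam k * \<bar>t\<bar> + \<bar>Im (mu k)\<bar> * \<bar>t\<bar>"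
        by (simp add: algebra_simps)
      ultimately show ?thesis by linarith
    qed
    have np: "Complex x (y k) \<notin> \<int>\<^sub>\<le>\<^sub>0" if "k < K" for x k
      using y1[OF that] by (auto elim!: nonpos_Ints_cases simp: complex_eq_iff)
    have "L ?s * (of_real Q powr ?s * (\<Prod>k<K. Gamma (of_real (lam k) * ?s + mu k)))
           = \<omega> * cnj ((of_real Q powr (1 - cnj ?s) *
                  (\<Prod>k<K. Gamma (of_real (lam k) * (1 - cnj ?s) + mu k))) * L (1 - cnj ?s))"
      by (rule FE[rule_format]) (use np in \<open>unfold s' e1 e2, auto simp: complex_eq_iff\<close>)
    hence "norm (L ?s * (of_real Q powr ?s * (\<Prod>k<K. Gamma (Complex (Re (mu k) - lam k) (y k)))))
       = norm (\<omega> * cnj ((of_real Q powr Complex 2 t * (\<Prod>k<K. Gamma (Complex ((Re (mu k) - lam k) + 3 * lam k) (y k)))) * L (Complex 2 t)))"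
      unfolding s' e1 e2 by (rule arg_cong)
    hence eq: "norm (L ?s) * (Q powr (-1) * (\<Prod>k<K. norm (Gamma (Complex (Re (mu k) - lam k) (y k)))))
       = (Q powr 2 * (\<Prod>k<K. norm (Gamma (Complex ((Re (mu k) - lam k) + 3 * lam k) (y k))))) * norm (L (Complex 2 t))"
      by (simp only: norm_mult complex_mod_cnj prod_norm[symmetric] om) (use Q in \<open>simp add: norm_powr_real_powr\<close>)
    have G0: "norm (Gamma (Complex (Re (mu k) - lam k) (y k))) > 0" if "k < K" for k
      using np[OF that] by (simp add: Gamma_eq_zero_iff)
    let ?G = "\<Prod>k<K. norm (Gamma (Complex (Re (mu k) - lam k) (y k)))"
    have "(\<Prod>k<K. norm (Gamma (Complex ((Re (mu k) - lam k) + 3 * lam k) (y k)))) \<le> (\<Prod>k<K. D k * (1 + \<bar>t\<bar>) ^ snd (Cn k) * norm (Gamma (Complex (Re (mu k) - lam k) (y k))))"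
    proof (intro prod_mono conjI)
      fix k assume "k \<in> {..<K}"
      hence k: "k < K" by simp
      have "(1 + \<bar>y k\<bar>) ^ snd (Cn k) \<le> ((1 + lam k + \<bar>Im (mu k)\<bar>) * (1 + \<bar>t\<bar>)) ^ snd (Cn k)"
        by (intro power_mono yup k) auto
      hence "fst (Cn k) * (1 + \<bar>y k\<bar>) ^ snd (Cn k) \<le> D k * (1 + \<bar>t\<bar>) ^ snd (Cn k)"
        unfolding D_def power_mult_distrib using Cn(1)[of k] by (simp add: mult.assoc)
      hence "fst (Cn k) * (1 + \<bar>y k\<bar>) ^ snd (Cn k) * norm (Gamma (Complex (Re (mu k) - lam k) (y k))) \<le> D k * (1 + \<bar>t\<bar>) ^ snd (Cn k) * norm (Gamma (Complex (Re (mu k) - lam k) (y k)))"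
        by (intro mult_right_mono) auto
      thus "norm (Gamma (Complex ((Re (mu k) - lam k) + 3 * lam k) (y k))) \<le> D k * (1 + \<bar>t\<bar>) ^ snd (Cn k) * norm (Gamma (Complex (Re (mu k) - lam k) (y k)))"
        using Cn(2)[OF y1[OF k]] by (rule order_trans[rotated])
    qed auto
    also have "\<dots> = (\<Prod>k<K. D k) * (1 + \<bar>t\<bar>) ^ M * ?G"
      unfolding M_def by (simp add: prod.distrib power_sum)
    finally have "norm (L ?s) * (Q powr (-1) * ?G) \<le> (Q powr 2 * ((\<Prod>k<K. D k) * (1 + \<bar>t\<bar>) ^ M * ?G)) * norm (L (Complex 2 t))"
      unfolding eq using Q by (intro mult_right_mono mult_left_mono) auto
    also have "Q powr 2 * ((\<Prod>k<K. D k) * (1 + \<bar>t\<bar>) ^ M * ?G) * norm (L (Complex 2 t)) = (C * (1 + \<bar>t\<bar>) ^ M * norm (L (Complex 2 t))) * (Q powr (-1) * ?G)"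
      using Q by (simp add: C_def powr_minus field_simps power3_eq_cube power2_eq_square)
    finally have "norm (L ?s) * (Q powr (-1) * ?G) \<le> (C * (1 + \<bar>t\<bar>) ^ M * norm (L (Complex 2 t))) * (Q powr (-1) * ?G)" .
    moreover have "?G > 0" by (rule prod_pos) (simp only: lessThan_iff G0)
    hence "Q powr (-1) * ?G > 0" using Q by simp
    ultimately show ?thesis by (rule mult_right_le_imp_le)
  qed
  ultimately show ?thesis by blast
qed

lemma selberg_bounded_right:
  assumes "selberg_class a L"
  shows "\<exists>A>0. \<forall>s. Re s \<ge> 2 \<longrightarrow> norm (L s) \<le> A"
proof -
  have sm: "\<And>s. Re s > 1 \<Longrightarrow> summable (\<lambda>n. norm (a n / of_nat n powr s)) \<and> L s = (\<Sum>n. a n / of_nat n powr s)"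
    using assms unfolding selberg_class_def by blast
  define u where "u n = norm (a n / of_nat n powr (2::complex))" for n
  have su: "summable u" using sm[of 2] unfolding u_def by simp
  have "norm (L s) \<le> suminf u" if "Re s \<ge> 2" for s
  proof -
    have "norm (a n / of_nat n powr s) \<le> u n" for n
    proof (cases "n = 0")
      case False
      have "real n powr Re 2 \<le> real n powr Re s" using False that by (intro powr_mono) auto
      moreover have "norm (of_nat n powr z :: complex) = real n powr Re z" for z by (subst norm_powr_real_powr) auto
      ultimately show ?thesis using False unfolding u_def norm_divide
        by (simp only:) (auto intro!: divide_left_mono)
    qed (auto simp: u_def)
    hence "norm (\<Sum>n. a n / of_nat n powr s) \<le> suminf u" by (rule norm_suminf_le[OF _ su])
    thus ?thesis using sm[of s] that by simp
  qed
  thus ?thesis by (intro exI[of _ "\<bar>suminf u\<bar> + 1"]) (force intro: order_trans[of _ "suminf u"])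
qed

text \<open>Convexity is applied to the entire function (s - 1)^m L(s), bounded by a power of |s +
  2| on the lines -1 and 2. The condition |Im s| \<ge> 1 then allows division by (s - 1)^m.\<close>

lemma selberg_poly_growth:
  assumes "selberg_class a L"
  shows "\<exists>C M. C > 0 \<and> (\<forall>s. Re s \<ge> -1 \<and> \<bar>Im s\<bar> \<ge> 1 \<longrightarrow> norm (L s) \<le> C * (1 + \<bar>Im s\<bar>) ^ M)"
proof -
  obtain A where A: "A > 0" "\<And>s. Re s \<ge> 2 \<Longrightarrow> norm (L s) \<le> A" using selberg_bounded_right[OF assms] by blast
  obtain m :: nat and F :: "complex \<Rightarrow> complex" and FA FB :: real where F: "F holomorphic_on UNIV"
    "\<And>s. s \<noteq> 1 \<Longrightarrow> F s = (s - 1) ^ m * L s" "\<And>s. norm (F s) \<le> FA * exp (norm s powr FB)"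
    using assms unfolding selberg_class_def by blast
  obtain C0 M t0 where C0: "C0 > 0" "\<And>t. \<bar>t\<bar> \<ge> t0 \<Longrightarrow> norm (L (Complex (-1) t)) \<le> C0 * (1 + \<bar>t\<bar>) ^ M * norm (L (Complex 2 t))"
    using selberg_left_line_growth[OF assms] by blast
  have "compact ((\<lambda>t. F (Complex (-1) t)) ` {-\<bar>t0\<bar>..\<bar>t0\<bar>})"
    by (intro compact_continuous_image continuous_on_compose2[OF holomorphic_on_imp_continuous_on[OF F(1)]] continuous_intros) auto
  then obtain B where B: "\<And>t. \<bar>t\<bar> \<le> \<bar>t0\<bar> \<Longrightarrow> norm (F (Complex (-1) t)) \<le> B"
    by (force dest!: compact_imp_bounded simp: bounded_iff abs_le_iff)
  \<comment> \<open>The summands serve, in this order, the line Re s = 2, the compact piece |t|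
    \<le> |t0| of the line -1, and the rest of that line, where |s - 1| \<le> 4|s + 2| and 1 + |Im
    s| \<le> 2|s + 2|.\<close>
  define C where "C = A + \<bar>B\<bar> + 4 ^ m * (C0 * 2 ^ M * A)"
  have C: "C > 0" unfolding C_def using A C0 by (auto intro!: add_pos_nonneg)
  have bd: "norm (F s) \<le> C * norm (s + 2) ^ (m + M)" if s: "Re s = -1 \<or> Re s = 2" for s
  proof -
    have s2: "norm (s + 2) \<ge> 1" using complex_Re_le_cmod[of "s + 2"] s by auto
    have p1: "1 \<le> norm (s + 2) ^ n" for n using s2 by (rule one_le_power)
    have Cge: "C \<ge> A" "C \<ge> \<bar>B\<bar>" "C \<ge> 4 ^ m * (C0 * 2 ^ M * A)" unfolding C_def using A C0 by auto
    consider "Re s = 2" | "Re s = -1" "\<bar>Im s\<bar> \<le> \<bar>t0\<bar>" | "Re s = -1" "\<bar>Im s\<bar> \<ge> t0" using s by linarith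
    thus ?thesis
    proof cases
      case 1
      have "norm (s - 1) \<le> norm (s + 2)" unfolding cmod_def using 1 by simp
      hence "norm (s - 1) ^ m * norm (L s) \<le> norm (s + 2) ^ m * A" using 1 A(2)[of s] by (intro mult_mono power_mono) auto
      also have "\<dots> \<le> norm (s + 2) ^ (m + M) * C" using A Cge p1[of M]
        by (intro mult_mono power_increasing s2) auto
      finally have "norm ((s - 1) ^ m * L s) \<le> C * norm (s + 2) ^ (m + M)" by (simp add: norm_mult norm_power mult_ac)
      moreover have "s \<noteq> 1" using 1 by auto
      ultimately show ?thesis using F(2)[of s] by simp
    next
      case 2
      have "norm (F s) \<le> B" using B[of "Im s"] 2 by (metis complex_surj)
      also have "\<dots> \<le> C * norm (s + 2) ^ (m + M)" using Cge p1[of "m+M"] C mult_mono[of B C 1 "norm (s + 2) ^ (m + M)"] by simp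
      finally show ?thesis .
    next
      case 3
      have sc: "s = Complex (-1) (Im s)" using 3 by (simp add: complex_eq_iff)
      have "norm (s - 1) \<le> norm (s + 2) + norm (3::complex)" using norm_triangle_ineq4[of "s + 2" 3] by simp
      hence n1: "norm (s - 1) \<le> 4 * norm (s + 2)" using s2 by simp
      have n2: "1 + \<bar>Im s\<bar> \<le> 2 * norm (s + 2)" using abs_Im_le_cmod[of "s + 2"] s2 by simp
      have "norm (L s) \<le> C0 * (1 + \<bar>Im s\<bar>) ^ M * norm (L (Complex 2 (Im s)))" using C0(2)[OF 3(2)] sc by metis
      also have "\<dots> \<le> C0 * (2 * norm (s + 2)) ^ M * A" using C0 A n2 by (intro mult_mono power_mono A(2)) auto
      finally have "norm (s - 1) ^ m * norm (L s) \<le> (4 * norm (s + 2)) ^ m * (C0 * (2 * norm (s + 2)) ^ M * A)"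
        using n1 by (intro mult_mono power_mono) auto
      also have "\<dots> = 4 ^ m * (C0 * 2 ^ M * A) * norm (s + 2) ^ (m + M)" by (simp add: power_mult_distrib power_add mult_ac)
      also have "\<dots> \<le> C * norm (s + 2) ^ (m + M)" using Cge by (intro mult_right_mono) auto
      finally have "norm ((s - 1) ^ m * L s) \<le> C * norm (s + 2) ^ (m + M)" by (simp add: norm_mult norm_power)
      moreover have "s \<noteq> 1" using 3 by auto
      ultimately show ?thesis using F(2)[of s] by simp
    qed
  qed
  have "norm (L s) \<le> (C * 4 ^ (m + M) + A) * (1 + \<bar>Im s\<bar>) ^ (m + M)" if s: "Re s \<ge> -1" "\<bar>Im s\<bar> \<ge> 1" for s
  proof (cases "Re s \<ge> 2")
    case True
    have "norm (L s) \<le> A * 1" using A(2)[OF True] by simp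
    also have "\<dots> \<le> (C * 4 ^ (m + M) + A) * (1 + \<bar>Im s\<bar>) ^ (m + M)"
      using A C by (intro mult_mono one_le_power) auto
    finally show ?thesis .
  next
    case False
    have "1 \<le> norm (s - 1)" using abs_Im_le_cmod[of "s - 1"] s by simp
    hence "norm (L s) \<le> norm (s - 1) ^ m * norm (L s)" by (simp add: mult_le_cancel_right1)
    also have "\<dots> = norm ((s - 1) ^ m * L s)" by (simp add: norm_mult norm_power)
    also have "\<dots> = norm (F s)" using F(2)[of s] s by force
    also have "\<dots> \<le> C * norm (s + 2) ^ (m + M)"
      by (rule phragmen_lindelof_strip[OF F(1) F(3) C bd]) (use s False in auto)
    also have "\<dots> \<le> C * (4 * (1 + \<bar>Im s\<bar>)) ^ (m + M)"
    proof (intro mult_left_mono power_mono)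
      show "norm (s + 2) \<le> 4 * (1 + \<bar>Im s\<bar>)" using cmod_le[of "s + 2"] s False by simp
    qed (use C in auto)
    also have "\<dots> = (C * 4 ^ (m + M)) * (1 + \<bar>Im s\<bar>) ^ (m + M)" by (simp only: power_mult_distrib mult.assoc)
    also have "\<dots> \<le> (C * 4 ^ (m + M) + A) * (1 + \<bar>Im s\<bar>) ^ (m + M)" using A by (intro mult_right_mono) auto
    finally show ?thesis .
  qed
  thus ?thesis using C A by (intro exI[of _ "C * 4 ^ (m + M) + A"] exI[of _ "m + M"]) (auto intro!: add_pos_pos)
qed

section \<open>The branch of the logarithm\<close>

text \<open>Two logarithms of the same function differ by values in 2 pi i Z, a discrete set, and a
  continuous function with discrete values on a connected set is constant.\<close>

lemma exp_lifts_differ_by_constant: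
  fixes g1 g2 :: "'a::metric_space \<Rightarrow> complex"
  assumes "connected S" "continuous_on S g1" "continuous_on S g2"
    and "\<And>u. u \<in> S \<Longrightarrow> exp (g1 u) = exp (g2 u)"
  shows "(\<lambda>u. g1 u - g2 u) constant_on S"
proof (rule continuous_discrete_range_constant[OF assms(1)])
  show "continuous_on S (\<lambda>u. g1 u - g2 u)" using assms by (intro continuous_intros)
  fix x assume x: "x \<in> S"
  have *: "\<exists>n::int. g1 y - g2 y = of_int (2 * n) * pi * \<i>" if "y \<in> S" for y
    using assms(4)[OF that] unfolding exp_eq by (auto simp: algebra_simps)
  show "\<exists>e>0. \<forall>y. y \<in> S \<and> g1 y - g2 y \<noteq> g1 x - g2 x \<longrightarrow>
      e \<le> cmod (g1 y - g2 y - (g1 x - g2 x))"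
  proof (intro exI[of _ "2 * pi"] conjI allI impI)
    fix y assume y: "y \<in> S \<and> g1 y - g2 y \<noteq> g1 x - g2 x"
    obtain n m :: int where n: "g1 y - g2 y = of_int (2 * n) * pi * \<i>"
      and m: "g1 x - g2 x = of_int (2 * m) * pi * \<i>"
      using * x y by blast
    have "n \<noteq> m" using y n m by auto
    hence "1 \<le> \<bar>n - m\<bar>" by linarith
    hence 1: "1 \<le> \<bar>real_of_int (n - m)\<bar>" by (metis of_int_1_le_iff of_int_abs)
    have "g1 y - g2 y - (g1 x - g2 x) = of_real (2 * pi * real_of_int (n - m)) * \<i>"
      using n m by (simp add: algebra_simps)
    hence "cmod (g1 y - g2 y - (g1 x - g2 x)) = 2 * pi * \<bar>real_of_int (n - m)\<bar>"
      by (simp only: norm_mult norm_of_real) (simp add: abs_mult)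
    thus "2 * pi \<le> cmod (g1 y - g2 y - (g1 x - g2 x))" using 1 by simp
  qed auto
qed

lemma exp_lifts_eq:
  fixes g1 g2 :: "'a::metric_space \<Rightarrow> complex"
  assumes "connected S" "continuous_on S g1" "continuous_on S g2"
    and "\<And>u. u \<in> S \<Longrightarrow> exp (g1 u) = exp (g2 u)"
    and "u0 \<in> S" "g1 u0 = g2 u0" "u \<in> S"
  shows "g1 u = g2 u"
  using exp_lifts_differ_by_constant[OF assms(1-4)] assms(5-7)
  unfolding constant_on_def by (metis eq_iff_diff_eq_0)

text \<open>Lifts of a path with given start are unique, so the definite description is determined
  as soon as one lift is exhibited.\<close>

lemma lift_log_along_eq:
  assumes "continuous_on {0..1} g" "\<And>u. u \<in> {0..1} \<Longrightarrow> exp (g u) = L (\<gamma> u)" "g 0 = v"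
  shows "lift_log_along L \<gamma> v = g 1"
  unfolding lift_log_along_def
proof (rule the_equality)
  show "\<exists>h. continuous_on {0..1} h \<and> (\<forall>u\<in>{0..1}. exp (h u) = L (\<gamma> u)) \<and> h 0 = v \<and> h 1 = g 1"
    using assms by blast
next
  fix w assume "\<exists>h. continuous_on {0..1} h \<and> (\<forall>u\<in>{0..1}. exp (h u) = L (\<gamma> u)) \<and> h 0 = v \<and> h 1 = w"
  then obtain h where h: "continuous_on {0..1} h" "\<forall>u\<in>{0..1}. exp (h u) = L (\<gamma> u)" "h 0 = v" "h 1 = w"
    by blast
  have "h 1 = g 1"
    by (rule exp_lifts_eq[of "{0..1::real}" h g 0]) (use h assms in auto)
  thus "w = g 1" using h by simp
qed

text \<open>Lifts along the ray are unique up to an additive constant, and the limit 0 at infinity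
  fixes that constant.\<close>

lemma log_L_at_2_eq:
  assumes g: "continuous_on {2..} g" "\<And>\<sigma>. \<sigma> \<ge> 2 \<Longrightarrow> exp (g \<sigma>) = L (of_real \<sigma>)" "(g \<longlongrightarrow> 0) at_top"
  shows "log_L_at_2 L = g 2"
  unfolding log_L_at_2_def
proof (rule the_equality)
  show "\<exists>h. continuous_on {2..} h \<and> (\<forall>\<sigma>\<ge>2. exp (h \<sigma>) = L (of_real \<sigma>)) \<and> (h \<longlongrightarrow> 0) at_top \<and> h 2 = g 2"
    using g by blast
next
  fix w assume "\<exists>h. continuous_on {2..} h \<and> (\<forall>\<sigma>\<ge>2. exp (h \<sigma>) = L (of_real \<sigma>)) \<and> (h \<longlongrightarrow> 0) at_top \<and> h 2 = w"
  then obtain h where h: "continuous_on {2..} h" "\<forall>\<sigma>\<ge>2. exp (h \<sigma>) = L (of_real \<sigma>)"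
    "(h \<longlongrightarrow> 0) at_top" "h 2 = w" by blast
  have "(\<lambda>u. h u - g u) constant_on {2..}"
    by (rule exp_lifts_differ_by_constant) (use g h in auto)
  then obtain c where c: "\<And>u. u \<ge> 2 \<Longrightarrow> h u - g u = c" unfolding constant_on_def by auto
  have "((\<lambda>u. h u - g u) \<longlongrightarrow> 0 - 0) at_top" by (intro tendsto_intros h g)
  moreover have "\<forall>\<^sub>F u in at_top. h u - g u = c"
    using eventually_ge_at_top[of 2] by eventually_elim (use c in auto)
  hence "((\<lambda>u. h u - g u) \<longlongrightarrow> c) at_top" by (rule tendsto_eventually)
  ultimately have "c = 0" by (metis diff_zero tendsto_unique trivial_limit_at_top_linorder)
  thus "w = g 2" using c[of 2] h by simp
qed

text \<open>Both path liftings are restrictions of known functions: \<open>G\<close> serves the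
  vertical segment on Re s = 2, \<open>g\<close> the horizontal one inside the convex set. Agreement
  at the common endpoint glues them.\<close>

lemma log_L_eq:
  assumes G: "continuous_on {s. Re s \<ge> 2} G" "\<And>s. Re s \<ge> 2 \<Longrightarrow> exp (G s) = L s"
    "((\<lambda>\<sigma>. G (of_real \<sigma>)) \<longlongrightarrow> 0) at_top"
    and g: "continuous_on S g" "convex S" "\<And>z. z \<in> S \<Longrightarrow> exp (g z) = L z"
    and S: "2 + \<i> * of_real (Im s) \<in> S" "s \<in> S"
    and eq: "g (2 + \<i> * of_real (Im s)) = G (2 + \<i> * of_real (Im s))"
  shows "log_L L s = g s"
proof -
  have 1: "log_L_at_2 L = G (of_real 2)"
  proof (rule log_L_at_2_eq[of "\<lambda>\<sigma>. G (of_real \<sigma>)"])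
    show "continuous_on {2..} (\<lambda>\<sigma>. G (of_real \<sigma>))"
      by (rule continuous_on_compose2[OF G(1)]) (auto intro!: continuous_intros)
  qed (use G in auto)
  let ?c = "2 + \<i> * of_real (Im s)"
  have re2: "Re (linepath 2 ?c u) = 2" for u by (simp add: linepath_def algebra_simps)
  have cl: "continuous_on {0..1} (linepath x y)" for x y :: complex
    using path_linepath unfolding path_def by blast
  have 2: "lift_log_along L (linepath 2 ?c) (G 2) = G (linepath 2 ?c 1)"
  proof (rule lift_log_along_eq)
    show "continuous_on {0..1} (\<lambda>u. G (linepath 2 ?c u))"
      by (rule continuous_on_compose2[OF G(1)]) (use re2 cl in auto)
    show "exp (G (linepath 2 ?c u)) = L (linepath 2 ?c u)" for u
      by (rule G(2)) (simp add: re2)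
  qed (simp add: linepath_def)
  have inS: "linepath ?c s u \<in> S" if "u \<in> {0..1}" for u
    using convex_contains_segment[of S] g(2) S linepath_in_path[of u ?c s] that by blast
  have 3: "lift_log_along L (linepath ?c s) (g ?c) = g (linepath ?c s 1)"
  proof (rule lift_log_along_eq)
    show "continuous_on {0..1} (\<lambda>u. g (linepath ?c s u))"
      by (rule continuous_on_compose2[OF g(1)]) (use inS cl in auto)
  qed (use inS g in \<open>auto simp: linepath_def\<close>)
  show ?thesis unfolding log_L_def using 1 2 3 eq by (simp add: linepath_def)
qed

text \<open>The map v -> v/(2A - v) takes the half-plane Re v < A into the unit disc and fixes 0, so
  Schwarz's lemma applies after rescaling. Only an upper bound for Re f enters, which for f = log L
  is a bound for |L|. The distance R - |z - c| to the circle stays explicit because the kernel has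
  to compensate it.\<close>

lemma borel_caratheodory:
  assumes hol: "f holomorphic_on ball c R" and "R > 0" "A > 0" "f c = 0"
    and bd: "\<And>z. z \<in> ball c R \<Longrightarrow> Re (f z) < A" and z: "z \<in> ball c R"
  shows "norm (f z) \<le> 2 * A * dist c z / (R - dist c z)"
proof -
  define h where "h w = f (c + of_real R * w) / (2 * of_real A - f (c + of_real R * w))" for w
  have inb: "c + of_real R * w \<in> ball c R" if "norm w < 1" for w :: complex
    using that \<open>R > 0\<close> by (simp add: dist_norm norm_mult)
  have ne: "2 * of_real A - f (c + of_real R * w) \<noteq> 0" if "norm w < 1" for w :: complex
  proof
    assume "2 * of_real A - f (c + of_real R * w) = 0"
    hence "Re (f (c + of_real R * w)) = 2 * A" by (simp add: complex_eq_iff)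
    thus False using bd[OF inb[OF that]] \<open>A > 0\<close> by linarith
  qed
  have "(\<lambda>w. f (c + of_real R * w)) holomorphic_on ball 0 1"
    by (rule holomorphic_on_compose_gen[OF _ hol, unfolded o_def])
       (use inb in \<open>auto intro!: holomorphic_intros\<close>)
  hence holh: "h holomorphic_on ball 0 1" unfolding h_def
    by (intro holomorphic_intros) (use ne in auto)
  have lt: "norm (h w) < 1" if "norm w < 1" for w
  proof -
    let ?v = "f (c + of_real R * w)"
    have r: "Re ?v < A" by (rule bd[OF inb[OF that]])
    have "(cmod ?v)\<^sup>2 < (cmod (2 * of_real A - ?v))\<^sup>2"
    proof -
      have "0 < 4 * A * (A - Re ?v)" using r \<open>A > 0\<close> by simp
      thus ?thesis unfolding cmod_power2 by (simp add: power2_eq_square algebra_simps)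
    qed
    hence "cmod ?v < cmod (2 * of_real A - ?v)" by (rule power2_less_imp_less) simp
    thus ?thesis unfolding h_def using ne[OF that] by (simp add: norm_divide)
  qed
  define w where "w = (z - c) / of_real R"
  have zc: "c + of_real R * w = z" using \<open>R > 0\<close> by (simp add: w_def)
  have nw: "norm w = dist c z / R" using \<open>R > 0\<close> by (simp add: w_def norm_divide dist_norm norm_minus_commute)
  have nw1: "norm w < 1" using z \<open>R > 0\<close> by (simp add: nw)
  have h0: "h 0 = 0" by (simp add: h_def \<open>f c = 0\<close>)
  have "norm (h w) \<le> norm w" by (rule Schwarz_Lemma(1)[OF holh h0 lt nw1])
  hence "norm (f z) / norm (2 * of_real A - f z) \<le> dist c z / R"
    by (simp add: h_def zc nw norm_divide)
  moreover have "norm (2 * of_real A - f z) > 0" using ne[OF nw1] zc by simp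
  ultimately have "norm (f z) * R \<le> dist c z * norm (2 * of_real A - f z)"
    using \<open>R > 0\<close> by (simp add: field_simps)
  also have "\<dots> \<le> dist c z * (2 * A + norm (f z))"
    using norm_triangle_ineq4[of "2 * of_real A" "f z"] \<open>A > 0\<close>
    by (intro mult_left_mono) (auto simp: norm_mult)
  finally have "norm (f z) * (R - dist c z) \<le> 2 * A * dist c z" by (simp add: algebra_simps)
  thus ?thesis using z by (simp add: field_simps)
qed

section \<open>The smoothing kernel\<close>

text \<open>As dz = i du, this carries a factor \<i> compared with the integral over the height
  u.\<close>

definition vline_integral :: "real \<Rightarrow> real \<Rightarrow> (complex \<Rightarrow> complex) \<Rightarrow> complex" where
  "vline_integral c U f = contour_integral (linepath (Complex c (-U)) (Complex c U)) f"

text \<open>Cauchy's theorem on a rectangle leaves the two horizontal edges, each of length |c2 -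
  c1|.\<close>

lemma vertical_line_shift:
  assumes f: "f holomorphic_on S" "convex S" and "U \<ge> 0" "B \<ge> 0"
    and S: "Complex c1 (-U) \<in> S" "Complex c1 U \<in> S" "Complex c2 (-U) \<in> S" "Complex c2 U \<in> S"
    and B: "\<And>x. x \<in> closed_segment c1 c2 \<Longrightarrow> norm (f (Complex x U)) \<le> B \<and> norm (f (Complex x (-U))) \<le> B"
  shows "norm (vline_integral c2 U f - vline_integral c1 U f) \<le> 2 * B * \<bar>c2 - c1\<bar>"
proof -
  let ?a = "Complex c1 (-U)" and ?b = "Complex c2 (-U)" and ?c = "Complex c2 U" and ?d = "Complex c1 U"
  have seg: "closed_segment x y \<subseteq> S" if "x \<in> S" "y \<in> S" for x y
    using f(2) that by (simp add: closed_segment_subset)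
  have int: "f contour_integrable_on linepath x y" if "x \<in> S" "y \<in> S" for x y
    by (intro contour_integrable_continuous_linepath continuous_on_subset[OF holomorphic_on_imp_continuous_on[OF f(1)]] seg that)
  have "(f has_contour_integral 0) (linepath ?a ?b +++ linepath ?b ?c +++ linepath ?c ?d +++ linepath ?d ?a)"
  proof (rule Cauchy_theorem_convex_simple[OF f])
    show "path_image (linepath ?a ?b +++ linepath ?b ?c +++ linepath ?c ?d +++ linepath ?d ?a) \<subseteq> S"
      using seg S by (intro subset_path_image_join) auto
  qed auto
  hence "contour_integral (linepath ?a ?b +++ linepath ?b ?c +++ linepath ?c ?d +++ linepath ?d ?a) f = 0"
    by (rule contour_integral_unique)
  hence "contour_integral (linepath ?a ?b) f + (contour_integral (linepath ?b ?c) f + (contour_integral (linepath ?c ?d) f + contour_integral (linepath ?d ?a) f)) = 0"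
    by (simp add: int S)
  moreover have "contour_integral (linepath ?d ?a) f = - contour_integral (linepath ?a ?d) f"
    by (rule contour_integral_reverse_linepath) (use continuous_on_subset[OF holomorphic_on_imp_continuous_on[OF f(1)] seg] S in auto)
  ultimately have "vline_integral c2 U f - vline_integral c1 U f = - contour_integral (linepath ?a ?b) f - contour_integral (linepath ?c ?d) f"
    unfolding vline_integral_def by (simp add: algebra_simps eq_neg_iff_add_eq_0)
  also have "norm \<dots> \<le> norm (contour_integral (linepath ?a ?b) f) + norm (contour_integral (linepath ?c ?d) f)"
    by (metis norm_minus_cancel norm_triangle_ineq4)
  also have "norm (contour_integral (linepath ?a ?b) f) \<le> B * norm (?b - ?a)"
  proof (rule contour_integral_bound_linepath)
    fix z assume "z \<in> closed_segment ?a ?b"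
    hence z: "Complex (Re z) (-U) = z" "Re z \<in> closed_segment c1 c2" by (auto simp: closed_segment_same_Im complex_eq_iff)
    show "norm (f z) \<le> B" using B[OF z(2)] unfolding z(1) by simp
  qed (use int S \<open>B \<ge> 0\<close> in auto)
  also have "norm (contour_integral (linepath ?c ?d) f) \<le> B * norm (?d - ?c)"
  proof (rule contour_integral_bound_linepath)
    fix z assume "z \<in> closed_segment ?c ?d"
    hence z: "Complex (Re z) U = z" "Re z \<in> closed_segment c1 c2" by (auto simp: closed_segment_same_Im complex_eq_iff closed_segment_commute)
    show "norm (f z) \<le> B" using B[OF z(2)] unfolding z(1) by simp
  qed (use int S \<open>B \<ge> 0\<close> in auto)
  also have "norm (?b - ?a) = \<bar>c2 - c1\<bar>" by (simp add: cmod_def)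
  also have "norm (?d - ?c) = \<bar>c2 - c1\<bar>" by (simp add: cmod_def)
  finally show ?thesis by simp
qed

lemma vline_integral_bound:
  assumes "continuous_on {z. Re z = c} f" "U \<ge> 0" "B \<ge> 0" "\<And>y. \<bar>y\<bar> \<le> U \<Longrightarrow> norm (f (Complex c y)) \<le> B"
  shows "norm (vline_integral c U f) \<le> B * (2 * U)"
proof -
  have seg: "closed_segment (Complex c (-U)) (Complex c U) = {z. Re z = c \<and> \<bar>Im z\<bar> \<le> U}"
    using \<open>U \<ge> 0\<close> by (auto simp: closed_segment_same_Re closed_segment_eq_real_ivl)
  have "norm (vline_integral c U f) \<le> B * norm (Complex c U - Complex c (-U))"
    unfolding vline_integral_def
  proof (rule contour_integral_bound_linepath)
    show "f contour_integrable_on linepath (Complex c (-U)) (Complex c U)"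
      by (intro contour_integrable_continuous_linepath continuous_on_subset[OF assms(1)]) (auto simp: seg)
    fix z assume "z \<in> closed_segment (Complex c (-U)) (Complex c U)"
    hence z: "Complex c (Im z) = z" "\<bar>Im z\<bar> \<le> U" by (auto simp: seg complex_eq_iff)
    show "norm (f z) \<le> B" using assms(4)[OF z(2)] unfolding z(1) by simp
  qed fact
  also have "norm (Complex c U - Complex c (-U)) = 2 * U" using \<open>U \<ge> 0\<close> by (simp add: cmod_def real_sqrt_mult)
  finally show ?thesis .
qed

section \<open>The kernel and its transform\<close>

definition sinhc :: "complex \<Rightarrow> complex" where
  "sinhc z = (if z = 0 then 1 else sinh z / z)"

text \<open>Entire of exponential type 4/16 = 1/4, and equal to \<open>smoothing_kernel_re\<close>
  on the imaginary axis. The fourth power yields the decay U^-4 at distance U and a second moment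
  bounded independently of U; the last factor vanishes at z = iU and z = -iU.\<close>

definition smoothing_kernel :: "real \<Rightarrow> complex \<Rightarrow> complex" where
  "smoothing_kernel U z = sinhc (z / 16) ^ 4 * (1 + z\<^sup>2 / of_real U ^ 2)"

definition smoothing_kernel_re :: "real \<Rightarrow> real \<Rightarrow> real" where
  "smoothing_kernel_re U u = (if u = 0 then 1 else sin (u / 16) / (u / 16)) ^ 4 * (1 - u\<^sup>2 / U\<^sup>2)"

text \<open>The Fourier-Laplace transform of the truncated kernel at frequency x, taken over the
  line Re z = \<delta>. It is concentrated on |x| < 1/2 because the kernel has type 1/4.\<close>

definition freq_integral :: "real \<Rightarrow> real \<Rightarrow> real \<Rightarrow> complex" where
  "freq_integral \<delta> U x = vline_integral \<delta> U (\<lambda>z. exp (- (of_real x * z)) * smoothing_kernel U z)"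

lemma sinhc_holomorphic: "sinhc holomorphic_on UNIV"
proof -
  have "deriv sinh (0::complex) = 1" by (rule DERIV_imp_deriv) (auto intro!: derivative_eq_intros)
  hence "sinhc = (\<lambda>z. if z = 0 then deriv sinh 0 else (sinh z - sinh 0) / (z - 0))"
    by (auto simp: sinhc_def fun_eq_iff)
  moreover have "sinh holomorphic_on (UNIV :: complex set)"
    unfolding holomorphic_on_def field_differentiable_def by (auto intro!: exI derivative_eq_intros)
  ultimately show ?thesis using pole_lemma_open[of sinh UNIV 0] by simp
qed

lemma smoothing_kernel_holomorphic [holomorphic_intros]: "smoothing_kernel U holomorphic_on A"
proof -
  have "(\<lambda>z. sinhc (z / 16)) holomorphic_on UNIV"
  proof -
    have "(\<lambda>z::complex. z / 16) holomorphic_on UNIV" by (intro holomorphic_intros) auto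
    from holomorphic_on_compose_gen[OF this sinhc_holomorphic] show ?thesis by (simp add: o_def)
  qed
  hence "(\<lambda>z. sinhc (z / 16)) holomorphic_on A" by (rule holomorphic_on_subset) auto
  thus ?thesis unfolding smoothing_kernel_def
    by (cases "U = 0") (auto intro!: holomorphic_intros)
qed

lemma norm_sinh_le: "norm (sinh z :: complex) \<le> exp \<bar>Re z\<bar>"
proof -
  have "norm (sinh z) \<le> (norm (exp z) + norm (exp (- z))) / 2"
    unfolding sinh_def using norm_triangle_ineq4[of "exp z" "exp (- z)"] by (simp add: norm_divide scaleR_conv_of_real norm_mult)
  also have "\<dots> = (exp (Re z) + exp (- Re z)) / 2" by simp
  also have "\<dots> \<le> exp \<bar>Re z\<bar>" by (simp add: abs_if)
  finally show ?thesis .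
qed

lemma norm_sinhc_le:
  assumes "norm z \<ge> r" "r > 0" shows "norm (sinhc z) \<le> exp \<bar>Re z\<bar> / r"
proof -
  have "norm (sinhc z) = norm (sinh z) / norm z" using assms by (auto simp: sinhc_def norm_divide)
  also have "\<dots> \<le> exp \<bar>Re z\<bar> / r" by (intro frac_le norm_sinh_le) (use assms in auto)
  finally show ?thesis .
qed

lemma cos_ge_1_minus_half_square: "cos y \<ge> 1 - y\<^sup>2 / (2::real)"
proof -
  have "(sin (y / 2))\<^sup>2 \<le> (y / 2)\<^sup>2" using abs_sin_x_le_abs_x[of "y / 2"] unfolding abs_le_square_iff .
  moreover have "cos y = 1 - 2 * (sin (y / 2))\<^sup>2" using cos_double_sin[of "y / 2"] by simp
  ultimately show ?thesis by (simp add: power_divide)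
qed

lemma norm_smoothing_kernel_le:
  assumes "norm z \<ge> U" "U > 0"
  shows "norm (smoothing_kernel U z) \<le> exp (\<bar>Re z\<bar> / 4) * (16 / U) ^ 4 * norm (1 + z\<^sup>2 / of_real U ^ 2)"
proof -
  have "norm (sinhc (z / 16)) \<le> exp \<bar>Re (z / 16)\<bar> / (U / 16)"
    by (rule norm_sinhc_le) (use assms in \<open>auto simp: norm_divide\<close>)
  hence "norm (sinhc (z / 16)) ^ 4 \<le> (exp \<bar>Re (z / 16)\<bar> / (U / 16)) ^ 4" by (intro power_mono) auto
  also have "\<dots> = exp (\<bar>Re z\<bar> / 4) * (16 / U) ^ 4"
    by (simp add: power_divide power_mult_distrib flip: exp_of_nat_mult)
  finally show ?thesis unfolding smoothing_kernel_def norm_mult norm_power by (intro mult_right_mono) auto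
qed

lemma norm_smoothing_kernel_le':
  assumes "norm z \<ge> U" "U > 0" "\<bar>Re z\<bar> \<le> U" "\<bar>Im z\<bar> \<le> U"
  shows "norm (smoothing_kernel U z) \<le> 3 * 16 ^ 4 * exp (\<bar>Re z\<bar> / 4) / U ^ 4"
proof -
  have "norm z ^ 2 = (Re z)\<^sup>2 + (Im z)\<^sup>2" by (rule cmod_power2)
  also have "\<dots> \<le> U\<^sup>2 + U\<^sup>2" using assms by (intro add_mono) (auto simp: abs_le_square_iff[symmetric])
  finally have "norm z ^ 2 / U\<^sup>2 \<le> 2" using assms by (simp add: field_simps)
  moreover have "norm (1 + z\<^sup>2 / of_real U ^ 2) \<le> norm (1::complex) + norm (z\<^sup>2 / of_real U ^ 2)" by (rule norm_triangle_ineq)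
  hence "norm (1 + z\<^sup>2 / of_real U ^ 2) \<le> 1 + norm z ^ 2 / U\<^sup>2" by (simp add: norm_divide norm_power)
  ultimately have "norm (1 + z\<^sup>2 / of_real U ^ 2) \<le> 3" by simp
  hence "exp (\<bar>Re z\<bar> / 4) * (16 / U) ^ 4 * norm (1 + z\<^sup>2 / of_real U ^ 2) \<le> exp (\<bar>Re z\<bar> / 4) * (16 / U) ^ 4 * 3"
    by (intro mult_left_mono) (use assms in auto)
  thus ?thesis using norm_smoothing_kernel_le[OF assms(1,2)] by (simp add: power_divide mult_ac)
qed

lemma freq_integrand_holomorphic: "(\<lambda>z. exp (- (of_real x * z)) * smoothing_kernel U z) holomorphic_on A"
  by (intro holomorphic_intros)

text \<open>Move the line to Re z = U or Re z = -U, whichever makes exp(-xz) decay. As |x| \<ge> 1/2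
  exceeds the type 1/4, the integrand stays O(exp(-\<delta>x) U^-4) on the edges and on the new
  line, whose total length is O(U).\<close>

lemma norm_freq_integral_far:
  assumes d: "0 \<le> \<delta>" "\<delta> \<le> 2" and U: "U \<ge> 2" and x: "\<bar>x\<bar> \<ge> 1/2"
  shows "norm (freq_integral \<delta> U x) \<le> 40 * 16 ^ 4 * exp (- (\<delta> * x)) / U ^ 3"
proof -
  define c where "c = (if x > 0 then U else - U)"
  define f where "f = (\<lambda>z. exp (- (of_real x * z)) * smoothing_kernel U z)"
  define E where "E = 6 * 16 ^ 4 * exp (- (\<delta> * x)) / U ^ 4"
  have E0: "E \<ge> 0" using U by (simp add: E_def)
  \<comment> \<open>The factor 2 bounds exp(1/2), and 1/2 bounds \<delta>/4, the exponent
    contributed by the kernel on the starting line.\<close>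
  have ex: "exp (- (x * r)) * exp (\<bar>r\<bar> / 4) \<le> 2 * exp (- (\<delta> * x))" if r: "r \<in> closed_segment \<delta> c" for r
  proof -
    have h: "exp (1/2::real) \<le> 2" using exp_bound[of "1/2"] by (simp add: power2_eq_square)
    have "- (x * r) + \<bar>r\<bar> / 4 \<le> 1 / 2 - \<delta> * x"
    proof (cases "x > 0")
      case True
      hence r: "\<delta> \<le> r" using r d U by (auto simp: c_def closed_segment_eq_real_ivl split: if_splits)
      have "0 \<le> (r - \<delta>) * (x - 1/4)" using r True x by (intro mult_nonneg_nonneg) auto
      moreover have "(r - \<delta>) * (x - 1/4) = x * r - r / 4 - \<delta> * x + \<delta> / 4" by (simp add: field_simps)
      ultimately show ?thesis using r d by linarith
    next
      case False
      hence r: "r \<le> \<delta>" using r d U by (auto simp: c_def closed_segment_eq_real_ivl split: if_splits)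
      show ?thesis
      proof (cases "r \<ge> 0")
        case True
        have "(- x) * r \<le> (- x) * \<delta>" using False r by (intro mult_left_mono) auto
        thus ?thesis using True r d by (simp add: algebra_simps)
      next
        case F: False
        have "0 \<le> (- r) * (- x - 1/4)" using F False x by (intro mult_nonneg_nonneg) auto
        moreover have "\<delta> * x \<le> 0" using False d by (simp add: mult_nonneg_nonpos)
        ultimately show ?thesis using F by (simp add: algebra_simps)
      qed
    qed
    hence "exp (- (x * r) + \<bar>r\<bar> / 4) \<le> exp (1/2 - \<delta> * x)" by simp
    also have "\<dots> = exp (1/2) * exp (- (\<delta> * x))" by (simp flip: exp_add)
    also have "\<dots> \<le> 2 * exp (- (\<delta> * x))" using h by (intro mult_right_mono) auto
    finally show ?thesis by (simp only: exp_add)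
  qed
  have fb: "norm (f z) \<le> E" if z: "Re z \<in> closed_segment \<delta> c" "norm z \<ge> U" "\<bar>Re z\<bar> \<le> U" "\<bar>Im z\<bar> \<le> U" for z
  proof -
    have "norm (f z) = exp (- (x * Re z)) * norm (smoothing_kernel U z)" by (simp add: f_def norm_mult)
    also have "\<dots> \<le> exp (- (x * Re z)) * (3 * 16 ^ 4 * exp (\<bar>Re z\<bar> / 4) / U ^ 4)"
      by (intro mult_left_mono norm_smoothing_kernel_le') (use z U in auto)
    also have "\<dots> = (exp (- (x * Re z)) * exp (\<bar>Re z\<bar> / 4)) * (3 * 16 ^ 4 / U ^ 4)" by simp
    also have "\<dots> \<le> (2 * exp (- (\<delta> * x))) * (3 * 16 ^ 4 / U ^ 4)"
      by (intro mult_right_mono ex z) (use U in auto)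
    finally show ?thesis by (simp add: E_def)
  qed
  have hol: "f holomorphic_on A" for A unfolding f_def by (rule freq_integrand_holomorphic)
  have segU: "\<bar>r\<bar> \<le> U" if "r \<in> closed_segment \<delta> c" for r
    using that d U by (auto simp: c_def closed_segment_eq_real_ivl split: if_splits)
  have 1: "norm (vline_integral c U f - vline_integral \<delta> U f) \<le> 2 * E * \<bar>c - \<delta>\<bar>"
  proof (rule vertical_line_shift[OF hol convex_UNIV])
    fix r assume r: "r \<in> closed_segment \<delta> c"
    have "norm (Complex r U) \<ge> U" "norm (Complex r (-U)) \<ge> U"
      using abs_Im_le_cmod[of "Complex r U"] abs_Im_le_cmod[of "Complex r (-U)"] U by auto
    thus "norm (f (Complex r U)) \<le> E \<and> norm (f (Complex r (-U))) \<le> E"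
      using r segU[OF r] U by (intro conjI fb) auto
  qed (use U E0 in auto)
  have 2: "norm (vline_integral c U f) \<le> E * (2 * U)"
  proof (rule vline_integral_bound)
    show "continuous_on {z. Re z = c} f" by (rule holomorphic_on_imp_continuous_on[OF hol])
    fix y assume y: "\<bar>y\<bar> \<le> U"
    have "norm (Complex c y) \<ge> U"
      using abs_Re_le_cmod[of "Complex c y"] U by (auto simp: c_def split: if_splits)
    thus "norm (f (Complex c y)) \<le> E" using y U by (intro fb) (auto simp: c_def)
  qed (use U E0 in auto)
  have "\<bar>c - \<delta>\<bar> \<le> 2 * U" using d U by (auto simp: c_def)
  hence "2 * E * \<bar>c - \<delta>\<bar> \<le> 2 * E * (2 * U)" using E0 by (intro mult_left_mono) auto
  \<comment> \<open>The two edges, each of length at most 2U, give 4EU, and the new line gives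
    2EU.\<close>
  hence "norm (vline_integral \<delta> U f) \<le> 6 * E * U"
    using 1 2 norm_triangle_ineq4[of "vline_integral c U f" "vline_integral c U f - vline_integral \<delta> U f"] by simp
  also have "6 * E * U = 36 * 16 ^ 4 * exp (- (\<delta> * x)) / U ^ 3"
    using U by (simp add: E_def field_simps power_numeral_reduce)
  also have "\<dots> \<le> 40 * 16 ^ 4 * exp (- (\<delta> * x)) / U ^ 3" using U by (intro divide_right_mono) auto
  finally show ?thesis by (simp add: freq_integral_def f_def)
qed

lemma smoothing_kernel_imag: "smoothing_kernel U (Complex 0 u) = of_real (smoothing_kernel_re U u)"
proof -
  have e: "Complex 0 u = \<i> * of_real u" by (simp add: complex_eq_iff)
  have "sinhc (Complex 0 u / 16) = of_real (if u = 0 then 1 else sin (u / 16) / (u / 16))"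
  proof (cases "u = 0")
    case False
    have "sinh (Complex 0 u / 16) = sinh (\<i> * of_real (u / 16))" by (simp add: e)
    also have "\<dots> = \<i> * sin (of_real (u / 16))" by (simp add: sinh_conv_sin)
    also have "sin (complex_of_real (u / 16)) = of_real (sin (u / 16))" by (rule sin_of_real)
    finally show ?thesis using False by (simp add: sinhc_def e)
  qed (auto simp: sinhc_def complex_eq_iff)
  moreover have "1 + (Complex 0 u)\<^sup>2 / of_real U ^ 2 = of_real (1 - u\<^sup>2 / U\<^sup>2)" by (simp add: e power_mult_distrib)
  ultimately show ?thesis unfolding smoothing_kernel_def smoothing_kernel_re_def by simp
qed

text \<open>The sine quotient is bounded both by 1 and by 16/|u|. Its fourth power leaves u^-2 decay
  even after multiplication by u^2, so mass and second moment are bounded independently of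
  U.\<close>

lemma smoothing_kernel_re_bounds:
  assumes "U > 0" "\<bar>u\<bar> \<le> U"
  shows "smoothing_kernel_re U u \<ge> 0" "smoothing_kernel_re U u \<le> 2 * 16 ^ 4 / (1 + u\<^sup>2)" "u\<^sup>2 * smoothing_kernel_re U u \<le> 2 * 16 ^ 4 / (1 + u\<^sup>2)"
proof -
  define q where "q = (if u = 0 then 1 else sin (u / 16) / (u / 16))"
  have f: "0 \<le> 1 - u\<^sup>2 / U\<^sup>2" "1 - u\<^sup>2 / U\<^sup>2 \<le> 1"
    using assms by (auto simp: field_simps abs_le_square_iff[symmetric])
  have q4: "q ^ 4 \<ge> 0" by simp
  have k: "0 \<le> smoothing_kernel_re U u" "smoothing_kernel_re U u \<le> q ^ 4"
    unfolding smoothing_kernel_re_def q_def[symmetric] using f q4 mult_left_mono[OF f(2) q4] by auto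
  have q1: "q ^ 4 \<le> 1"
  proof -
    have "\<bar>q\<bar> \<le> 1" unfolding q_def using abs_sin_x_le_abs_x[of "u / 16"] by (auto simp: abs_divide divide_le_eq)
    hence "\<bar>q\<bar> ^ 4 \<le> 1" by (intro power_le_one) auto
    thus ?thesis by (simp add: power_abs[symmetric])
  qed
  have q2: "u ^ 4 * q ^ 4 \<le> 16 ^ 4"
  proof -
    have "\<bar>u * q\<bar> \<le> 16" unfolding q_def by (auto simp: abs_mult)
    hence "\<bar>u * q\<bar> ^ 4 \<le> 16 ^ 4" by (intro power_mono) auto
    thus ?thesis by (simp add: power_abs[symmetric] power_mult_distrib)
  qed
  show "smoothing_kernel_re U u \<ge> 0" by fact
  have u4: "u\<^sup>2 * q ^ 4 \<le> 16 ^ 4 \<and> u ^ 4 * q ^ 4 + u\<^sup>2 * q ^ 4 \<le> 2 * 16 ^ 4"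
  proof (cases "\<bar>u\<bar> \<le> 1")
    case True
    hence "u\<^sup>2 \<le> 1" by (simp add: abs_square_le_1)
    hence "u\<^sup>2 * q ^ 4 \<le> 1 * 1" using q1 by (intro mult_mono) auto
    thus ?thesis using q2 by simp
  next
    case False
    hence "1 \<le> u\<^sup>2" by (metis abs_square_less_1 not_le less_imp_le)
    hence "u\<^sup>2 * 1 \<le> u\<^sup>2 * u\<^sup>2" by (intro mult_left_mono) auto
    hence "u\<^sup>2 * q ^ 4 \<le> u ^ 4 * q ^ 4" by (intro mult_right_mono q4) (simp add: power_numeral_reduce)
    thus ?thesis using q2 by simp
  qed
  have "smoothing_kernel_re U u * (1 + u\<^sup>2) \<le> q ^ 4 * (1 + u\<^sup>2)" using k by (intro mult_right_mono) auto
  also have "\<dots> \<le> 2 * 16 ^ 4" using u4 q1 by (simp add: algebra_simps)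
  finally show "smoothing_kernel_re U u \<le> 2 * 16 ^ 4 / (1 + u\<^sup>2)" by (simp add: pos_le_divide_eq add_pos_nonneg)
  have "u\<^sup>2 * smoothing_kernel_re U u * (1 + u\<^sup>2) \<le> u\<^sup>2 * q ^ 4 * (1 + u\<^sup>2)" using k by (intro mult_right_mono mult_left_mono) auto
  also have "\<dots> \<le> 2 * 16 ^ 4" using u4 by (simp add: algebra_simps power_numeral_reduce)
  finally show "u\<^sup>2 * smoothing_kernel_re U u \<le> 2 * 16 ^ 4 / (1 + u\<^sup>2)" by (simp add: pos_le_divide_eq add_pos_nonneg)
qed

lemma continuous_smoothing_kernel_re: "continuous_on A (smoothing_kernel_re U)"
proof -
  have "continuous_on A (\<lambda>u. Re (smoothing_kernel U (Complex 0 u)))"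
    by (intro continuous_intros continuous_on_compose2[OF holomorphic_on_imp_continuous_on[OF smoothing_kernel_holomorphic[of U UNIV]]]) auto
  thus ?thesis by (simp add: smoothing_kernel_imag)
qed

lemma integral_inverse_1_square:
  fixes U D :: real
  assumes "U \<ge> 0"
  shows "(\<lambda>u. D / (1 + u\<^sup>2)) integrable_on {-U..U}" "D \<ge> 0 \<Longrightarrow> integral {-U..U} (\<lambda>u. D / (1 + u\<^sup>2)) \<le> 4 * D"
proof -
  have "((\<lambda>u. D / (1 + u\<^sup>2)) has_integral (D * arctan U - D * arctan (-U))) {-U..U}"
    by (rule fundamental_theorem_of_calculus)
       (use assms in \<open>auto intro!: derivative_eq_intros simp: has_real_derivative_iff_has_vector_derivative[symmetric] divide_inverse\<close>)
  note hi = this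
  show "(\<lambda>u. D / (1 + u\<^sup>2)) integrable_on {-U..U}" using hi by blast
  assume "D \<ge> 0"
  have "arctan U \<le> 2" using arctan_ubound[of U] pi_less_4 by linarith
  hence "D * arctan U \<le> D * 2" using \<open>D \<ge> 0\<close> by (rule mult_left_mono)
  thus "integral {-U..U} (\<lambda>u. D / (1 + u\<^sup>2)) \<le> 4 * D"
    using integral_unique[OF hi] by (simp add: arctan_minus)
qed

lemma integral_smoothing_kernel_re_le:
  assumes "U > 0"
  shows "integral {-U..U} (smoothing_kernel_re U) \<le> 8 * 16 ^ 4" "integral {-U..U} (\<lambda>u. u\<^sup>2 * smoothing_kernel_re U u) \<le> 8 * 16 ^ 4"
proof -
  have "integral {-U..U} (smoothing_kernel_re U) \<le> integral {-U..U} (\<lambda>u. 2 * 16 ^ 4 / (1 + u\<^sup>2))"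
    by (rule integral_le) (use assms smoothing_kernel_re_bounds(2)[OF assms] integral_inverse_1_square(1)[of U] in
      \<open>auto intro!: integrable_continuous_real continuous_smoothing_kernel_re\<close>)
  also have "\<dots> \<le> 4 * (2 * 16 ^ 4)" by (rule integral_inverse_1_square(2)) (use assms in auto)
  finally show "integral {-U..U} (smoothing_kernel_re U) \<le> 8 * 16 ^ 4" by simp
  have "integral {-U..U} (\<lambda>u. u\<^sup>2 * smoothing_kernel_re U u) \<le> integral {-U..U} (\<lambda>u. 2 * 16 ^ 4 / (1 + u\<^sup>2))"
    by (rule integral_le) (use assms smoothing_kernel_re_bounds(3)[OF assms] integral_inverse_1_square(1)[of U] in
      \<open>auto intro!: integrable_continuous_real continuous_intros continuous_smoothing_kernel_re\<close>)
  also have "\<dots> \<le> 4 * (2 * 16 ^ 4)" by (rule integral_inverse_1_square(2)) (use assms in auto)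
  finally show "integral {-U..U} (\<lambda>u. u\<^sup>2 * smoothing_kernel_re U u) \<le> 8 * 16 ^ 4" by simp
qed

text \<open>The interval [-1, 1] alone suffices: there the sine quotient is at least 1/2 and, for U
  \<ge> 2, the last factor at least 3/4, so the kernel is at least 3/64.\<close>

lemma integral_smoothing_kernel_re_ge:
  assumes "U \<ge> 2" shows "integral {-U..U} (smoothing_kernel_re U) \<ge> 3 / 32"
proof -
  have pos: "smoothing_kernel_re U u \<ge> 3 / 64" if u: "u \<in> {-1..1}" for u
  proof -
    have "u\<^sup>2 \<le> 1" using u by (simp add: abs_square_le_1 abs_le_iff)
    moreover have "U\<^sup>2 \<ge> 4" using assms power_mono[of 2 U 2] by simp
    ultimately have "u\<^sup>2 / U\<^sup>2 \<le> 1 / 4" by (intro frac_le) auto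
    hence a: "3 / 4 \<le> 1 - u\<^sup>2 / U\<^sup>2" by simp
    have b: "(1/2) ^ 4 \<le> (if u = 0 then 1 else sin (u / 16) / (u / 16)) ^ 4"
    proof (cases "u = 0")
      case False
      have s: "sin v / v \<ge> 1/2" if "0 < v" "v \<le> 1" for v :: real
      proof -
        have "\<bar>sin v - (\<Sum>k<3. sin_coeff k * v ^ k)\<bar> \<le> inverse (fact 3) * \<bar>v\<bar> ^ 3" by (rule Maclaurin_sin_bound)
        hence "\<bar>sin v - v\<bar> \<le> v ^ 3 / 6" using that by (simp add: sin_coeff_def numeral_eq_Suc fact_Suc)
        hence "sin v \<ge> v - v ^ 3 / 6" by linarith
        moreover have "v ^ 3 \<le> v" using that power_decreasing[of 1 3 v] by simp
        ultimately have "sin v \<ge> v / 2" using that by linarith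
        thus ?thesis using that by (simp add: field_simps)
      qed
      have "sin (u / 16) / (u / 16) = sin \<bar>u / 16\<bar> / \<bar>u / 16\<bar>" by (auto simp: abs_if)
      also have "\<dots> \<ge> 1/2" by (rule s) (use u False in auto)
      finally show ?thesis using False by (intro power_mono) auto
    qed (simp add: power_divide)
    have "(1/2) ^ 4 * (3/4) \<le> smoothing_kernel_re U u" unfolding smoothing_kernel_re_def by (intro mult_mono a b) (use a in auto)
    thus ?thesis by (simp add: power_divide)
  qed
  have "3 / 32 = integral {-1..1} (\<lambda>u::real. 3 / 64 :: real)" by simp
  also have "\<dots> \<le> integral {-1..1} (smoothing_kernel_re U)"
    by (intro integral_le pos integrable_continuous_real continuous_smoothing_kernel_re continuous_intros)
  also have "\<dots> \<le> integral {-U..U} (smoothing_kernel_re U)"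
    by (rule integral_subset_le) (use assms smoothing_kernel_re_bounds(1)[of U] in \<open>auto intro!: integrable_continuous_real continuous_smoothing_kernel_re\<close>)
  finally show ?thesis .
qed

text \<open>On the imaginary axis, reached at the cost of two edges of size U^-4, the transform is
  bounded by the mass of the kernel. For tiny x it stays close to that mass, since cos(xu) \<ge> 1 -
  (xu)^2/2 and the second moment is bounded.\<close>

lemma freq_integral_near:
  assumes d: "0 \<le> \<delta>" "\<delta> \<le> 2" and U: "U \<ge> 2" and x: "\<bar>x\<bar> \<le> 1/2"
  shows "norm (freq_integral \<delta> U x) \<le> 100 * 16 ^ 4"
    and "\<bar>x\<bar> \<le> 1 / 4096 \<Longrightarrow> norm (freq_integral \<delta> U x) \<ge> 3 / 64 - 80 * 16 ^ 4 / U ^ 4"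
proof -
  define f where "f = (\<lambda>z. exp (- (of_real x * z)) * smoothing_kernel U z)"
  define E where "E = 18 * 16 ^ 4 / U ^ 4"
  have hol: "f holomorphic_on A" for A unfolding f_def by (rule freq_integrand_holomorphic)
  have E0: "E \<ge> 0" using U by (simp add: E_def)
  have fb: "norm (f z) \<le> E" if z: "0 \<le> Re z" "Re z \<le> 2" "\<bar>Im z\<bar> = U" for z
  proof -
    have "- (x * Re z) + \<bar>Re z\<bar> / 4 \<le> 3 / 2"
    proof -
      have "(- x) * Re z \<le> (1/2) * 2" by (intro mult_mono) (use z x in \<open>auto simp: abs_le_iff\<close>)
      thus ?thesis using z by simp
    qed
    hence "exp (- (x * Re z) + \<bar>Re z\<bar> / 4) \<le> exp (3/2)" by simp
    also have "exp (3/2::real) \<le> 6"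
    proof -
      have "exp (1/2::real) \<le> 1.75" using exp_bound[of "1/2"] by (simp add: power2_eq_square)
      hence "exp (1/2::real) ^ 3 \<le> 1.75 ^ 3" by (intro power_mono) auto
      moreover have "exp (3/2::real) = exp (1/2) ^ 3" by (simp flip: exp_of_nat_mult)
      ultimately show ?thesis by (simp add: power_divide)
    qed
    finally have e: "exp (- (x * Re z)) * exp (\<bar>Re z\<bar> / 4) \<le> 6" by (simp only: exp_add)
    have nz: "norm z \<ge> U" using abs_Im_le_cmod[of z] z by simp
    have "norm (f z) = exp (- (x * Re z)) * norm (smoothing_kernel U z)" by (simp add: f_def norm_mult)
    also have "\<dots> \<le> exp (- (x * Re z)) * (3 * 16 ^ 4 * exp (\<bar>Re z\<bar> / 4) / U ^ 4)"
      by (intro mult_left_mono norm_smoothing_kernel_le') (use z U nz in auto)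
    also have "\<dots> = (exp (- (x * Re z)) * exp (\<bar>Re z\<bar> / 4)) * (3 * 16 ^ 4 / U ^ 4)" by simp
    also have "\<dots> \<le> 6 * (3 * 16 ^ 4 / U ^ 4)" by (intro mult_right_mono e) (use U in auto)
    finally show ?thesis by (simp add: E_def)
  qed
  have sh: "norm (vline_integral \<delta> U f - vline_integral 0 U f) \<le> 2 * E * \<bar>\<delta> - 0\<bar>"
    by (rule vertical_line_shift[OF hol convex_UNIV]; (intro conjI fb)?) (use U E0 d in \<open>auto simp: closed_segment_eq_real_ivl\<close>)
  have "2 * E * \<bar>\<delta> - 0\<bar> \<le> 2 * E * 2" using E0 d by (intro mult_left_mono) auto
  hence sh: "norm (vline_integral \<delta> U f - vline_integral 0 U f) \<le> 4 * E" using sh by simp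
  have v0: "vline_integral 0 U f = \<i> * integral {-U..U} (\<lambda>u. cis (- (x * u)) * of_real (smoothing_kernel_re U u))"
  proof -
    have "f (Complex 0 u) = cis (- (x * u)) * of_real (smoothing_kernel_re U u)" for u
    proof -
      have "- (of_real x * Complex 0 u) = \<i> * of_real (- (x * u))" by (simp add: complex_eq_iff)
      thus ?thesis unfolding f_def cis_conv_exp smoothing_kernel_imag by (simp only:)
    qed
    moreover have "vline_integral 0 U f = \<i> * integral {-U..U} (\<lambda>u. f (Complex 0 u))"
      unfolding vline_integral_def by (rule contour_integral_linepath_same_Re) (use U in auto)
    ultimately show ?thesis by simp
  qed
  have int: "(\<lambda>u. cis (- (x * u)) * of_real (smoothing_kernel_re U u)) integrable_on {-U..U}"
    unfolding cis_conv_exp by (intro integrable_continuous_real continuous_intros continuous_smoothing_kernel_re)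
  have intk: "smoothing_kernel_re U integrable_on {-U..U}" by (intro integrable_continuous_real continuous_smoothing_kernel_re)
  have "norm (integral {-U..U} (\<lambda>u. cis (- (x * u)) * of_real (smoothing_kernel_re U u))) \<le> integral {-U..U} (smoothing_kernel_re U)"
    by (rule integral_norm_bound_integral[OF int intk]) (use smoothing_kernel_re_bounds(1)[of U] U in \<open>auto simp: norm_mult\<close>)
  hence nv: "norm (vline_integral 0 U f) \<le> 8 * 16 ^ 4" unfolding v0 norm_mult using integral_smoothing_kernel_re_le(1)[of U] U by simp
  have tr1: "norm (vline_integral \<delta> U f) \<le> norm (vline_integral 0 U f) + 4 * E"
    using sh norm_triangle_ineq2[of "vline_integral \<delta> U f" "vline_integral 0 U f"] by linarith
  have tr2: "norm (vline_integral \<delta> U f) \<ge> norm (vline_integral 0 U f) - 4 * E"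
    using sh norm_triangle_ineq3[of "vline_integral \<delta> U f" "vline_integral 0 U f"] by linarith
  have p16: "(16::real) ^ 4 \<ge> 0" by simp
  have U4: "U ^ 4 \<ge> 1" using U by (intro one_le_power) auto
  have "4 * E \<le> 72 * 16 ^ 4" using U4 by (simp add: E_def divide_le_eq)
  thus "norm (freq_integral \<delta> U x) \<le> 100 * 16 ^ 4" using tr1 nv p16 unfolding freq_integral_def f_def by linarith
  assume x': "\<bar>x\<bar> \<le> 1 / 4096"
  have intc: "(\<lambda>u. cos (x * u) * smoothing_kernel_re U u) integrable_on {-U..U}"
    by (intro integrable_continuous_real continuous_intros continuous_smoothing_kernel_re)
  have Re: "Re (integral {-U..U} (\<lambda>u. cis (- (x * u)) * of_real (smoothing_kernel_re U u))) = integral {-U..U} (\<lambda>u. cos (x * u) * smoothing_kernel_re U u)"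
    using integral_linear[OF int bounded_linear_Re] by (simp add: o_def)
  have int2: "(\<lambda>u. u\<^sup>2 * smoothing_kernel_re U u) integrable_on {-U..U}"
    by (intro integrable_continuous_real continuous_intros continuous_smoothing_kernel_re)
  have "integral {-U..U} (\<lambda>u. smoothing_kernel_re U u - x\<^sup>2 / 2 * (u\<^sup>2 * smoothing_kernel_re U u)) \<le> integral {-U..U} (\<lambda>u. cos (x * u) * smoothing_kernel_re U u)"
  proof (rule integral_le[OF _ intc])
    show "(\<lambda>u. smoothing_kernel_re U u - x\<^sup>2 / 2 * (u\<^sup>2 * smoothing_kernel_re U u)) integrable_on {-U..U}"
      by (intro integrable_diff intk integrable_on_mult_right int2)
    fix u assume u: "u \<in> {-U..U}"
    have "cos (x * u) \<ge> 1 - (x * u)\<^sup>2 / 2" by (rule cos_ge_1_minus_half_square)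
    hence "(1 - (x * u)\<^sup>2 / 2) * smoothing_kernel_re U u \<le> cos (x * u) * smoothing_kernel_re U u"
      using smoothing_kernel_re_bounds(1)[of U u] u U by (intro mult_right_mono) auto
    thus "smoothing_kernel_re U u - x\<^sup>2 / 2 * (u\<^sup>2 * smoothing_kernel_re U u) \<le> cos (x * u) * smoothing_kernel_re U u"
      by (simp add: algebra_simps power_mult_distrib)
  qed
  also have "integral {-U..U} (\<lambda>u. smoothing_kernel_re U u - x\<^sup>2 / 2 * (u\<^sup>2 * smoothing_kernel_re U u)) = integral {-U..U} (smoothing_kernel_re U) - x\<^sup>2 / 2 * integral {-U..U} (\<lambda>u. u\<^sup>2 * smoothing_kernel_re U u)"
    by (subst integral_diff) (auto intro!: intk integrable_on_mult_right int2)
  finally have "integral {-U..U} (smoothing_kernel_re U) - x\<^sup>2 / 2 * integral {-U..U} (\<lambda>u. u\<^sup>2 * smoothing_kernel_re U u) \<le> integral {-U..U} (\<lambda>u. cos (x * u) * smoothing_kernel_re U u)" .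
  \<comment> \<open>As 1/4096 = 2^-12, the loss is at most 2^-25 * 2^19 = 1/64, against a mass of at
    least 3/32 = 6/64.\<close>
  moreover have "x\<^sup>2 / 2 * integral {-U..U} (\<lambda>u. u\<^sup>2 * smoothing_kernel_re U u) \<le> (1/4096)\<^sup>2 / 2 * (8 * 16 ^ 4)"
  proof (intro mult_mono divide_right_mono)
    show "x\<^sup>2 \<le> (1/4096)\<^sup>2" using x' by (simp add: abs_le_square_iff[symmetric])
    show "0 \<le> integral {-U..U} (\<lambda>u. u\<^sup>2 * smoothing_kernel_re U u)"
      by (rule integral_nonneg[OF int2]) (use smoothing_kernel_re_bounds(1)[of U] U in auto)
  qed (use integral_smoothing_kernel_re_le(2)[of U] U in auto)
  ultimately have "3 / 64 \<le> integral {-U..U} (\<lambda>u. cos (x * u) * smoothing_kernel_re U u)"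
    using integral_smoothing_kernel_re_ge[OF U] by (simp add: power2_eq_square)
  also have "\<dots> \<le> norm (vline_integral 0 U f)" unfolding Re[symmetric] v0 norm_mult using complex_Re_le_cmod by simp
  finally have "3 / 64 \<le> norm (vline_integral 0 U f)" .
  moreover have "4 * E \<le> 80 * 16 ^ 4 / U ^ 4" using U by (simp add: E_def divide_right_mono)
  ultimately show "norm (freq_integral \<delta> U x) \<ge> 3 / 64 - 80 * 16 ^ 4 / U ^ 4"
    using tr2 unfolding freq_integral_def f_def by linarith
qed

section \<open>Smoothing the logarithm along a vertical line\<close>

definition freq_window :: "real \<Rightarrow> nat set" where
  "freq_window \<nu> = {n. n \<ge> 1 \<and> \<bar>ln (real n) - \<nu>\<bar> < 1/2}"

lemma freq_window_bounds:
  assumes "n \<in> freq_window \<nu>" shows "real n < exp (\<nu> + 1/2)" "real n > exp (\<nu> - 1/2)"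
proof -
  have n: "n \<ge> 1" "ln (real n) < \<nu> + 1/2" "ln (real n) > \<nu> - 1/2" using assms unfolding freq_window_def abs_less_iff by auto
  show "real n < exp (\<nu> + 1/2)" using n by (metis exp_less_cancel_iff exp_ln of_nat_0_less_iff less_le_trans zero_less_one)
  show "real n > exp (\<nu> - 1/2)" using n by (metis exp_less_cancel_iff exp_ln of_nat_0_less_iff less_le_trans zero_less_one)
qed

lemma finite_freq_window: "finite (freq_window \<nu>)"
proof (rule finite_subset)
  show "freq_window \<nu> \<subseteq> {..nat \<lceil>exp (\<nu> + 1/2)\<rceil>}"
  proof
    fix n assume "n \<in> freq_window \<nu>"
    hence "real n \<le> real (nat \<lceil>exp (\<nu> + 1/2)\<rceil>)"
      using freq_window_bounds(1)[of n \<nu>] real_nat_ceiling_ge[of "exp (\<nu> + 1/2)"] by linarith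
    thus "n \<in> {..nat \<lceil>exp (\<nu> + 1/2)\<rceil>}" by simp
  qed
qed auto

lemma norm_cosh_le: "norm (cosh z :: complex) \<le> exp \<bar>Re z\<bar>"
proof -
  have "norm (cosh z) \<le> (norm (exp z) + norm (exp (- z))) / 2"
    unfolding cosh_def using norm_triangle_ineq[of "exp z" "exp (- z)"] by (simp add: norm_divide scaleR_conv_of_real norm_mult)
  also have "\<dots> = (exp (Re z) + exp (- Re z)) / 2" by simp
  also have "\<dots> \<le> exp \<bar>Re z\<bar>" by (simp add: abs_if)
  finally show ?thesis .
qed

text \<open>At height |y| = U one has 1 + z^2/U^2 = x(x + 2iy)/U^2, of size x/U. The factor x
  cancels the singular bound B/x of Borel-Caratheodory, and together with the fourth power the gain
  is U^-5.\<close>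

lemma smoothed_log_top_edge:
  fixes B U \<nu> \<delta> x :: real
  assumes "B \<ge> 0" "U \<ge> 2" "\<nu> \<ge> 0" "0 \<le> x" "x \<le> \<delta>" "\<delta> \<le> 2" "\<bar>y\<bar> = U"
    and l: "x > 0 \<Longrightarrow> norm l \<le> B / x"
  shows "norm (l * (smoothing_kernel U (Complex x y) * (1 + cosh (of_real \<nu> * Complex x y)))) \<le> 12 * 16 ^ 4 * B * exp (\<delta> * \<nu>) / U ^ 5"
proof -
  let ?z = "Complex x y"
  have nz: "norm ?z \<ge> U" using abs_Im_le_cmod[of ?z] assms by simp
  have y2: "y\<^sup>2 = U\<^sup>2" using assms(7) by (metis power2_abs)
  have U0: "U > 0" using assms by simp
  have "1 + ?z\<^sup>2 / of_real U ^ 2 = of_real (x / U\<^sup>2) * Complex x (2 * y)"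
    using U0 y2 by (simp add: complex_eq_iff power2_eq_square field_simps)
  hence "norm (1 + ?z\<^sup>2 / of_real U ^ 2) = x / U\<^sup>2 * norm (Complex x (2 * y))"
    using assms by (simp only: norm_mult norm_of_real) (simp add: abs_mult)
  also have "\<dots> \<le> x / U\<^sup>2 * (3 * U)"
    using cmod_le[of "Complex x (2 * y)"] assms by (intro mult_left_mono) auto
  also have "\<dots> = 3 * x / U" using U0 by (simp add: power2_eq_square)
  finally have c: "norm (1 + ?z\<^sup>2 / of_real U ^ 2) \<le> 3 * x / U" .
  have "exp (\<bar>Re ?z\<bar> / 4) \<le> exp (1/2)" using assms by simp
  also have "exp (1/2::real) \<le> 2" using exp_bound[of "1/2"] by (simp add: power2_eq_square)
  finally have e: "exp (\<bar>Re ?z\<bar> / 4) \<le> 2" .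
  have "norm (smoothing_kernel U ?z) \<le> exp (\<bar>Re ?z\<bar> / 4) * (16 / U) ^ 4 * norm (1 + ?z\<^sup>2 / of_real U ^ 2)"
    by (rule norm_smoothing_kernel_le[OF nz U0])
  also have "\<dots> \<le> 2 * (16 / U) ^ 4 * (3 * x / U)" using e c U0 by (intro mult_mono) auto
  finally have k: "norm (smoothing_kernel U ?z) \<le> 2 * (16 / U) ^ 4 * (3 * x / U)" .
  have "\<nu> * x \<le> \<delta> * \<nu>" using mult_left_mono[OF assms(5,3)] by (simp add: mult.commute)
  hence "exp (\<bar>Re (of_real \<nu> * ?z)\<bar>) \<le> exp (\<delta> * \<nu>)" using assms by simp
  moreover have "norm (1 + cosh (of_real \<nu> * ?z)) \<le> 1 + norm (cosh (of_real \<nu> * ?z))"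
    using norm_triangle_ineq[of 1 "cosh (of_real \<nu> * ?z)"] by simp
  moreover have "1 \<le> exp (\<delta> * \<nu>)" using assms by simp
  ultimately have ch: "norm (1 + cosh (of_real \<nu> * ?z)) \<le> 2 * exp (\<delta> * \<nu>)"
    using norm_cosh_le[of "of_real \<nu> * ?z"] by linarith
  show ?thesis
  proof (cases "x > 0")
    \<comment> \<open>At x = 0 the logarithm is not bounded by assumption, but the kernel is 0 at
      the corner.\<close>
    case False
    hence "norm (smoothing_kernel U ?z) \<le> 0" using k assms by simp
    thus ?thesis using assms by simp
  next
    case True
    have "norm (l * (smoothing_kernel U ?z * (1 + cosh (of_real \<nu> * ?z)))) \<le> (B / x) * ((2 * (16 / U) ^ 4 * (3 * x / U)) * (2 * exp (\<delta> * \<nu>)))"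
      unfolding norm_mult by (intro mult_mono l k ch True) (use True assms in auto)
    also have "\<dots> = 12 * 16 ^ 4 * B * exp (\<delta> * \<nu>) / U ^ 5"
      using True U0 by (simp add: power_divide field_simps power_numeral_reduce)
    finally show ?thesis .
  qed
qed

text \<open>Writing cosh as half a sum of two exponentials splits the term into transforms at ln n,
  ln n - \<nu> and ln n + \<nu>. Only the second can be within 1/2 of 0, and it carries the weight
  1/2.\<close>

lemma smoothed_dirichlet_term:
  fixes \<sigma> t U \<nu> :: real and g :: "nat \<Rightarrow> complex"
  assumes "n \<ge> 2" "U \<ge> 2" "\<nu> \<ge> 0" "1/2 < \<sigma>" "\<sigma> < 1"
  defines "\<delta> \<equiv> 2 - \<sigma>" and "s0 \<equiv> Complex \<sigma> t"
  defines "v \<equiv> vline_integral \<delta> U (\<lambda>z. g n / of_nat n powr (s0 + z) * (smoothing_kernel U z * (1 + cosh (of_real \<nu> * z))))"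
  shows "norm (v - (if n \<in> freq_window \<nu> then g n / of_nat n powr s0 * freq_integral \<delta> U (ln (real n) - \<nu>) / 2 else 0))
     \<le> norm (g n) / real n powr 2 * (80 * 16 ^ 4 * exp (\<delta> * \<nu>) / U ^ 3)"
proof -
  define x where "x = ln (real n)"
  define c where "c = g n / of_nat n powr s0"
  define e where "e = (\<lambda>x z. exp (- (of_real x * z)) * smoothing_kernel U z)"
  define F where "F = freq_integral \<delta> U"
  have n0: "real n > 0" using assms by simp
  have nx: "of_nat n powr z = exp (z * of_real x)" for z :: complex
    using n0 Ln_of_real[of "real n"] by (simp add: powr_def x_def)
  have "(\<lambda>z. g n / of_nat n powr (s0 + z) * (smoothing_kernel U z * (1 + cosh (of_real \<nu> * z)))) =
      (\<lambda>z. c * (e x z + (e (x - \<nu>) z / 2 + e (x + \<nu>) z / 2)))"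
  proof
    fix z :: complex
    have alg: "c * a * (k * (1 + (p + m) / 2)) = c * (a * k + (a * p * k / 2 + a * m * k / 2))" for a k p m :: complex
      by (simp add: field_simps)
    have "e x z = exp (- (of_real x * z)) * smoothing_kernel U z" by (simp add: e_def)
    moreover have "cosh (of_real \<nu> * z) = (exp (of_real \<nu> * z) + exp (- (of_real \<nu> * z))) / 2" by (rule cosh_field_def)
    moreover have "e (x - \<nu>) z = exp (- (of_real x * z)) * exp (of_real \<nu> * z) * smoothing_kernel U z"
      unfolding e_def by (simp add: exp_add[symmetric] algebra_simps)
    moreover have "e (x + \<nu>) z = exp (- (of_real x * z)) * exp (- (of_real \<nu> * z)) * smoothing_kernel U z"
      unfolding e_def by (simp add: exp_add[symmetric] algebra_simps)
    moreover have "g n / of_nat n powr (s0 + z) = c * exp (- (of_real x * z))"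
    proof -
      have "exp ((s0 + z) * of_real x) = exp (s0 * of_real x) * exp (of_real x * z)" by (simp add: exp_add[symmetric] algebra_simps)
      thus ?thesis unfolding c_def nx by (simp only: exp_minus divide_inverse inverse_mult_distrib mult.assoc)
    qed
    ultimately show "g n / of_nat n powr (s0 + z) * (smoothing_kernel U z * (1 + cosh (of_real \<nu> * z))) =
      c * (e x z + (e (x - \<nu>) z / 2 + e (x + \<nu>) z / 2))"
      by (simp only: alg)
  qed
  moreover have int: "e y contour_integrable_on linepath a b" for y a b
    unfolding e_def by (intro contour_integrable_continuous_linepath holomorphic_on_imp_continuous_on freq_integrand_holomorphic)
  moreover have hF: "(e y has_contour_integral F y) (linepath (Complex \<delta> (-U)) (Complex \<delta> U))" for y
    using has_contour_integral_integral[OF int] unfolding F_def freq_integral_def vline_integral_def e_def by simp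
  have "((\<lambda>z. c * (e x z + (e (x - \<nu>) z / 2 + e (x + \<nu>) z / 2))) has_contour_integral
      c * (F x + (F (x - \<nu>) / 2 + F (x + \<nu>) / 2))) (linepath (Complex \<delta> (-U)) (Complex \<delta> U))"
    by (intro has_contour_integral_lmul has_contour_integral_add has_contour_integral_div hF)
  ultimately have v: "v = c * (F x + (F (x - \<nu>) / 2 + F (x + \<nu>) / 2))"
    unfolding v_def vline_integral_def by (simp only: contour_integral_unique)
  have d: "0 \<le> \<delta>" "\<delta> \<le> 2" using assms by auto
  define Q where "Q = 40 * 16 ^ 4 * exp (- (\<delta> * x)) / U ^ 3"
  have Q0: "Q \<ge> 0" using assms by (simp add: Q_def)
  \<comment> \<open>This puts the frequencies ln n and ln n + \<nu> in the far range for every n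
    \<ge> 2.\<close>
  have "ln (2::real) \<ge> 1/2" using exp_bound[of "1/2"] by (subst ln_ge_iff) (auto simp: power2_eq_square)
  moreover have "ln (real n) \<ge> ln 2" using assms by simp
  ultimately have xx: "x \<ge> 1/2" unfolding x_def by linarith
  have Fb: "norm (F (x + r)) \<le> Q * exp (- (\<delta> * r))" if "\<bar>x + r\<bar> \<ge> 1/2" for r
  proof -
    have "norm (F (x + r)) \<le> 40 * 16 ^ 4 * exp (- (\<delta> * (x + r))) / U ^ 3"
      unfolding F_def by (rule norm_freq_integral_far) (use d assms that in auto)
    also have "exp (- (\<delta> * (x + r))) = exp (- (\<delta> * x)) * exp (- (\<delta> * r))" by (simp add: exp_add[symmetric] algebra_simps)
    finally show ?thesis by (simp add: Q_def)
  qed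
  have X: "1 \<le> exp (\<delta> * \<nu>)" using d assms by simp
  have F1: "norm (F x) \<le> Q" using Fb[of 0] xx by simp
  have F2: "norm (F (x + \<nu>)) \<le> Q"
  proof -
    have "norm (F (x + \<nu>)) \<le> Q * exp (- (\<delta> * \<nu>))" by (rule Fb) (use xx assms in auto)
    also have "\<dots> \<le> Q * 1" using Q0 d assms by (intro mult_left_mono) auto
    finally show ?thesis by simp
  qed
  define w where "w = (if n \<in> freq_window \<nu> then 0 else F (x - \<nu>))"
  have F3: "norm w \<le> Q * exp (\<delta> * \<nu>)"
  proof (cases "n \<in> freq_window \<nu>")
    case False
    hence "\<bar>x + (- \<nu>)\<bar> \<ge> 1/2" using assms by (auto simp: freq_window_def x_def)
    from Fb[OF this] show ?thesis using False by (simp add: w_def)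
  qed (use Q0 in \<open>auto simp: w_def\<close>)
  have "v - (if n \<in> freq_window \<nu> then g n / of_nat n powr s0 * freq_integral \<delta> U (ln (real n) - \<nu>) / 2 else 0) = c * (F x + F (x + \<nu>) / 2 + w / 2)"
    unfolding v w_def F_def x_def c_def by (simp add: algebra_simps)
  also have "norm \<dots> = norm c * norm (F x + F (x + \<nu>) / 2 + w / 2)" by (rule norm_mult)
  also have "\<dots> \<le> norm c * (Q + Q / 2 + Q * exp (\<delta> * \<nu>) / 2)"
    using F1 F2 F3 by (intro mult_left_mono norm_triangle_le add_mono) (auto simp: norm_divide)
  also have "\<dots> \<le> norm c * (2 * Q * exp (\<delta> * \<nu>))"
  proof (intro mult_left_mono)
    have "Q * 1 \<le> Q * exp (\<delta> * \<nu>)" using X Q0 by (intro mult_left_mono) auto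
    thus "Q + Q / 2 + Q * exp (\<delta> * \<nu>) / 2 \<le> 2 * Q * exp (\<delta> * \<nu>)" by linarith
  qed auto
  also have "norm c = norm (g n) / real n powr \<sigma>" unfolding c_def norm_dirichlet_term by (simp add: s0_def)
  \<comment> \<open>With \<delta> = 2 - \<sigma> the decay of the transform turns n^-\<sigma> into
    n^-2, so that the errors can be summed over n.\<close>
  also have "exp (- (\<delta> * x)) = 1 / real n powr \<delta>" using n0 by (simp add: powr_def x_def exp_minus divide_inverse)
  hence "norm (g n) / real n powr \<sigma> * (2 * Q * exp (\<delta> * \<nu>)) = norm (g n) / (real n powr \<sigma> * real n powr \<delta>) * (80 * 16 ^ 4 * exp (\<delta> * \<nu>) / U ^ 3)"
    by (simp add: Q_def)
  also have "real n powr \<sigma> * real n powr \<delta> = real n powr 2" by (simp add: \<delta>_def flip: powr_add)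
  finally show ?thesis .
qed

text \<open>Shift the weighted integral from Re s = \<sigma> to Re s = 2; the edges cost U^-5. On
  the new line the logarithm is its Dirichlet series and can be integrated term by term, where only
  n in the window give a main term.\<close>

lemma smoothed_log_identity:
  fixes g :: "nat \<Rightarrow> complex" and lg :: "complex \<Rightarrow> complex" and \<sigma> t U \<nu> B :: real
  assumes g: "dirichlet_abs_conv g 2" "\<And>n. n < 2 \<Longrightarrow> g n = 0"
    and sig: "1/2 < \<sigma>" "\<sigma> < 1" and U: "U \<ge> 2" and nu: "\<nu> \<ge> 0" and "B \<ge> 0"
    and l: "lg holomorphic_on S" "convex S" "\<And>s. \<sigma> \<le> Re s \<Longrightarrow> Re s \<le> 2 \<Longrightarrow> \<bar>Im s - t\<bar> \<le> U \<Longrightarrow> s \<in> S"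
    and eq: "\<And>s. Re s = 2 \<Longrightarrow> \<bar>Im s - t\<bar> \<le> U \<Longrightarrow> lg s = dirichlet_series g s"
    and bd: "\<And>s. \<sigma> < Re s \<Longrightarrow> Re s \<le> 2 \<Longrightarrow> \<bar>Im s - t\<bar> = U \<Longrightarrow> norm (lg s) \<le> B / (Re s - \<sigma>)"
  shows "norm (\<i> * integral {-U..U} (\<lambda>u. lg (Complex \<sigma> (t + u)) * of_real (smoothing_kernel_re U u * (1 + cos (\<nu> * u))))
      - (\<Sum>n\<in>freq_window \<nu>. g n / of_nat n powr Complex \<sigma> t * freq_integral (2 - \<sigma>) U (ln (real n) - \<nu>)) / 2)
    \<le> (80 * 16 ^ 4 * (\<Sum>n. norm (g n) / real n powr 2) / U ^ 3 + 48 * 16 ^ 4 * B / U ^ 5) * exp ((2 - \<sigma>) * \<nu>)"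
proof -
  define \<delta> where "\<delta> = 2 - \<sigma>"
  define s0 where "s0 = Complex \<sigma> t"
  define K where "K z = smoothing_kernel U z * (1 + cosh (of_real \<nu> * z))" for z
  define f where "f z = lg (s0 + z) * K z" for z
  define S' where "S' = (+) (- s0) ` S"
  have d: "0 \<le> \<delta>" "\<delta> \<le> 2" using sig by (auto simp: \<delta>_def)
  have S': "z \<in> S' \<longleftrightarrow> s0 + z \<in> S" for z unfolding S'_def by (auto simp: image_iff) (metis add.commute diff_add_cancel uminus_add_conv_diff)
  have S'c: "convex S'" unfolding S'_def by (rule convex_translation[OF l(2)])
  have rect: "z \<in> S'" if "0 \<le> Re z" "Re z \<le> \<delta>" "\<bar>Im z\<bar> \<le> U" for z
    unfolding S' by (rule l(3)) (use that in \<open>auto simp: s0_def \<delta>_def\<close>)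
  have cosh_hol: "(\<lambda>z. cosh (of_real \<nu> * z)) holomorphic_on A" for A
    unfolding holomorphic_on_def field_differentiable_def by (auto intro!: exI derivative_eq_intros)
  have Khol: "K holomorphic_on A" for A unfolding K_def by (intro holomorphic_intros cosh_hol)
  have "(\<lambda>z. lg (s0 + z)) holomorphic_on S'"
  proof -
    have "(\<lambda>z. s0 + z) holomorphic_on S'" by (intro holomorphic_intros)
    moreover have "(\<lambda>z. s0 + z) ` S' \<subseteq> S" using S' by auto
    ultimately show ?thesis using holomorphic_on_compose_gen[of "\<lambda>z. s0 + z" S' lg S] l(1) by (simp add: o_def)
  qed
  hence fhol: "f holomorphic_on S'" unfolding f_def by (intro holomorphic_intros Khol)
  define E where "E = 12 * 16 ^ 4 * B * exp (\<delta> * \<nu>) / U ^ 5"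
  have E0: "E \<ge> 0" using U \<open>B \<ge> 0\<close> by (simp add: E_def)
  have edge: "norm (f (Complex x y)) \<le> E" if x: "x \<in> closed_segment 0 \<delta>" and y: "\<bar>y\<bar> = U" for x y
    unfolding f_def K_def E_def
  proof (rule smoothed_log_top_edge)
    show x0: "0 \<le> x" "x \<le> \<delta>" using x d by (auto simp: closed_segment_eq_real_ivl)
    assume "x > 0"
    thus "norm (lg (s0 + Complex x y)) \<le> B / x"
      using bd[of "s0 + Complex x y"] y x0 by (simp add: s0_def \<delta>_def)
  qed (use U nu \<open>B \<ge> 0\<close> d y in auto)
  have sh: "norm (vline_integral \<delta> U f - vline_integral 0 U f) \<le> 2 * E * \<bar>\<delta> - 0\<bar>"
    by (rule vertical_line_shift[OF fhol S'c]; (intro conjI edge)?) (use U E0 d in \<open>auto intro!: rect\<close>)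
  moreover have "2 * E * \<bar>\<delta> - 0\<bar> \<le> 2 * E * 2" using E0 d by (intro mult_left_mono) auto
  ultimately have sh: "norm (vline_integral \<delta> U f - vline_integral 0 U f) \<le> 4 * E" by simp
  have v0: "vline_integral 0 U f = \<i> * integral {-U..U} (\<lambda>u. lg (Complex \<sigma> (t + u)) * of_real (smoothing_kernel_re U u * (1 + cos (\<nu> * u))))"
  proof -
    have "f (Complex 0 u) = lg (Complex \<sigma> (t + u)) * of_real (smoothing_kernel_re U u * (1 + cos (\<nu> * u)))" for u
    proof -
      have "of_real \<nu> * Complex 0 u = \<i> * of_real (\<nu> * u)" by (simp add: complex_eq_iff)
      hence "cosh (of_real \<nu> * Complex 0 u) = of_real (cos (\<nu> * u))" by (simp only: cosh_conv_cos) (simp add: cos_of_real[symmetric])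
      moreover have "s0 + Complex 0 u = Complex \<sigma> (t + u)" by (simp add: s0_def complex_eq_iff)
      ultimately show ?thesis unfolding f_def K_def smoothing_kernel_imag by simp
    qed
    moreover have "vline_integral 0 U f = \<i> * integral {-U..U} (\<lambda>u. f (Complex 0 u))"
      unfolding vline_integral_def by (rule contour_integral_linepath_same_Re) (use U in auto)
    ultimately show ?thesis by simp
  qed
  let ?\<gamma> = "linepath (Complex \<delta> (-U)) (Complex \<delta> U)"
  have dd: "\<sigma> + \<delta> = 2" by (simp add: \<delta>_def)
  have pim: "path_image ?\<gamma> = {z. Re z = \<delta> \<and> \<bar>Im z\<bar> \<le> U}"
    using U by (auto simp: closed_segment_same_Re closed_segment_eq_real_ivl)
  define dterm where "dterm n z = g n / of_nat n powr (s0 + z) * K z" for n z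
  have thol: "dterm n holomorphic_on A" for n A
    unfolding dterm_def by (cases "n = 0") (auto intro!: holomorphic_intros Khol)
  have tint: "dterm n contour_integrable_on ?\<gamma>" for n
    by (intro contour_integrable_continuous_linepath holomorphic_on_imp_continuous_on thol)
  \<comment> \<open>The shifted segment lies over Re s = 2, where absolute convergence makes the
    partial sums converge uniformly and allows sum and integral to be exchanged.\<close>
  have ul1: "uniform_limit (path_image ?\<gamma>) (\<lambda>N z. \<Sum>i<N. g i / of_nat i powr (s0 + z)) (\<lambda>z. dirichlet_series g (s0 + z)) sequentially"
    by (rule uniform_limit_compose'[OF dirichlet_series_uniform_limit[OF g(1)]]) (use pim dd in \<open>auto simp: s0_def\<close>)
  have cpt: "compact (path_image ?\<gamma>)" by simp
  have "continuous_on (path_image ?\<gamma>) (\<lambda>z. dirichlet_series g (s0 + z))"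
    by (rule continuous_on_compose2[OF continuous_on_dirichlet_series[OF g(1)]]) (use pim dd in \<open>auto simp: s0_def intro!: continuous_intros\<close>)
  hence b1: "bounded ((\<lambda>z. dirichlet_series g (s0 + z)) ` path_image ?\<gamma>)"
    by (intro compact_imp_bounded compact_continuous_image cpt)
  have b2: "bounded (K ` path_image ?\<gamma>)"
    by (intro compact_imp_bounded compact_continuous_image cpt holomorphic_on_imp_continuous_on Khol)
  have "uniform_limit (path_image ?\<gamma>) (\<lambda>N z. (\<Sum>i<N. g i / of_nat i powr (s0 + z)) * K z) (\<lambda>z. dirichlet_series g (s0 + z) * K z) sequentially"
    by (rule uniform_lim_mult[OF ul1 uniform_limit_const b1 b2])
  hence ul: "uniform_limit (path_image ?\<gamma>) (\<lambda>N z. \<Sum>i<N. dterm i z) (\<lambda>z. dirichlet_series g (s0 + z) * K z) sequentially"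
    by (simp add: dterm_def sum_distrib_right)
  have "(\<lambda>N. contour_integral ?\<gamma> (\<lambda>z. \<Sum>i<N. dterm i z)) \<longlonglongrightarrow> contour_integral ?\<gamma> (\<lambda>z. dirichlet_series g (s0 + z) * K z)"
    by (rule contour_integral_uniform_limit(2)[OF _ ul, where B = "norm (Complex \<delta> U - Complex \<delta> (-U))"])
       (auto intro!: always_eventually contour_integrable_sum tint)
  moreover have "contour_integral ?\<gamma> (\<lambda>z. \<Sum>i<N. dterm i z) = (\<Sum>i<N. vline_integral \<delta> U (dterm i))" for N
    unfolding vline_integral_def by (rule contour_integral_sum) (auto intro: tint)
  moreover have "contour_integral ?\<gamma> (\<lambda>z. dirichlet_series g (s0 + z) * K z) = vline_integral \<delta> U f"
    unfolding vline_integral_def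
  proof (rule contour_integral_eq)
    fix z assume "z \<in> path_image ?\<gamma>"
    hence "Re z = \<delta>" "\<bar>Im z\<bar> \<le> U" using pim by auto
    thus "dirichlet_series g (s0 + z) * K z = f z" unfolding f_def using eq[of "s0 + z"] by (simp add: s0_def \<delta>_def)
  qed
  ultimately have sums: "(\<lambda>i. vline_integral \<delta> U (dterm i)) sums vline_integral \<delta> U f" by (simp add: sums_def)
  define w where "w n = (if n \<in> freq_window \<nu> then g n / of_nat n powr s0 * freq_integral \<delta> U (ln (real n) - \<nu>) / 2 else 0)" for n
  define Y where "Y = 80 * 16 ^ 4 * exp (\<delta> * \<nu>) / U ^ 3"
  have wsums: "w sums (\<Sum>n\<in>freq_window \<nu>. w n)"
    by (rule sums_finite[OF finite_freq_window]) (auto simp: w_def)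
  have nb: "norm (vline_integral \<delta> U (dterm n) - w n) \<le> norm (g n) / real n powr 2 * Y" for n
  proof (cases "n < 2")
    case True
    hence "g n = 0" by (rule g(2))
    moreover from this have "dterm n = (\<lambda>z. 0)" by (simp add: dterm_def fun_eq_iff)
    ultimately show ?thesis by (simp add: w_def vline_integral_def)
  next
    case False
    thus ?thesis unfolding dterm_def K_def w_def Y_def s0_def \<delta>_def
      by (intro smoothed_dirichlet_term) (use U nu sig in auto)
  qed
  have sg: "summable (\<lambda>n. norm (g n) / real n powr 2)" using g(1) by (simp add: dirichlet_abs_conv_def)
  have "norm (\<Sum>n. vline_integral \<delta> U (dterm n) - w n) \<le> (\<Sum>n. norm (g n) / real n powr 2 * Y)"
    by (rule norm_suminf_le[OF nb summable_mult2[OF sg]])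
  also have "\<dots> = (\<Sum>n. norm (g n) / real n powr 2) * Y" by (rule suminf_mult2[OF sg, symmetric])
  also have "(\<Sum>n. vline_integral \<delta> U (dterm n) - w n) = vline_integral \<delta> U f - (\<Sum>n\<in>freq_window \<nu>. w n)"
    using sums_unique[OF sums_diff[OF sums wsums]] by simp
  finally have fin: "norm (vline_integral \<delta> U f - (\<Sum>n\<in>freq_window \<nu>. w n)) \<le> (\<Sum>n. norm (g n) / real n powr 2) * Y" .
  have "norm (vline_integral 0 U f - (\<Sum>n\<in>freq_window \<nu>. w n)) \<le> (\<Sum>n. norm (g n) / real n powr 2) * Y + 4 * E"
    using norm_triangle_ineq4[of "vline_integral \<delta> U f - (\<Sum>n\<in>freq_window \<nu>. w n)" "vline_integral \<delta> U f - vline_integral 0 U f"] fin sh by simp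
  also have "(\<Sum>n\<in>freq_window \<nu>. w n) = (\<Sum>n\<in>freq_window \<nu>. g n / of_nat n powr s0 * freq_integral \<delta> U (ln (real n) - \<nu>)) / 2"
    unfolding sum_divide_distrib by (intro sum.cong) (auto simp: w_def)
  also have "(\<Sum>n. norm (g n) / real n powr 2) * Y + 4 * E = (80 * 16 ^ 4 * (\<Sum>n. norm (g n) / real n powr 2) / U ^ 3 + 48 * 16 ^ 4 * B / U ^ 5) * exp (\<delta> * \<nu>)"
    by (simp add: Y_def E_def algebra_simps)
  finally show ?thesis unfolding v0 s0_def \<delta>_def .
qed

section \<open>Resonance\<close>

text \<open>Erdos's argument: for n = 2m + 1 the primes in (m + 1, n] divide the binomial
  coefficient n over m, since they divide n! but neither m! nor (m + 1)!. That coefficient occurs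
  twice in the row sum 2^n, so it is at most 4^m. An even n > 2 is not prime and reduces to n -
  1.\<close>

lemma prod_primes_le_4_pow: "(\<Prod>p\<in>{p::nat. prime p \<and> p \<le> n}. p) \<le> 4 ^ n"
proof (induction n rule: less_induct)
  case (less n)
  consider "n \<le> 2" | "n > 2" "even n" | "n > 2" "odd n" by linarith
  then show ?case
  proof cases
    case 1
    hence "n = 0 \<or> n = 1 \<or> n = 2" by auto
    moreover have "{p::nat. prime p \<and> p \<le> 0} = {}" "{p::nat. prime p \<and> p \<le> 1} = {}"
      by (auto dest: prime_gt_1_nat)
    moreover have "{p::nat. prime p \<and> p \<le> 2} = {2}" by (auto dest: prime_ge_2_nat)
    ultimately show ?thesis by (elim disjE; simp only:) simp_all
  next
    case 2
    have "\<not> prime n" using 2 primes_dvd_imp_eq[of 2 n] by auto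
    hence "{p::nat. prime p \<and> p \<le> n} = {p::nat. prime p \<and> p \<le> n - 1}"
      using 2 by (auto simp: le_less)
    thus ?thesis using less.IH[of "n - 1"] 2
      by simp (metis One_nat_def diff_le_self le_trans one_le_numeral power_increasing)
  next
    case 3
    then obtain m where n: "n = 2 * m + 1" by (elim oddE)
    have m: "m \<ge> 1" using n 3 by auto
    let ?A = "{p::nat. prime p \<and> p \<le> m + 1}" and ?B = "{p::nat. prime p \<and> m + 1 < p \<and> p \<le> n}"
    have un: "{p::nat. prime p \<and> p \<le> n} = ?A \<union> ?B" using n m by auto
    have fin: "finite ?A" "finite ?B" by (auto intro: finite_subset[of _ "{..m+1}"] finite_subset[of _ "{..n}"])
    have dv: "(\<Prod>p\<in>?B. p) dvd (n choose m)"
    proof -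
      have dvd: "p dvd (n choose m)" if p: "p \<in> ?B" for p
      proof -
      have "fact m * fact (n - m) * (n choose m) = (fact n :: nat)"
        by (rule binomial_fact_lemma) (use n in auto)
      moreover have "p dvd fact n" using p prime_dvd_fact_iff[of p n] by auto
      moreover have "\<not> p dvd (fact m :: nat)" "\<not> p dvd (fact (n - m) :: nat)"
        using p n by (simp_all only: prime_dvd_fact_iff mem_Collect_eq) auto
      ultimately show "p dvd (n choose m)" using p by (metis (mono_tags, lifting) mem_Collect_eq prime_dvd_mult_iff)
      qed
      have "(\<Prod>p\<in>C. p) dvd (n choose m)" if "finite C" "C \<subseteq> ?B" for C
        using that
      proof (induction C)
        case (insert p C)
        have "coprime p (\<Prod>p\<in>C. p)"
          by (rule prod_coprime_right) (use insert in \<open>auto intro!: primes_coprime\<close>)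
        thus ?case using insert dvd by (auto intro!: divides_mult)
      qed auto
      thus ?thesis using fin by blast
    qed
    have le: "(n choose m) \<le> 4 ^ m"
    proof -
      have "(n choose m) + (n choose (m+1)) = (\<Sum>k\<in>{m,m+1}. n choose k)" by simp
      also have "\<dots> \<le> (\<Sum>k\<le>n. n choose k)" by (intro sum_mono2) (use n in auto)
      also have "\<dots> = 2 ^ n" by (rule choose_row_sum)
      also have "(n choose (m+1)) = (n choose m)" using binomial_symmetric[of m n] n by (simp add: ac_simps)
      finally show ?thesis using n by (simp add: power_mult)
    qed
    have "(\<Prod>p\<in>{p::nat. prime p \<and> p \<le> n}. p) = (\<Prod>p\<in>?A. p) * (\<Prod>p\<in>?B. p)"
      unfolding un by (rule prod.union_disjoint) (use fin in auto)
    also have "\<dots> \<le> 4 ^ (m + 1) * 4 ^ m"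
      using less.IH[of "m + 1"] n m dvd_imp_le[OF dv] le by (intro mult_mono) (auto intro: order_trans)
    also have "\<dots> = 4 ^ n" using n by (simp add: power_add[symmetric] mult_2)
    finally show ?thesis .
  qed
qed

lemma integral_cis_bound:
  fixes a b T :: real assumes "a \<noteq> 0" "T \<ge> 0"
  shows "norm (integral {T..2*T} (\<lambda>t. cis (t * a + b))) \<le> 2 / \<bar>a\<bar>"
proof -
  have "((\<lambda>t. cis (t * a + b)) has_integral (cis (2*T*a+b) / (\<i> * a) - cis (T*a+b) / (\<i> * a))) {T..2*T}"
  proof (rule fundamental_theorem_of_calculus)
    fix x assume "x \<in> {T..2*T}"
    have "((\<lambda>z. exp (\<i> * (z * a + b)) / (\<i> * a)) has_field_derivative exp (\<i> * (complex_of_real x * complex_of_real a + complex_of_real b))) (at (of_real x))"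
      using assms by (auto intro!: derivative_eq_intros simp: field_simps)
    hence "((\<lambda>t. exp (\<i> * (complex_of_real t * complex_of_real a + complex_of_real b)) / (\<i> * a)) has_vector_derivative exp (\<i> * (complex_of_real x * complex_of_real a + complex_of_real b))) (at x within {T..2*T})"
      by (rule has_vector_derivative_real_field)
    thus "((\<lambda>t. cis (t * a + b) / (\<i> * a)) has_vector_derivative cis (x * a + b)) (at x within {T..2*T})"
      by (simp add: cis_conv_exp)
  qed (use assms in auto)
  hence "integral {T..2*T} (\<lambda>t. cis (t * a + b)) = cis (2*T*a+b) / (\<i> * a) - cis (T*a+b) / (\<i> * a)"
    by (rule integral_unique)
  also have "norm \<dots> \<le> 1 / \<bar>a\<bar> + 1 / \<bar>a\<bar>"
    by (rule order_trans[OF norm_triangle_ineq4]) (simp add: norm_divide norm_mult)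
  finally show ?thesis by simp
qed

text \<open>Each term of zero frequency integrates to T; every other has frequency at least 1/Y in
  modulus and integrates to at most 2Y.\<close>

lemma integral_sum_cis_approx:
  fixes a b :: "'i \<Rightarrow> real" and T Y :: real
  assumes "finite I" "Z \<subseteq> I" "T \<ge> 0" "Y > 0" "\<And>i. i \<in> Z \<Longrightarrow> a i = 0 \<and> b i = 0"
    and "\<And>i. i \<in> I - Z \<Longrightarrow> \<bar>a i\<bar> \<ge> 1 / Y"
  shows "norm (integral {T..2*T} (\<lambda>t. \<Sum>i\<in>I. cis (t * a i + b i)) - of_real (T * card Z))
     \<le> card I * (2 * Y)"
proof -
  let ?J = "\<lambda>i. integral {T..2*T} (\<lambda>t. cis (t * a i + b i))"
  have "integral {T..2*T} (\<lambda>t. \<Sum>i\<in>I. cis (t * a i + b i)) = (\<Sum>i\<in>I. ?J i)"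
    by (rule integral_sum[OF assms(1)]) (unfold cis_conv_exp, intro integrable_continuous_real continuous_intros)
  also have "\<dots> = (\<Sum>i\<in>Z. ?J i) + (\<Sum>i\<in>I-Z. ?J i)"
    using sum.subset_diff[OF assms(2,1), of ?J] by (simp add: add.commute)
  also have "(\<Sum>i\<in>Z. ?J i) = (\<Sum>i\<in>Z. of_real T)"
    by (rule sum.cong) (use assms in \<open>auto simp: scaleR_conv_of_real\<close>)
  finally have "norm (integral {T..2*T} (\<lambda>t. \<Sum>i\<in>I. cis (t * a i + b i)) - of_real (T * card Z))
      = norm (\<Sum>i\<in>I-Z. ?J i)" by (simp add: mult.commute)
  also have "\<dots> \<le> (\<Sum>i\<in>I-Z. 2 * Y)"
  proof (rule sum_norm_le)
    fix i assume i: "i \<in> I - Z"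
    have 1: "\<bar>a i\<bar> \<ge> 1 / Y" using assms(6)[OF i] .
    hence 2: "\<bar>a i\<bar> > 0" using \<open>Y > 0\<close> by (meson divide_pos_pos less_le_trans zero_less_one)
    have "norm (?J i) \<le> 2 / \<bar>a i\<bar>" by (rule integral_cis_bound) (use 2 assms in auto)
    also have "\<dots> \<le> 2 * Y" using 1 2 \<open>Y > 0\<close> by (simp add: field_simps)
    finally show "norm (?J i) \<le> 2 * Y" .
  qed
  also have "\<dots> \<le> card I * (2 * Y)"
    using assms(1,4) by (auto intro!: mult_right_mono simp: card_mono)
  finally show ?thesis .
qed

text \<open>From ln x \<le> x - 1. This separation turns unique factorization into a quantitative
  lower bound for the off-diagonal frequencies.\<close>

lemma ln_nat_diff_ge:
  fixes m n :: nat assumes "m > 0" "n > 0" "m \<noteq> n" "real m \<le> Y" "real n \<le> Y"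
  shows "\<bar>ln (real m) - ln (real n)\<bar> \<ge> 1 / Y"
proof -
  have *: "ln (real q) - ln (real p) \<ge> 1 / Y" if "p > 0" "p < q" "real q \<le> Y" for p q :: nat
  proof -
    have "ln (real p / real q) \<le> real p / real q - 1" by (rule ln_le_minus_one) (use that in auto)
    hence "ln (real q) - ln (real p) \<ge> (real q - real p) / real q"
      using that by (simp add: ln_div field_simps)
    moreover have "(real q - real p) / real q \<ge> 1 / real q" using that by (intro divide_right_mono) auto
    moreover have "1 / real q \<ge> 1 / Y" using that by (intro divide_left_mono) auto
    ultimately show ?thesis by linarith
  qed
  show ?thesis using *[of m n] *[of n m] assms by (cases m n rule: linorder_cases) auto
qed

section \<open>The resonator and its mean values\<close>

text \<open>Its squared modulus is the Fejer type product without the normalization k^-|P|. The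
  phases \<theta> do not affect the main terms of the two means below.\<close>

definition resonator :: "nat set \<Rightarrow> nat \<Rightarrow> (nat \<Rightarrow> real) \<Rightarrow> real \<Rightarrow> complex" where
  "resonator P k \<theta> t = (\<Prod>p\<in>P. \<Sum>j<k. cis (real j * (t * ln (real p) + \<theta> p)))"

text \<open>Extensional functions are used so that agreement on P is equality and the cardinality is
  exactly k^|P|.\<close>

definition exponent_functions :: "nat set \<Rightarrow> nat \<Rightarrow> (nat \<Rightarrow> nat) set" where
  "exponent_functions P k = (\<Pi>\<^sub>E p\<in>P. {..<k})"

definition exponent_product :: "nat set \<Rightarrow> (nat \<Rightarrow> nat) \<Rightarrow> nat" where
  "exponent_product P f = (\<Prod>p\<in>P. p ^ f p)"

lemma finite_exponent_functions: "finite P \<Longrightarrow> finite (exponent_functions P k)"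
  by (auto simp: exponent_functions_def intro: finite_PiE)

lemma card_exponent_functions: "finite P \<Longrightarrow> card (exponent_functions P k) = k ^ card P"
  by (simp add: exponent_functions_def card_PiE)

lemma exponent_product_pos:
  assumes "\<And>p. p \<in> P \<Longrightarrow> prime p" shows "exponent_product P f > 0"
  unfolding exponent_product_def using assms prime_gt_0_nat by (intro prod_pos) auto

lemma exponent_product_le:
  assumes "\<And>p. p \<in> P \<Longrightarrow> prime p" "\<And>p. p \<in> P \<Longrightarrow> f p \<le> k"
  shows "exponent_product P f \<le> (\<Prod>p\<in>P. p) ^ k"
proof -
  have "exponent_product P f \<le> (\<Prod>p\<in>P. p ^ k)" unfolding exponent_product_def
    by (intro prod_mono conjI power_increasing) (use assms in \<open>auto simp: Suc_le_eq prime_gt_0_nat\<close>)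
  thus ?thesis by (simp add: prod_power_distrib)
qed

lemma exponent_product_inj:
  assumes "finite P" "\<And>p. p \<in> P \<Longrightarrow> prime p" "exponent_product P f = exponent_product P g" "p \<in> P"
  shows "f p = g p"
proof -
  have "multiplicity p (exponent_product P h) = h p" for h
    unfolding exponent_product_def using assms
    by (subst multiplicity_prod_prime_powers) auto
  thus ?thesis using assms(3) by metis
qed

lemma resonator_eq_sum:
  assumes "finite P" "\<And>p. p \<in> P \<Longrightarrow> prime p"
  shows "resonator P k \<theta> t = (\<Sum>f\<in>exponent_functions P k.
     cis (t * ln (real (exponent_product P f)) + (\<Sum>p\<in>P. real (f p) * \<theta> p)))"
proof -
  have "resonator P k \<theta> t = (\<Sum>f\<in>exponent_functions P k. \<Prod>p\<in>P. cis (real (f p) * (t * ln (real p) + \<theta> p)))"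
    unfolding resonator_def exponent_functions_def by (rule prod_sum_PiE) (use assms in auto)
  also have "\<dots> = (\<Sum>f\<in>exponent_functions P k.
     cis (t * ln (real (exponent_product P f)) + (\<Sum>p\<in>P. real (f p) * \<theta> p)))"
  proof (rule sum.cong[OF refl])
    fix f assume "f \<in> exponent_functions P k"
    have "ln (real (exponent_product P f)) = (\<Sum>p\<in>P. real (f p) * ln (real p))"
      unfolding exponent_product_def of_nat_prod
      by (subst ln_prod) (use assms prime_gt_0_nat in \<open>auto simp: ln_realpow\<close>)
    moreover have "(\<Prod>p\<in>P. cis (u p)) = cis (\<Sum>p\<in>P. u p)" for u :: "nat \<Rightarrow> real"
      using assms(1) by (induction P) (auto simp: cis_mult)
    ultimately show "(\<Prod>p\<in>P. cis (real (f p) * (t * ln (real p) + \<theta> p))) =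
       cis (t * ln (real (exponent_product P f)) + (\<Sum>p\<in>P. real (f p) * \<theta> p))"
      by (simp add: sum_distrib_left sum.distrib[symmetric] algebra_simps)
  qed
  finally show ?thesis .
qed

lemma norm_resonator_le: "finite P \<Longrightarrow> norm (resonator P k \<theta> t) \<le> real k ^ card P"
  unfolding resonator_def prod_norm[symmetric]
  by (rule order_trans[OF prod_mono[where g = "\<lambda>_. real k"]]) (auto intro!: sum_norm_le[where g="\<lambda>_. 1", THEN order_trans])

lemma continuous_resonator: "continuous_on A (resonator P k \<theta>)"
  unfolding resonator_def cis_conv_exp by (intro continuous_intros)

lemma resonator_square_twisted:
  assumes "finite P" "\<And>p. p \<in> P \<Longrightarrow> prime p"
  shows "complex_of_real ((norm (resonator P k \<theta> t))\<^sup>2) * cis (- (t * u + v)) =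
    (\<Sum>(f,g)\<in>exponent_functions P k \<times> exponent_functions P k.
      cis (t * (ln (real (exponent_product P f)) - ln (real (exponent_product P g)) - u) +
        ((\<Sum>p\<in>P. real (f p) * \<theta> p) - (\<Sum>p\<in>P. real (g p) * \<theta> p) - v)))"
proof -
  have eq: "resonator P k \<theta> t = (\<Sum>f\<in>exponent_functions P k.
     cis (t * ln (real (exponent_product P f)) + (\<Sum>p\<in>P. real (f p) * \<theta> p)))"
    by (rule resonator_eq_sum) (use assms in auto)
  have "complex_of_real ((norm (resonator P k \<theta> t))\<^sup>2) * cis (- (t * u + v)) =
    resonator P k \<theta> t * cnj (resonator P k \<theta> t) * cis (- (t * u + v))"
    unfolding complex_norm_square ..
  also have "\<dots> = (\<Sum>(f,g)\<in>exponent_functions P k \<times> exponent_functions P k.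
      cis (t * ln (real (exponent_product P f)) + (\<Sum>p\<in>P. real (f p) * \<theta> p)) *
      cis (- (t * ln (real (exponent_product P g)) + (\<Sum>p\<in>P. real (g p) * \<theta> p))) * cis (- (t * u + v)))"
    unfolding eq cnj_sum cis_cnj sum_product sum.cartesian_product
    by (simp add: case_prod_unfold sum_distrib_right)
  finally show ?thesis by (simp add: cis_mult algebra_simps)
qed

text \<open>By unique factorization the frequency of a pair (f, g) vanishes only for f = g. There
  are k^|P| such pairs, and the logarithms of distinct integers up to (prod p)^k are separated by at
  least (prod p)^-k.\<close>

lemma resonator_mean:
  assumes P: "finite P" "\<And>p. p \<in> P \<Longrightarrow> prime p" and "T \<ge> 0"
  shows "\<bar>integral {T..2*T} (\<lambda>t. (norm (resonator P k \<theta> t))\<^sup>2) - T * real k ^ card P\<bar>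
    \<le> real k ^ (2 * card P) * (2 * real (\<Prod>p\<in>P. p) ^ (2 * k))"
proof -
  let ?F = "exponent_functions P k" and ?Y = "real ((\<Prod>p\<in>P. p) ^ k)"
  let ?e = "\<lambda>f. exponent_product P f" and ?Th = "\<lambda>f. \<Sum>p\<in>P. real (f p) * \<theta> p"
  let ?a = "\<lambda>(f,g). ln (real (?e f)) - ln (real (?e g))" and ?b = "\<lambda>(f,g). ?Th f - ?Th g"
  have Y1: "(\<Prod>p\<in>P. p) \<ge> 1" using P prime_gt_0_nat by (intro prod_ge_1) (auto simp: Suc_le_eq)
  have Y: "?Y \<ge> 1" using of_nat_mono[OF one_le_power[OF Y1], where 'a = real] by (simp only: of_nat_1)
  have le: "real (?e f) \<le> ?Y" if "f \<in> ?F" for f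
    unfolding of_nat_le_iff by (rule exponent_product_le)
      (use that P in \<open>auto simp: exponent_functions_def PiE_iff less_imp_le\<close>)
  have "norm (integral {T..2*T} (\<lambda>t. \<Sum>i\<in>?F \<times> ?F. cis (t * ?a i + ?b i)) - of_real (T * card ((\<lambda>f. (f,f)) ` ?F)))
     \<le> card (?F \<times> ?F) * (2 * ?Y)"
  proof (rule integral_sum_cis_approx)
    fix i assume i: "i \<in> ?F \<times> ?F - (\<lambda>f. (f,f)) ` ?F"
    obtain f g where fg: "i = (f,g)" "f \<in> ?F" "g \<in> ?F" "f \<noteq> g" using i by auto
    have "?e f \<noteq> ?e g"
    proof
      assume "?e f = ?e g"
      hence "f p = g p" if "p \<in> P" for p using exponent_product_inj[of P f g p] P that by blast
      hence "f = g" using fg unfolding exponent_functions_def by (metis PiE_ext)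
      thus False using fg by simp
    qed
    thus "\<bar>?a i\<bar> \<ge> 1 / ?Y" using fg ln_nat_diff_ge[of "?e f" "?e g" ?Y] le exponent_product_pos[of P] P by auto
  qed (use assms Y finite_exponent_functions in auto)
  moreover have "card ((\<lambda>f. (f,f)) ` ?F) = k ^ card P"
    by (subst card_image) (auto simp: inj_on_def card_exponent_functions P)
  moreover have "(\<lambda>t. \<Sum>i\<in>?F \<times> ?F. cis (t * ?a i + ?b i)) = (\<lambda>t. of_real ((norm (resonator P k \<theta> t))\<^sup>2))"
    using resonator_square_twisted[OF P, of k \<theta> _ 0 0] by (auto simp: case_prod_unfold)
  moreover have "integral {T..2*T} (\<lambda>t. complex_of_real ((norm (resonator P k \<theta> t))\<^sup>2))
     = of_real (integral {T..2*T} (\<lambda>t. (norm (resonator P k \<theta> t))\<^sup>2))"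
  proof -
    have "(\<lambda>t. (norm (resonator P k \<theta> t))\<^sup>2) integrable_on {T..2*T}"
      by (intro integrable_continuous_real continuous_intros continuous_resonator)
    from integral_linear[OF this bounded_linear_of_real] show ?thesis by (simp add: o_def)
  qed
  ultimately have "norm (complex_of_real (integral {T..2*T} (\<lambda>t. (norm (resonator P k \<theta> t))\<^sup>2) - T * real k ^ card P))
    \<le> card (?F \<times> ?F) * (2 * ?Y)"
    by simp
  also have "card (?F \<times> ?F) = k ^ (2 * card P)"
    by (simp add: card_cartesian_product card_exponent_functions P mult_2 power_add)
  \<comment> \<open>Enlarging the exponent from k to 2k gives both means the same error
    term.\<close>
  also have "real (k ^ (2 * card P)) * (2 * ?Y) \<le> real k ^ (2 * card P) * (2 * real (\<Prod>p\<in>P. p) ^ (2 * k))"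
  proof -
    have "?Y \<le> real ((\<Prod>p\<in>P. p) ^ (2 * k))"
      unfolding of_nat_le_iff by (rule power_increasing) (use Y1 in auto)
    hence "real (k ^ (2 * card P)) * (2 * ?Y) \<le> real (k ^ (2 * card P)) * (2 * real ((\<Prod>p\<in>P. p) ^ (2 * k)))"
      by (intro mult_left_mono) auto
    thus ?thesis by (simp only: of_nat_power)
  qed
  finally show ?thesis unfolding norm_of_real .
qed

text \<open>The pairs in resonance with q are those where f is g with the exponent at q raised by
  one. Both exponents must lie below k, which leaves (k - 1) k^(|P| - 1) pairs; this is the origin
  of the factor 1 - 1/k.\<close>

lemma resonator_twisted_mean:
  assumes P: "finite P" "\<And>p. p \<in> P \<Longrightarrow> prime p" and "T \<ge> 0" "q \<in> P" "k \<ge> 1"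
  shows "integral {T..2*T} (\<lambda>t. (norm (resonator P k \<theta> t))\<^sup>2 * cos (t * ln (real q) + \<theta> q))
    \<ge> T * (real k ^ card P * (1 - 1 / real k)) - real k ^ (2 * card P) * (2 * real (\<Prod>p\<in>P. p) ^ (2 * k))"
proof -
  let ?F = "exponent_functions P k" and ?Y = "real ((\<Prod>p\<in>P. p) ^ (2 * k))"
  let ?e = "\<lambda>f. exponent_product P f" and ?Th = "\<lambda>f. \<Sum>p\<in>P. real (f p) * \<theta> p"
  let ?a = "\<lambda>(f,g). ln (real (?e f)) - ln (real (?e g)) - ln (real q)"
  let ?b = "\<lambda>(f,g). ?Th f - ?Th g - \<theta> q"
  let ?up = "\<lambda>g. g(q := Suc (g q))"
  \<comment> \<open>The exponent at q stays below k - 1 so that raising it does not leave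
    \<open>exponent_functions P k\<close>.\<close>
  define Z0 where "Z0 = (\<Pi>\<^sub>E p\<in>P. if p = q then {..<k-1} else {..<k})"
  define Z where "Z = (\<lambda>g. (?up g, g)) ` Z0"
  have Y1: "(\<Prod>p\<in>P. p) \<ge> 1" using P prime_gt_0_nat by (intro prod_ge_1) (auto simp: Suc_le_eq)
  have Y: "?Y \<ge> 1" using of_nat_mono[OF one_le_power[OF Y1], where 'a = real] by (simp only: of_nat_1)
  have Z0F: "g \<in> ?F" "?up g \<in> ?F" if "g \<in> Z0" for g
    using that \<open>q \<in> P\<close> unfolding Z0_def exponent_functions_def PiE_iff
    by (force simp: extensional_def split: if_splits)+
  have e_up: "?e (?up g) = ?e g * q" for g
    unfolding exponent_product_def using P \<open>q \<in> P\<close>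
    by (subst (1 2) prod.remove[of P q]) (auto intro!: prod.cong)
  have th_up: "?Th (?up g) = ?Th g + \<theta> q" for g
    using P \<open>q \<in> P\<close> by (subst (1 2) sum.remove[of P q]) (auto simp: algebra_simps intro!: sum.cong)
  have qpos: "q > 0" using P \<open>q \<in> P\<close> prime_gt_0_nat by auto
  have le: "real (?e g * q) \<le> ?Y" if "g \<in> ?F" for g
    unfolding of_nat_le_iff e_up[symmetric] by (rule exponent_product_le)
      (use that P \<open>k \<ge> 1\<close> in \<open>auto simp: exponent_functions_def PiE_iff less_imp_le Suc_le_eq intro: trans_less_add1\<close>)
  have le': "real (?e g) \<le> ?Y" if "g \<in> ?F" for g
  proof -
    have "real (?e g) \<le> real (?e g * q)" unfolding of_nat_le_iff using qpos by auto
    thus ?thesis using le[OF that] by linarith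
  qed
  have "norm (integral {T..2*T} (\<lambda>t. \<Sum>i\<in>?F \<times> ?F. cis (t * ?a i + ?b i)) - of_real (T * card Z))
     \<le> card (?F \<times> ?F) * (2 * ?Y)"
  proof (rule integral_sum_cis_approx)
    show "Z \<subseteq> ?F \<times> ?F" using Z0F by (auto simp: Z_def)
    show "?a i = 0 \<and> ?b i = 0" if iZ: "i \<in> Z" for i
    proof -
      obtain g where g: "i = (?up g, g)" using iZ unfolding Z_def by blast
      have "ln (real (?e g * q)) = ln (real (?e g)) + ln (real q)"
        using exponent_product_pos[of P g] P qpos by (simp add: ln_mult)
      thus ?thesis unfolding g using e_up[of g] th_up[of g] by simp
    qed
    fix i assume i: "i \<in> ?F \<times> ?F - Z"
    obtain f g where fg: "i = (f,g)" "f \<in> ?F" "g \<in> ?F" using i by auto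
    have "?e f \<noteq> ?e g * q"
    proof
      assume "?e f = ?e g * q"
      hence eq: "f p = ?up g p" if "p \<in> P" for p
        using exponent_product_inj[of P f "?up g" p] P that e_up[of g] by metis
      hence "g q < k - 1" using fg(2) \<open>q \<in> P\<close> unfolding exponent_functions_def PiE_iff by force
      hence "g \<in> Z0" using fg(3) unfolding Z0_def exponent_functions_def PiE_iff by auto
      moreover have "f = ?up g"
        by (rule ext) (use eq fg \<open>q \<in> P\<close> in \<open>auto simp: exponent_functions_def PiE_iff extensional_def; metis\<close>)
      ultimately show False using i fg by (auto simp: Z_def)
    qed
    hence "\<bar>ln (real (?e f)) - ln (real (?e g * q))\<bar> \<ge> 1 / ?Y"
      using fg ln_nat_diff_ge[of "?e f" "?e g * q" ?Y] le le' exponent_product_pos[of P] P qpos by auto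
    thus "\<bar>?a i\<bar> \<ge> 1 / ?Y" using exponent_product_pos[of P g] P qpos fg
      by (simp add: ln_mult algebra_simps del: of_nat_power)
  qed (use assms Y finite_exponent_functions in auto)
  moreover have "card Z = card Z0" unfolding Z_def
    by (rule card_image) (auto simp: inj_on_def)
  moreover have "real (card Z0) = real k ^ card P * (1 - 1 / real k)"
  proof -
    have "card Z0 = (\<Prod>p\<in>P. if p = q then k - 1 else k)" unfolding Z0_def
      by (subst card_PiE) (auto simp: P intro!: prod.cong)
    also have "\<dots> = (k - 1) * (\<Prod>p\<in>P-{q}. if p = q then k - 1 else k)"
      using P \<open>q \<in> P\<close> by (subst prod.remove[of P q]) auto
    also have "(\<Prod>p\<in>P-{q}. if p = q then k - 1 else k) = (\<Prod>p\<in>P-{q}. k)" by (rule prod.cong) auto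
    also have "\<dots> = k ^ (card P - 1)" using P \<open>q \<in> P\<close> by (simp add: card_Diff_singleton)
    finally have "real (card Z0) = (real k - 1) * real k ^ (card P - 1)" using \<open>k \<ge> 1\<close> by (simp add: of_nat_diff)
    moreover have "card P \<ge> 1" using P \<open>q \<in> P\<close> by (metis One_nat_def Suc_leI card_gt_0_iff empty_iff)
    hence "real k ^ card P = real k * real k ^ (card P - 1)" by (metis Suc_diff_1 less_le_trans power_Suc zero_less_one)
    moreover have "(real k * x) * (1 - 1 / real k) = (real k - 1) * x" for x
      using \<open>k \<ge> 1\<close> by (simp add: field_simps)
    ultimately show ?thesis by metis
  qed
  moreover have "(\<lambda>t. \<Sum>i\<in>?F \<times> ?F. cis (t * ?a i + ?b i)) = (\<lambda>t. of_real ((norm (resonator P k \<theta> t))\<^sup>2) * cis (- (t * ln (real q) + \<theta> q)))"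
    by (subst resonator_square_twisted[OF P]) (auto simp: case_prod_unfold)
  moreover have "Re (integral {T..2*T} (\<lambda>t. complex_of_real ((norm (resonator P k \<theta> t))\<^sup>2) * cis (- (t * ln (real q) + \<theta> q))))
     = (integral {T..2*T} (\<lambda>t. (norm (resonator P k \<theta> t))\<^sup>2 * cos (t * ln (real q) + \<theta> q)))"
  proof -
    have "(\<lambda>t. complex_of_real ((norm (resonator P k \<theta> t))\<^sup>2) * cis (- (t * ln (real q) + \<theta> q))) integrable_on {T..2*T}"
      unfolding cis_conv_exp by (intro integrable_continuous_real continuous_intros continuous_resonator)
    from integral_linear[OF this bounded_linear_Re] show ?thesis
      by (simp add: o_def cos_diff cos_add algebra_simps del: cis_cnj)
  qed
  moreover have "card (?F \<times> ?F) = k ^ (2 * card P)"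
    by (simp add: card_cartesian_product card_exponent_functions P mult_2 power_add)
  ultimately show ?thesis
  proof -
    let ?J = "integral {T..2*T} (\<lambda>t. complex_of_real ((norm (resonator P k \<theta> t))\<^sup>2) * cis (- (t * ln (real q) + \<theta> q)))"
    assume a: "cmod (integral {T..2*T} (\<lambda>t. \<Sum>i\<in>?F \<times> ?F. cis (t * ?a i + ?b i)) - of_real (T * card Z)) \<le> card (?F \<times> ?F) * (2 * ?Y)"
      "card Z = card Z0" "real (card Z0) = real k ^ card P * (1 - 1 / real k)"
      "(\<lambda>t. \<Sum>i\<in>?F \<times> ?F. cis (t * ?a i + ?b i)) = (\<lambda>t. of_real ((norm (resonator P k \<theta> t))\<^sup>2) * cis (- (t * ln (real q) + \<theta> q)))"
      "Re ?J = (integral {T..2*T} (\<lambda>t. (norm (resonator P k \<theta> t))\<^sup>2 * cos (t * ln (real q) + \<theta> q)))"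
      "card (?F \<times> ?F) = k ^ (2 * card P)"
    have "cmod (?J - of_real (T * (real k ^ card P * (1 - 1 / real k)))) \<le> real k ^ (2 * card P) * (2 * ?Y)"
      using a(1) unfolding a(2,3,4,6) by simp
    moreover have "\<bar>Re (?J - of_real (T * (real k ^ card P * (1 - 1 / real k))))\<bar> \<le> cmod (?J - of_real (T * (real k ^ card P * (1 - 1 / real k))))"
      by (rule abs_Re_le_cmod)
    ultimately show ?thesis unfolding a(5)[symmetric] minus_complex.simps Re_complex_of_real by (simp add: abs_le_iff)
  qed
qed

lemma integral_interval_indicator:
  fixes a b c d :: real assumes "a \<le> b"
  shows "(\<lambda>t. if t \<in> {a..b} then 1 else 0::real) integrable_on {c..d}"
    and "integral {c..d} (\<lambda>t. if t \<in> {a..b} then 1 else 0) \<le> b - a"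
proof -
  have *: "{a..b} \<inter> {c..d} = {max a c..min b d}" by auto
  show "(\<lambda>t. if t \<in> {a..b} then 1 else 0::real) integrable_on {c..d}"
    by (subst integrable_restrict_Int) (simp add: * integrable_const_ivl)
  have "integral {c..d} (\<lambda>t. if t \<in> {a..b} then 1 else 0) = integral {max a c..min b d} (\<lambda>_. 1::real)"
    by (subst integral_restrict_Int) (simp add: *)
  also have "\<dots> \<le> b - a" using assms by (auto simp: content_real_if)
  finally show "integral {c..d} (\<lambda>t. if t \<in> {a..b} then 1 else 0) \<le> b - a" .
qed

text \<open>Suppose no t works and average the total defect V, in which the weights of each window
  add up to 1, against w, the squared modulus of the resonator. Away from \<open>Z\<close> some
  window misses half of its trivial bound, so V \<ge> 1/2; near \<open>Z\<close> only w \<le> K^2 is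
  available. But the twisted means bound the average of V by H/k \<le> 1/8 up to errors.\<close>

lemma resonance_method:
  fixes y :: "nat \<Rightarrow> nat \<Rightarrow> complex" and Wd :: "nat \<Rightarrow> nat set"
  assumes P: "finite P" "\<And>p. p \<in> P \<Longrightarrow> prime p"
    and Wd: "\<And>h. h < H \<Longrightarrow> Wd h \<subseteq> P"
    and disj: "\<And>g h p. g < H \<Longrightarrow> h < H \<Longrightarrow> p \<in> Wd g \<Longrightarrow> p \<in> Wd h \<Longrightarrow> g = h"
    and M: "\<And>h. h < H \<Longrightarrow> (\<Sum>p\<in>Wd h. norm (y h p)) > 0"
    and k: "k \<ge> 8 * H" "k \<ge> 1" and "T > 0" "r \<ge> 0" "finite Z"
    and small1: "real k ^ card P * real (\<Prod>p\<in>P. p) ^ (2 * k) * (32 * real H + 16) \<le> T"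
    and small2: "real k ^ card P * (real (card Z) * (16 * r)) \<le> T"
  shows "\<exists>t\<in>{T..2*T}. (\<forall>z\<in>Z. \<bar>t - z\<bar> > r) \<and>
    (\<forall>h<H. Re (\<Sum>p\<in>Wd h. y h p * cis (- (t * ln (real p)))) \<ge> (\<Sum>p\<in>Wd h. norm (y h p)) / 2)"
proof (rule ccontr)
  assume contra: "\<not> ?thesis"
  define m where "m h = (\<Sum>p\<in>Wd h. norm (y h p))" for h
  \<comment> \<open>A prime lies in at most one window, so its phase can be matched to the
    coefficient of that window.\<close>
  define idx where "idx p = (SOME h. h < H \<and> p \<in> Wd h)" for p
  define \<theta> where "\<theta> p = - Arg (y (idx p) p)" for p
  define w where "w t = (norm (resonator P k \<theta> t))\<^sup>2" for t
  define V where "V t = (\<Sum>h<H. \<Sum>p\<in>Wd h. norm (y h p) / m h * (1 - cos (t * ln (real p) + \<theta> p)))" for t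
  define K where "K = real k ^ card P"
  define E where "E = K\<^sup>2 * (2 * real (\<Prod>p\<in>P. p) ^ (2 * k))"
  define ind where "ind z t = (if t \<in> {z-r..z+r} then 1 else 0::real)" for z t
  have K1: "K \<ge> 1" using k by (simp add: K_def)
  have m: "m h > 0" if "h < H" for h using M that by (simp add: m_def)
  have finW: "finite (Wd h)" if "h < H" for h using Wd[OF that] P finite_subset by blast
  have idx: "idx p = h" if "h < H" "p \<in> Wd h" for p h
  proof -
    have "idx p < H \<and> p \<in> Wd (idx p)" unfolding idx_def by (rule someI[of _ h]) (use that in auto)
    thus ?thesis using disj that by blast
  qed
  have E': "E = real k ^ (2 * card P) * (2 * real (\<Prod>p\<in>P. p) ^ (2 * k))"
    unfolding E_def K_def by (simp add: power_mult mult.commute flip: power_mult)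
  have contw: "continuous_on A w" for A
    unfolding w_def by (intro continuous_intros continuous_resonator)
  have Iw: "w integrable_on {T..2*T}" by (intro integrable_continuous_real contw)
  have Icos: "(\<lambda>t. w t * cos (t * ln (real p) + \<theta> p)) integrable_on {T..2*T}" for p
    by (intro integrable_continuous_real continuous_intros contw)
  have wmean: "\<bar>integral {T..2*T} w - T * K\<bar> \<le> E"
    unfolding E' K_def w_def by (rule resonator_mean) (use P \<open>T > 0\<close> in auto)
  have wcos: "integral {T..2*T} (\<lambda>t. w t * cos (t * ln (real p) + \<theta> p)) \<ge> T * (K * (1 - 1 / real k)) - E" if "p \<in> P" for p
    unfolding E' K_def w_def by (rule resonator_twisted_mean) (use P \<open>T > 0\<close> k that in auto)
  have wV: "(\<lambda>t. w t * V t) = (\<lambda>t. \<Sum>h<H. \<Sum>p\<in>Wd h. norm (y h p) / m h * (w t - w t * cos (t * ln (real p) + \<theta> p)))"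
    unfolding V_def by (simp add: sum_distrib_left algebra_simps)
  have IwV: "(\<lambda>t. w t * V t) integrable_on {T..2*T}"
    unfolding wV by (intro integrable_sum integrable_on_mult_right integrable_diff Iw Icos) (use finW in auto)
  have upper: "integral {T..2*T} (\<lambda>t. w t * V t) \<le> real H * (T * K / real k + 2 * E)"
  proof -
    have "integral {T..2*T} (\<lambda>t. w t * V t) = (\<Sum>h<H. \<Sum>p\<in>Wd h. norm (y h p) / m h *
        (integral {T..2*T} w - integral {T..2*T} (\<lambda>t. w t * cos (t * ln (real p) + \<theta> p))))"
    proof -
      have I1: "(\<lambda>t. norm (y h p) / m h * (w t - w t * cos (t * ln (real p) + \<theta> p))) integrable_on {T..2*T}" for h p
        by (intro integrable_on_mult_right integrable_diff Iw Icos)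
      have I2: "(\<lambda>t. \<Sum>p\<in>Wd h. norm (y h p) / m h * (w t - w t * cos (t * ln (real p) + \<theta> p))) integrable_on {T..2*T}"
        if "h \<in> {..<H}" for h
        by (intro integrable_sum I1) (use finW that in auto)
      have "integral {T..2*T} (\<lambda>t. w t * V t) = (\<Sum>h<H. integral {T..2*T} (\<lambda>t. \<Sum>p\<in>Wd h. norm (y h p) / m h * (w t - w t * cos (t * ln (real p) + \<theta> p))))"
        unfolding wV by (rule integral_sum[OF finite_lessThan I2])
      also have "\<dots> = (\<Sum>h<H. \<Sum>p\<in>Wd h. integral {T..2*T} (\<lambda>t. norm (y h p) / m h * (w t - w t * cos (t * ln (real p) + \<theta> p))))"
        by (intro sum.cong[OF refl] integral_sum I1) (use finW in auto)
      also have "\<dots> = (\<Sum>h<H. \<Sum>p\<in>Wd h. norm (y h p) / m h *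
        (integral {T..2*T} w - integral {T..2*T} (\<lambda>t. w t * cos (t * ln (real p) + \<theta> p))))"
        by (simp only: integral_mult_right integral_diff[OF Iw Icos])
      finally show ?thesis .
    qed
    also have "\<dots> \<le> (\<Sum>h<H. \<Sum>p\<in>Wd h. norm (y h p) / m h * (T * K / real k + 2 * E))"
    proof (intro sum_mono mult_left_mono)
      fix h p assume hp: "h \<in> {..<H}" "p \<in> Wd h"
      have "p \<in> P" using hp Wd by auto
      have "T * K - T * (K * (1 - 1 / real k)) = T * K / real k" by (simp add: algebra_simps)
      thus "integral {T..2*T} w - integral {T..2*T} (\<lambda>t. w t * cos (t * ln (real p) + \<theta> p)) \<le> T * K / real k + 2 * E"
        using wmean wcos[OF \<open>p \<in> P\<close>] by linarith
      show "0 \<le> norm (y h p) / m h" using m[of h] hp by auto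
    qed
    also have "\<dots> = (\<Sum>h<H. T * K / real k + 2 * E)"
    proof (rule sum.cong[OF refl])
      fix h assume "h \<in> {..<H}"
      hence "(\<Sum>p\<in>Wd h. norm (y h p) / m h) = 1" using m[of h] by (simp add: sum_divide_distrib[symmetric] m_def)
      thus "(\<Sum>p\<in>Wd h. norm (y h p) / m h * (T * K / real k + 2 * E)) = T * K / real k + 2 * E"
        unfolding sum_distrib_right[symmetric] by simp
    qed
    finally show ?thesis by simp
  qed
  have ReV: "(\<Sum>p\<in>Wd h. norm (y h p) / m h * (1 - cos (t * ln (real p) + \<theta> p))) =
     1 - Re (\<Sum>p\<in>Wd h. y h p * cis (- (t * ln (real p)))) / m h" if "h < H" for h t
  proof -
    have "Re (y h p * cis (- (t * ln (real p)))) = norm (y h p) * cos (t * ln (real p) + \<theta> p)" if p: "p \<in> Wd h" for p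
    proof -
      have "y h p = of_real (norm (y h p)) * cis (Arg (y h p))" by (metis rcis_cmod_Arg rcis_def)
      from arg_cong[OF this, of "\<lambda>v. v * cis (- (t * ln (real p)))"]
      have "y h p * cis (- (t * ln (real p))) = of_real (norm (y h p)) * (cis (Arg (y h p)) * cis (- (t * ln (real p))))"
        by (simp add: mult.assoc)
      also have "\<dots> = of_real (norm (y h p)) * cis (- (t * ln (real p) + \<theta> p))"
        using idx[OF \<open>h < H\<close> p] by (simp add: \<theta>_def cis_mult)
      finally have "y h p * cis (- (t * ln (real p))) = of_real (norm (y h p)) * cis (- (t * ln (real p) + \<theta> p))" .
      thus ?thesis by (simp del: minus_add_distrib)
    qed
    hence "Re (\<Sum>p\<in>Wd h. y h p * cis (- (t * ln (real p)))) = (\<Sum>p\<in>Wd h. norm (y h p) * cos (t * ln (real p) + \<theta> p))"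
      unfolding Re_sum by (intro sum.cong refl)
    moreover have "(\<Sum>p\<in>Wd h. norm (y h p) / m h) = 1" using m[OF that] by (simp add: sum_divide_distrib[symmetric] m_def)
    ultimately show ?thesis by (simp add: algebra_simps sum_subtractf sum_divide_distrib)
  qed
  have V0: "(\<Sum>p\<in>Wd h. norm (y h p) / m h * (1 - cos (t * ln (real p) + \<theta> p))) \<ge> 0" if "h < H" for h t
    using m[OF that] by (intro sum_nonneg mult_nonneg_nonneg) auto
  have lower: "w t / 2 - K\<^sup>2 / 2 * (\<Sum>z\<in>Z. ind z t) \<le> w t * V t" if t: "t \<in> {T..2*T}" for t
  proof (cases "\<forall>z\<in>Z. \<bar>t - z\<bar> > r")
    case True
    hence "\<not> (\<forall>h<H. Re (\<Sum>p\<in>Wd h. y h p * cis (- (t * ln (real p)))) \<ge> m h / 2)"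
      using contra t unfolding m_def by blast
    then obtain h where h: "h < H" "Re (\<Sum>p\<in>Wd h. y h p * cis (- (t * ln (real p)))) < m h / 2"
      by (meson not_le)
    have "1 / 2 \<le> (\<Sum>p\<in>Wd h. norm (y h p) / m h * (1 - cos (t * ln (real p) + \<theta> p)))"
      unfolding ReV[OF h(1)] using h m[OF h(1)] by (simp add: field_simps)
    also have "\<dots> \<le> V t" unfolding V_def
      by (rule member_le_sum[where f = "\<lambda>h. \<Sum>p\<in>Wd h. norm (y h p) / m h * (1 - cos (t * ln (real p) + \<theta> p))"])
         (use V0 h in auto)
    finally have "w t * (1 / 2) \<le> w t * V t" by (intro mult_left_mono) (auto simp: w_def)
    moreover have "K\<^sup>2 / 2 * (\<Sum>z\<in>Z. ind z t) \<ge> 0" by (intro mult_nonneg_nonneg sum_nonneg) (auto simp: ind_def)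
    ultimately show ?thesis by simp
  next
    case False
    then obtain z where z: "z \<in> Z" "\<bar>t - z\<bar> \<le> r" by force
    have "1 = ind z t" using z by (auto simp: ind_def abs_le_iff)
    also have "\<dots> \<le> (\<Sum>z\<in>Z. ind z t)"
      by (rule member_le_sum) (use z \<open>finite Z\<close> in \<open>auto simp: ind_def\<close>)
    finally have "K\<^sup>2 / 2 * 1 \<le> K\<^sup>2 / 2 * (\<Sum>z\<in>Z. ind z t)" by (intro mult_left_mono) auto
    moreover have "w t \<le> K\<^sup>2" unfolding w_def K_def by (intro power_mono norm_resonator_le P) auto
    moreover have "V t \<ge> 0" unfolding V_def using V0 by (intro sum_nonneg[where A = "{..<H}"]) auto
    hence "w t * V t \<ge> 0" by (simp add: w_def)
    ultimately show ?thesis by simp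
  qed
  have Iind: "ind z integrable_on {T..2*T}" "integral {T..2*T} (ind z) \<le> 2 * r" for z
    using integral_interval_indicator[of "z - r" "z + r" T "2 * T"] \<open>r \<ge> 0\<close> unfolding ind_def by auto
  have Isum: "(\<lambda>t. \<Sum>z\<in>Z. ind z t) integrable_on {T..2*T}"
    by (intro integrable_sum Iind \<open>finite Z\<close>)
  have "integral {T..2*T} (\<lambda>t. w t / 2 - K\<^sup>2 / 2 * (\<Sum>z\<in>Z. ind z t)) \<le> integral {T..2*T} (\<lambda>t. w t * V t)"
    by (rule integral_le[OF _ IwV lower]) (intro integrable_diff integrable_on_divide integrable_on_mult_right Iw Isum, auto)
  also have "integral {T..2*T} (\<lambda>t. w t / 2 - K\<^sup>2 / 2 * (\<Sum>z\<in>Z. ind z t))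
     = integral {T..2*T} w / 2 - K\<^sup>2 / 2 * (\<Sum>z\<in>Z. integral {T..2*T} (ind z))"
    by (subst integral_diff) (auto intro!: integrable_on_divide integrable_on_mult_right Iw Isum simp: integral_sum[OF \<open>finite Z\<close> Iind(1)])
  finally have A: "integral {T..2*T} w / 2 - K\<^sup>2 / 2 * (\<Sum>z\<in>Z. integral {T..2*T} (ind z)) \<le> real H * (T * K / real k + 2 * E)"
    using upper by linarith
  have "(\<Sum>z\<in>Z. integral {T..2*T} (ind z)) \<le> (\<Sum>z\<in>Z. 2 * r)" by (intro sum_mono Iind)
  hence "K\<^sup>2 / 2 * (\<Sum>z\<in>Z. integral {T..2*T} (ind z)) \<le> K\<^sup>2 / 2 * (real (card Z) * (2 * r))" by (intro mult_left_mono) auto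
  also have "\<dots> = K * (K * (real (card Z) * (16 * r))) / 16" by (simp add: power2_eq_square)
  also have "\<dots> \<le> K * T / 16" using small2 K1 unfolding K_def[symmetric] by (intro divide_right_mono mult_left_mono) auto
  finally have B: "K\<^sup>2 / 2 * (\<Sum>z\<in>Z. integral {T..2*T} (ind z)) \<le> K * T / 16" .
  have "E * (16 * real H + 8) = K * (K * real (\<Prod>p\<in>P. p) ^ (2 * k) * (32 * real H + 16))"
    unfolding E_def by (simp add: power2_eq_square algebra_simps)
  also have "\<dots> \<le> K * T" using small1 K1 unfolding K_def[symmetric] by (intro mult_left_mono) auto
  finally have C: "E * (16 * real H + 8) \<le> K * T" .
  have "real H * (T * K / real k) = T * K * (real H / real k)" by simp
  also have "\<dots> \<le> T * K * (1 / 8)"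
  proof (intro mult_left_mono)
    have "8 * real H \<le> real k" using k(1) by (metis of_nat_le_iff of_nat_mult of_nat_numeral)
    thus "real H / real k \<le> 1 / 8" using k(2) by (simp add: field_simps)
  qed (use K1 \<open>T > 0\<close> in auto)
  finally have D: "real H * (T * K / real k) \<le> T * K / 8" by simp
  \<comment> \<open>In units of KT: the neighbourhood of \<open>Z\<close> costs 1/16, the defects
    cost 1/8, and 2HE + E/2 is at most 1/8. The total 5/16 would have to reach 1/2.\<close>
  have "real H * (T * K / real k + 2 * E) = real H * (T * K / real k) + 2 * (real H * E)" by (simp add: algebra_simps)
  hence "integral {T..2*T} w / 2 \<le> K * T / 16 + T * K / 8 + 2 * (real H * E)" using A B D by linarith
  moreover have "integral {T..2*T} w \<ge> T * K - E" using wmean by linarith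
  moreover have "16 * (real H * E) + 8 * E \<le> K * T" using C by (simp add: algebra_simps)
  moreover have "K * T > 0" using K1 \<open>T > 0\<close> by simp
  moreover have "E \<ge> 0" by (simp add: E_def)
  moreover have "T * K = K * T" by simp
  moreover have "real H * E \<ge> 0" using \<open>E \<ge> 0\<close> by simp
  ultimately show False by linarith
qed

section \<open>Large values\<close>

lemma selberg_holomorphic:
  assumes "selberg_class a L" shows "L holomorphic_on {s. s \<noteq> 1}"
proof -
  obtain m :: nat and F :: "complex \<Rightarrow> complex" where F: "F holomorphic_on UNIV"
    "\<And>s. s \<noteq> 1 \<Longrightarrow> F s = (s - 1) ^ m * L s"
    using assms unfolding selberg_class_def by blast
  have "(\<lambda>s. F s / (s - 1) ^ m) holomorphic_on {s. s \<noteq> 1}"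
    using holomorphic_on_subset[OF F(1)] by (intro holomorphic_intros) auto
  thus ?thesis by (rule holomorphic_transform) (use F(2) in auto)
qed

text \<open>Since \<open>card\<close> is 0 on infinite sets, \<open>zero_count\<close> controls
  zeros only once finiteness is known. The zeros lie in a compact rectangle and are zeros of the
  entire function (s - 1)^m L(s), which does not vanish at 2.\<close>

lemma selberg_finite_zeros:
  assumes L: "selberg_class a L" and nz: "\<And>s. Re s > 3/2 \<Longrightarrow> L s \<noteq> 0" and "T > 0"
  shows "finite {\<rho>. L \<rho> = 0 \<and> T \<le> Im \<rho> \<and> Im \<rho> \<le> 2 * T \<and> Re \<rho> \<ge> \<sigma>}"
proof -
  obtain m :: nat and F :: "complex \<Rightarrow> complex" where F: "F holomorphic_on UNIV"
    "\<And>s. s \<noteq> 1 \<Longrightarrow> F s = (s - 1) ^ m * L s"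
    using L unfolding selberg_class_def by blast
  have F2: "F 2 \<noteq> 0" using F(2)[of 2] nz[of 2] by simp
  let ?K = "cbox (Complex \<sigma> T) (Complex 2 (2 * T))"
  have "finite {z\<in>?K. F z = 0}"
  proof (cases "F constant_on UNIV")
    case True
    then obtain c where "\<And>z. F z = c" unfolding constant_on_def by auto
    thus ?thesis using F2 by auto
  qed (use holomorphic_compact_finite_zeros[OF F(1), of ?K] in auto)
  moreover have "{\<rho>. L \<rho> = 0 \<and> T \<le> Im \<rho> \<and> Im \<rho> \<le> 2 * T \<and> Re \<rho> \<ge> \<sigma>} \<subseteq> {z\<in>?K. F z = 0}"
  proof
    fix \<rho> assume r: "\<rho> \<in> {\<rho>. L \<rho> = 0 \<and> T \<le> Im \<rho> \<and> Im \<rho> \<le> 2 * T \<and> Re \<rho> \<ge> \<sigma>}"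
    hence "\<rho> \<noteq> 1" using \<open>T > 0\<close> by auto
    moreover have "Re \<rho> \<le> 3/2" using nz[of \<rho>] r by force
    ultimately show "\<rho> \<in> {z\<in>?K. F z = 0}" using r F(2)[of \<rho>] by (auto simp: in_cbox_complex_iff)
  qed
  ultimately show ?thesis by (rule rev_finite_subset)
qed

lemma norm_dirichlet_series_le:
  assumes "dirichlet_abs_conv g \<sigma>" "Re s \<ge> \<sigma>"
  shows "norm (dirichlet_series g s) \<le> (\<Sum>n. norm (g n) / real n powr \<sigma>)"
  unfolding dirichlet_series_def
proof (rule norm_suminf_le)
  show "summable (\<lambda>n. norm (g n) / real n powr \<sigma>)" using assms by (simp add: dirichlet_abs_conv_def)
  fix n show "norm (g n / of_nat n powr s) \<le> norm (g n) / real n powr \<sigma>"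
    unfolding norm_dirichlet_term using assms by (cases "n = 0") (auto intro!: divide_left_mono powr_mono)
qed

text \<open>The series starts at n = 2 and is therefore O(2^-\<sigma>). This identifies it as the
  branch of the logarithm normalized at infinity.\<close>

lemma dirichlet_series_tendsto_0:
  assumes g: "dirichlet_abs_conv g 2" "\<And>n. n < 2 \<Longrightarrow> g n = 0"
  shows "((\<lambda>\<sigma>::real. dirichlet_series g (of_real \<sigma>)) \<longlongrightarrow> 0) at_top"
proof (rule Lim_null_comparison)
  define A where "A = (\<Sum>n. norm (g n) / real n powr 2)"
  have sA: "summable (\<lambda>n. norm (g n) / real n powr 2)" using g(1) by (simp add: dirichlet_abs_conv_def)
  show "((\<lambda>\<sigma>. A * 2 powr (2 - \<sigma>)) \<longlongrightarrow> 0) at_top" by (rule tendsto_mult_right_zero) real_asymp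
  show "\<forall>\<^sub>F \<sigma> in at_top. norm (dirichlet_series g (of_real \<sigma>)) \<le> A * 2 powr (2 - \<sigma>)"
    using eventually_ge_at_top[of 2]
  proof eventually_elim
    case (elim \<sigma>)
    have "norm (dirichlet_series g (of_real \<sigma>)) \<le> (\<Sum>n. norm (g n) / real n powr 2 * 2 powr (2 - \<sigma>))"
      unfolding dirichlet_series_def
    proof (rule norm_suminf_le[OF _ summable_mult2[OF sA]])
      fix n :: nat
      show "norm (g n / of_nat n powr of_real \<sigma>) \<le> norm (g n) / real n powr 2 * 2 powr (2 - \<sigma>)"
      proof (cases "n < 2")
        case False
        have "real n powr (2 - \<sigma>) \<le> 2 powr (2 - \<sigma>)" using False elim by (intro powr_mono2') auto
        hence "norm (g n) / real n powr 2 * real n powr (2 - \<sigma>) \<le> norm (g n) / real n powr 2 * 2 powr (2 - \<sigma>)"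
          by (intro mult_left_mono) auto
        moreover have "norm (g n / of_nat n powr of_real \<sigma>) = norm (g n) / real n powr 2 * real n powr (2 - \<sigma>)"
          unfolding norm_dirichlet_term using False by (simp add: powr_diff)
        ultimately show ?thesis by simp
      qed (simp add: g(2))
    qed
    also have "\<dots> = A * 2 powr (2 - \<sigma>)" unfolding A_def by (rule suminf_mult2[OF sA, symmetric])
    finally show ?case .
  qed
qed

text \<open>A zero-free convex open set around the rectangle carries a logarithm, normalized by the
  Dirichlet series at 2 + it. The open disc about 2 + i Im s that touches the line Re s = \<sigma>
  lies in this set, and Borel-Caratheodory on it gives the denominator Re s - \<sigma>.\<close>

lemma selberg_zero_free_log:
  assumes L: "selberg_class a L"
    and g: "dirichlet_abs_conv g 2" "\<And>n. n < 2 \<Longrightarrow> g n = 0"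
    and Lg: "\<And>s. Re s > 3/2 \<Longrightarrow> L s = exp (dirichlet_series g s)"
    and C: "C > 0" and growth: "\<And>s. Re s \<ge> -1 \<Longrightarrow> \<bar>Im s\<bar> \<ge> 1 \<Longrightarrow> norm (L s) \<le> C * (1 + \<bar>Im s\<bar>) ^ M"
    and sig: "1/2 < \<sigma>" "\<sigma> < 1" and U: "U \<ge> 0" and t: "t \<ge> U + 5"
    and zf: "\<And>\<rho>. L \<rho> = 0 \<Longrightarrow> Re \<rho> \<ge> \<sigma> \<Longrightarrow> \<bar>Im \<rho> - t\<bar> > U + 3"
  defines "A \<equiv> (\<Sum>n. norm (g n) / real n powr 2)"
  obtains lg S where "lg holomorphic_on S" "convex S"
    "\<And>s. \<sigma> \<le> Re s \<Longrightarrow> Re s \<le> 2 \<Longrightarrow> \<bar>Im s - t\<bar> \<le> U \<Longrightarrow> s \<in> S"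
    "\<And>s. Re s = 2 \<Longrightarrow> \<bar>Im s - t\<bar> \<le> U \<Longrightarrow> lg s = dirichlet_series g s"
    "\<And>s. \<sigma> \<le> Re s \<Longrightarrow> Re s \<le> 2 \<Longrightarrow> \<bar>Im s - t\<bar> \<le> U \<Longrightarrow> log_L L s = lg s"
    "\<And>s. \<sigma> < Re s \<Longrightarrow> Re s \<le> 2 \<Longrightarrow> \<bar>Im s - t\<bar> \<le> U \<Longrightarrow>
        norm (lg s) \<le> (6 * A + 4 * (\<bar>ln C\<bar> + real M * ln (t + U + 3) + 1)) / (Re s - \<sigma>)"
proof -
  define R0 where "R0 = cbox (Complex \<sigma> (t - U - 2)) (Complex 4 (t + U + 2))"
  define N where "N = {s. Im s > 1} \<inter> {s. L s \<noteq> 0}"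
  have Lhol: "L holomorphic_on {s. Im s > 1}" by (rule holomorphic_on_subset[OF selberg_holomorphic[OF L]]) auto
  have oN: "open N"
  proof -
    have "open ({s. Im s > 1} \<inter> L -` (- {0}))"
      by (rule continuous_open_preimage[OF holomorphic_on_imp_continuous_on[OF Lhol]]) (auto intro: open_halfspace_Im_gt)
    moreover have "{s. Im s > 1} \<inter> L -` (- {0}) = N" by (auto simp: N_def)
    ultimately show ?thesis by simp
  qed
  have R0N: "R0 \<subseteq> N"
  proof
    fix s assume "s \<in> R0"
    hence s: "\<sigma> \<le> Re s" "t - U - 2 \<le> Im s" "Im s \<le> t + U + 2" by (auto simp: R0_def in_cbox_complex_iff)
    hence "L s \<noteq> 0" using zf[of s] by (auto simp: abs_if split: if_splits)
    thus "s \<in> N" using s t by (auto simp: N_def)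
  qed
  \<comment> \<open>Compactness provides room to the left of the line \<sigma>, so that the line is
    interior to S. The width e depends on t and enters no bound.\<close>
  obtain e where e: "e > 0" "(\<Union>x\<in>R0. ball x e) \<subseteq> N"
    using compact_subset_open_imp_ball_epsilon_subset[OF _ oN R0N] by (auto simp: R0_def)
  define S where "S = {s. Re s > \<sigma> - e} \<inter> {s. Re s < 4} \<inter> {s. Im s > t - U - 2} \<inter> {s. Im s < t + U + 2}"
  have oS: "open S" unfolding S_def by (intro open_Int open_halfspace_Re_gt open_halfspace_Re_lt open_halfspace_Im_gt open_halfspace_Im_lt)
  have cS: "convex S" unfolding S_def by (intro convex_Int convex_halfspace_Re_gt convex_halfspace_Re_lt convex_halfspace_Im_gt convex_halfspace_Im_lt)
  have SN: "S \<subseteq> N"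
  proof
    fix s assume s: "s \<in> S"
    define s' where "s' = Complex (max \<sigma> (Re s)) (Im s)"
    have "s' \<in> R0" using s sig by (auto simp: s'_def R0_def S_def in_cbox_complex_iff)
    moreover have "dist s' s < e"
    proof -
      have "dist s' s = \<bar>max \<sigma> (Re s) - Re s\<bar>" by (simp add: dist_norm s'_def cmod_def)
      also have "\<dots> < e" using s e by (auto simp: S_def max_def)
      finally show ?thesis .
    qed
    hence "s \<in> ball s' e" by simp
    ultimately show "s \<in> N" using e(2) by blast
  qed
  have inS: "s \<in> S" if "\<sigma> \<le> Re s" "Re s < 4" "\<bar>Im s - t\<bar> < U + 2" for s
    using that e by (auto simp: S_def abs_less_iff)
  have "L holomorphic_on S" by (rule holomorphic_on_subset[OF Lhol]) (use SN in \<open>auto simp: N_def\<close>)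
  moreover have "contractible S" using cS by (rule convex_imp_contractible)
  moreover have "L s \<noteq> 0" if "s \<in> S" for s using SN that by (auto simp: N_def)
  ultimately obtain g0 where g0: "g0 holomorphic_on S" "\<And>z. z \<in> S \<Longrightarrow> L z = exp (g0 z)"
    using contractible_imp_holomorphic_log by metis
  define c0 where "c0 = Complex 2 t"
  have c0: "c0 \<in> S" by (rule inS) (use sig U in \<open>auto simp: c0_def\<close>)
  \<comment> \<open>The added constant has exponential 1; it moves \<open>g0\<close> to the branch
    given by the Dirichlet series.\<close>
  define lg where "lg z = g0 z + (dirichlet_series g c0 - g0 c0)" for z
  have lgh: "lg holomorphic_on S" unfolding lg_def by (intro holomorphic_intros g0(1))
  have "exp (dirichlet_series g c0 - g0 c0) = 1"
    using Lg[of c0] g0(2)[OF c0] by (simp add: exp_diff c0_def)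
  hence elg: "exp (lg z) = L z" if "z \<in> S" for z using g0(2)[OF that] by (simp add: lg_def exp_add)
  have contG: "continuous_on {s. Re s \<ge> 2} (dirichlet_series g)" by (rule continuous_on_dirichlet_series[OF g(1)])
  have eq2: "lg s = dirichlet_series g s" if s: "Re s \<ge> 2" "s \<in> S" for s
  proof (rule exp_lifts_eq[of "S \<inter> {s. Re s \<ge> 2}" lg _ c0])
    show "connected (S \<inter> {s. Re s \<ge> 2})" by (intro convex_connected convex_Int cS convex_halfspace_Re_ge)
    show "continuous_on (S \<inter> {s. Re s \<ge> 2}) lg" by (rule continuous_on_subset[OF holomorphic_on_imp_continuous_on[OF lgh]]) auto
    show "continuous_on (S \<inter> {s. Re s \<ge> 2}) (dirichlet_series g)" by (rule continuous_on_subset[OF contG]) auto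
    show "exp (lg u) = exp (dirichlet_series g u)" if "u \<in> S \<inter> {s. 2 \<le> Re s}" for u
      using elg[of u] Lg[of u] that by auto
  qed (use c0 s in \<open>auto simp: c0_def lg_def\<close>)
  have logL: "log_L L s = lg s" if s: "\<sigma> \<le> Re s" "Re s \<le> 2" "\<bar>Im s - t\<bar> \<le> U" for s
  proof (rule log_L_eq[OF contG _ dirichlet_series_tendsto_0[OF g] _ cS elg])
    show "exp (dirichlet_series g s) = L s" if "2 \<le> Re s" for s using Lg[of s] that by simp
    show "continuous_on S lg" by (rule holomorphic_on_imp_continuous_on[OF lgh])
    show c: "2 + \<i> * of_real (Im s) \<in> S" by (rule inS) (use s sig in auto)
    show "s \<in> S" by (rule inS) (use s in auto)
    show "lg (2 + \<i> * of_real (Im s)) = dirichlet_series g (2 + \<i> * of_real (Im s))" by (rule eq2[OF _ c]) simp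
  qed
  have A0: "A \<ge> 0" unfolding A_def using g(1) by (intro suminf_nonneg) (auto simp: dirichlet_abs_conv_def)
  define A2 where "A2 = \<bar>ln C\<bar> + real M * ln (t + U + 3) + A + 1"
  have ln0: "ln (t + U + 3) \<ge> 0" using t U by (intro ln_ge_zero) auto
  have A2: "A2 > 0" unfolding A2_def using A0 ln0 by (intro add_nonneg_pos add_nonneg_nonneg mult_nonneg_nonneg) auto
  have bound: "norm (lg s) \<le> (6 * A + 4 * (\<bar>ln C\<bar> + real M * ln (t + U + 3) + 1)) / (Re s - \<sigma>)"
    if s: "\<sigma> < Re s" "Re s \<le> 2" "\<bar>Im s - t\<bar> \<le> U" for s
  proof -
    define c where "c = Complex 2 (Im s)"
    \<comment> \<open>This radius is less than 3/2, so a disc centred at a height within U of t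
      stays within U + 2.\<close>
    define R where "R = 2 - \<sigma>"
    have R: "0 < R" "R < 3/2" using sig by (auto simp: R_def)
    have ball: "z \<in> S" "Re z \<ge> -1" "\<bar>Im z\<bar> \<ge> 1" "\<bar>Im z\<bar> \<le> t + U + 2" if z: "z \<in> ball c R" for z
    proof -
      have 1: "\<bar>Re z - 2\<bar> < R" "\<bar>Im z - Im s\<bar> < R"
        using abs_Re_le_cmod[of "c - z"] abs_Im_le_cmod[of "c - z"] z by (auto simp: c_def dist_norm)
      show "z \<in> S" by (rule inS) (use 1 R s in \<open>auto simp: R_def abs_less_iff abs_le_iff\<close>)
      show "Re z \<ge> -1" using 1 R by (auto simp: abs_less_iff)
      show "\<bar>Im z\<bar> \<ge> 1" "\<bar>Im z\<bar> \<le> t + U + 2" using 1 R s t U by linarith+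
    qed
    have cS': "c \<in> S" by (rule ball) (use R in auto)
    have lgc: "norm (lg c) \<le> A" unfolding A_def using eq2[OF _ cS'] norm_dirichlet_series_le[OF g(1), of c] by (simp add: c_def)
    define f where "f z = lg z - lg c" for z
    have d: "dist c s = 2 - Re s" using s by (simp add: c_def dist_norm cmod_def abs_if)
    have sb: "s \<in> ball c R" using d s by (simp add: R_def)
    have "norm (f s) \<le> 2 * A2 * dist c s / (R - dist c s)"
    proof (rule borel_caratheodory[OF _ R(1) A2 _ _ sb])
      show "f holomorphic_on ball c R" unfolding f_def
        by (intro holomorphic_intros holomorphic_on_subset[OF lgh]) (use ball(1) in auto)
      show "f c = 0" by (simp add: f_def)
      fix z assume z: "z \<in> ball c R"
      have "exp (Re (lg z)) = norm (L z)" using elg[OF ball(1)[OF z]] by (metis norm_exp_eq_Re)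
      also have "\<dots> \<le> C * (1 + \<bar>Im z\<bar>) ^ M" by (rule growth) (use ball[OF z] in auto)
      also have "\<dots> \<le> C * (t + U + 3) ^ M" using ball(4)[OF z] C by (intro mult_left_mono power_mono) auto
      also have "\<dots> = exp (ln C + real M * ln (t + U + 3))" using C t U by (simp add: exp_add exp_of_nat_mult)
      finally have "Re (lg z) \<le> \<bar>ln C\<bar> + real M * ln (t + U + 3)" unfolding exp_le_cancel_iff by linarith
      moreover have "- Re (lg c) \<le> A" using lgc abs_Re_le_cmod[of "lg c"] by linarith
      ultimately show "Re (f z) < A2" by (simp add: f_def A2_def)
    qed
    also have "R - dist c s = Re s - \<sigma>" using d by (simp add: R_def)
    also have "2 * A2 * dist c s / (Re s - \<sigma>) \<le> 4 * A2 / (Re s - \<sigma>)"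
    proof (intro divide_right_mono)
      have "2 * A2 * dist c s \<le> 2 * A2 * 2" using d s sig A2 by (intro mult_left_mono) auto
      thus "2 * A2 * dist c s \<le> 4 * A2" by simp
    qed (use s in auto)
    finally have "norm (lg s) \<le> 4 * A2 / (Re s - \<sigma>) + A"
      using lgc norm_triangle_ineq[of "f s" "lg c"] by (simp add: f_def)
    \<comment> \<open>Re s - \<sigma> is at most 2, so a constant can be absorbed into the singular
      bound.\<close>
    also have "A \<le> 2 * A / (Re s - \<sigma>)"
    proof -
      have "A * (Re s - \<sigma>) \<le> A * 2" using A0 s sig by (intro mult_left_mono) auto
      thus ?thesis using s by (simp add: pos_le_divide_eq mult.commute)
    qed
    finally show ?thesis by (simp add: A2_def add_divide_distrib algebra_simps)
  qed
  show ?thesis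
  proof (rule that[OF lgh cS])
    show "s \<in> S" if "\<sigma> \<le> Re s" "Re s \<le> 2" "\<bar>Im s - t\<bar> \<le> U" for s by (rule inS) (use that in auto)
    show "lg s = dirichlet_series g s" if "Re s = 2" "\<bar>Im s - t\<bar> \<le> U" for s
      by (rule eq2[OF _ inS]) (use that sig in auto)
  qed (use logL bound in auto)
qed

text \<open>The point is that g, \<theta>, C and B are fixed before T, U, t and \<nu>. As t + U + 3
  \<le> 2T \<le> T^2, the Borel-Caratheodory constant is at most D log T with D depending only on
  L.\<close>

lemma selberg_smoothed_log:
  assumes L: "selberg_class a L" and sig: "1/2 < \<sigma>" "\<sigma> < 1"
  obtains g \<theta> C B where "0 \<le> \<theta>" "\<theta> < 1/2" "C \<ge> 0" "B \<ge> 0" "\<And>n. n \<ge> 1 \<Longrightarrow> norm (g n) \<le> C * real n powr \<theta>"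
    "\<And>n. \<not> primepow n \<Longrightarrow> g n = 0" "\<And>p. prime p \<Longrightarrow> g p = a p"
    "\<And>T U t \<nu>. U \<ge> 2 \<Longrightarrow> U + 5 \<le> t \<Longrightarrow> t + U + 3 \<le> 2 * T \<Longrightarrow> T \<ge> 3 \<Longrightarrow> \<nu> \<ge> 0 \<Longrightarrow>
       (\<And>\<rho>. L \<rho> = 0 \<Longrightarrow> Re \<rho> \<ge> \<sigma> \<Longrightarrow> \<bar>Im \<rho> - t\<bar> > U + 3) \<Longrightarrow>
       continuous_on {-U..U} (\<lambda>u. log_L L (Complex \<sigma> (t + u))) \<and>
       norm (\<i> * integral {-U..U} (\<lambda>u. log_L L (Complex \<sigma> (t + u)) * of_real (smoothing_kernel_re U u * (1 + cos (\<nu> * u))))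
      - (\<Sum>n\<in>freq_window \<nu>. g n / of_nat n powr Complex \<sigma> t * freq_integral (2 - \<sigma>) U (ln (real n) - \<nu>)) / 2)
       \<le> (B / U ^ 3 + B * ln T / U ^ 5) * exp ((2 - \<sigma>) * \<nu>)"
proof -
  obtain g C0 \<theta> where g: "0 \<le> \<theta>" "\<theta> < 1/2" "C0 \<ge> 0" "\<And>n. n \<ge> 1 \<Longrightarrow> norm (g n) \<le> C0 * real n powr \<theta>"
    "\<And>n. \<not> primepow n \<Longrightarrow> g n = 0" "\<And>s. Re s > 3/2 \<Longrightarrow> L s = exp (dirichlet_series g s)"
    "\<And>p. prime p \<Longrightarrow> g p = a p"
    using selberg_class_log_coeffs[OF L] by metis
  obtain C M where C: "C > 0" "\<And>s. Re s \<ge> -1 \<Longrightarrow> \<bar>Im s\<bar> \<ge> 1 \<Longrightarrow> norm (L s) \<le> C * (1 + \<bar>Im s\<bar>) ^ M"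
    using selberg_poly_growth[OF L] by blast
  have ac: "dirichlet_abs_conv g 2" by (rule dirichlet_abs_conv_bounded[where e = \<theta>, OF g(4)]) (use g in auto)
  have g01: "g n = 0" if "n < 2" for n
  proof -
    have "n = 0 \<or> n = 1" using that by auto
    thus ?thesis using g(5)[of n] by auto
  qed
  define A where "A = (\<Sum>n. norm (g n) / real n powr 2)"
  have A0: "A \<ge> 0" unfolding A_def using ac by (intro suminf_nonneg) (auto simp: dirichlet_abs_conv_def)
  define D where "D = 6 * A + 4 * (\<bar>ln C\<bar> + 2 * real M + 1)"
  have D0: "D \<ge> 0" using A0 by (simp add: D_def)
  define B where "B = 80 * 16 ^ 4 * A + 48 * 16 ^ 4 * D"
  have B0: "B \<ge> 0" using A0 D0 by (simp add: B_def)
  show ?thesis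
  proof (rule that[OF g(1,2,3) B0 g(4,5,7)])
    fix T U t \<nu> :: real
    assume U: "U \<ge> 2" and t: "U + 5 \<le> t" "t + U + 3 \<le> 2 * T" and T: "T \<ge> 3" and nu: "\<nu> \<ge> 0"
      and zf: "\<And>\<rho>. L \<rho> = 0 \<Longrightarrow> Re \<rho> \<ge> \<sigma> \<Longrightarrow> \<bar>Im \<rho> - t\<bar> > U + 3"
    define D' where "D' = 6 * A + 4 * (\<bar>ln C\<bar> + real M * ln (t + U + 3) + 1)"
    obtain lg S where lg: "lg holomorphic_on S" "convex S"
      "\<And>s. \<sigma> \<le> Re s \<Longrightarrow> Re s \<le> 2 \<Longrightarrow> \<bar>Im s - t\<bar> \<le> U \<Longrightarrow> s \<in> S"
      "\<And>s. Re s = 2 \<Longrightarrow> \<bar>Im s - t\<bar> \<le> U \<Longrightarrow> lg s = dirichlet_series g s"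
      "\<And>s. \<sigma> \<le> Re s \<Longrightarrow> Re s \<le> 2 \<Longrightarrow> \<bar>Im s - t\<bar> \<le> U \<Longrightarrow> log_L L s = lg s"
      "\<And>s. \<sigma> < Re s \<Longrightarrow> Re s \<le> 2 \<Longrightarrow> \<bar>Im s - t\<bar> \<le> U \<Longrightarrow> norm (lg s) \<le> D' / (Re s - \<sigma>)"
      unfolding D'_def A_def
      by (rule selberg_zero_free_log[OF L ac g01 g(6) C sig _ t(1) zf]) (use U in auto)
    have lnT: "ln T \<ge> 1" using T exp_le by (subst ln_ge_iff) auto
    have ln0: "ln (t + U + 3) \<ge> 0" using t U by (intro ln_ge_zero) auto
    have "ln (t + U + 3) \<le> ln (2 * T)" using t U by simp
    also have "\<dots> \<le> ln (T * T)" using T by simp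
    also have "\<dots> = 2 * ln T" using T by (simp add: ln_mult)
    finally have l2: "ln (t + U + 3) \<le> 2 * ln T" .
    have D'0: "D' \<ge> 0" unfolding D'_def using A0 ln0 by (intro add_nonneg_nonneg mult_nonneg_nonneg) auto
    have D'D: "D' \<le> D * ln T"
    proof -
      have "real M * ln (t + U + 3) \<le> real M * (2 * ln T)" by (intro mult_left_mono l2) auto
      moreover have "A * 1 \<le> A * ln T" using lnT A0 by (intro mult_left_mono) auto
      moreover have "\<bar>ln C\<bar> * 1 \<le> \<bar>ln C\<bar> * ln T" using lnT by (intro mult_left_mono) auto
      ultimately show ?thesis unfolding D'_def D_def using lnT by (simp add: algebra_simps)
    qed
    have ll: "log_L L (Complex \<sigma> (t + u)) = lg (Complex \<sigma> (t + u))" if "u \<in> {-U..U}" for u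
      by (rule lg(5)) (use that sig in auto)
    have "continuous_on {-U..U} (\<lambda>u. lg (Complex \<sigma> (t + u)))"
      by (rule continuous_on_compose2[OF holomorphic_on_imp_continuous_on[OF lg(1)]])
         (use sig in \<open>auto intro!: continuous_intros lg(3)\<close>)
    hence c: "continuous_on {-U..U} (\<lambda>u. log_L L (Complex \<sigma> (t + u)))"
      by (rule continuous_on_eq) (use ll in auto)
    have i: "integral {-U..U} (\<lambda>u. log_L L (Complex \<sigma> (t + u)) * of_real (smoothing_kernel_re U u * (1 + cos (\<nu> * u))))
      = integral {-U..U} (\<lambda>u. lg (Complex \<sigma> (t + u)) * of_real (smoothing_kernel_re U u * (1 + cos (\<nu> * u))))"
      by (rule integral_cong) (simp only: ll)
    have "norm (\<i> * integral {-U..U} (\<lambda>u. lg (Complex \<sigma> (t + u)) * of_real (smoothing_kernel_re U u * (1 + cos (\<nu> * u))))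
      - (\<Sum>n\<in>freq_window \<nu>. g n / of_nat n powr Complex \<sigma> t * freq_integral (2 - \<sigma>) U (ln (real n) - \<nu>)) / 2)
       \<le> (80 * 16 ^ 4 * A / U ^ 3 + 48 * 16 ^ 4 * D' / U ^ 5) * exp ((2 - \<sigma>) * \<nu>)"
      unfolding A_def
      by (rule smoothed_log_identity[OF ac g01 sig U nu D'0 lg(1,2,3,4)]) (use lg(6) in auto)
    also have "\<dots> \<le> (B / U ^ 3 + B * ln T / U ^ 5) * exp ((2 - \<sigma>) * \<nu>)"
    proof (intro mult_right_mono add_mono divide_right_mono)
      show "80 * 16 ^ 4 * A \<le> B" using D0 by (simp add: B_def)
      have "48 * 16 ^ 4 * D' \<le> (48 * 16 ^ 4 * D) * ln T" using D'D by simp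
      also have "\<dots> \<le> B * ln T" using lnT A0 by (intro mult_right_mono) (auto simp: B_def)
      finally show "48 * 16 ^ 4 * D' \<le> B * ln T" .
    qed (use U in auto)
    finally show "continuous_on {-U..U} (\<lambda>u. log_L L (Complex \<sigma> (t + u))) \<and>
       norm (\<i> * integral {-U..U} (\<lambda>u. log_L L (Complex \<sigma> (t + u)) * of_real (smoothing_kernel_re U u * (1 + cos (\<nu> * u))))
      - (\<Sum>n\<in>freq_window \<nu>. g n / of_nat n powr Complex \<sigma> t * freq_integral (2 - \<sigma>) U (ln (real n) - \<nu>)) / 2)
       \<le> (B / U ^ 3 + B * ln T / U ^ 5) * exp ((2 - \<sigma>) * \<nu>)"
      using c unfolding i by blast
  qed
qed

section \<open>Prime sums and large values of a single function\<close>

text \<open>Subtract the asymptotics at x and at qx. As ln x / ln(qx) tends to 1, the sum over (x,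
  qx] is asymptotic to \<kappa>(q - 1) x / ln x, of which half is kept.\<close>

lemma prime_window_sum:
  fixes f :: "nat \<Rightarrow> real"
  assumes lim: "((\<lambda>x. ln x / x * (\<Sum>p\<in>{p::nat. prime p \<and> real p \<le> x}. f p)) \<longlongrightarrow> \<kappa>) at_top"
    and "\<kappa> > 0" "q > 1"
  shows "\<exists>c>0. \<forall>\<^sub>F x in at_top. c * x / ln x \<le> (\<Sum>p\<in>{p::nat. prime p \<and> x < real p \<and> real p \<le> q * x}. f p)"
proof -
  define S where "S x = (\<Sum>p\<in>{p::nat. prime p \<and> real p \<le> x}. f p)" for x :: real
  define R where "R x = ln x / x * S x" for x
  have R: "(R \<longlongrightarrow> \<kappa>) at_top" using lim unfolding R_def S_def .
  have "filterlim (\<lambda>x. q * x) at_top at_top" using \<open>q > 1\<close> by real_asymp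
  hence R2: "((\<lambda>x. R (q * x)) \<longlongrightarrow> \<kappa>) at_top" by (rule filterlim_compose[OF R])
  have "((\<lambda>x. ln x / ln (q * x)) \<longlongrightarrow> 1) at_top" using \<open>q > 1\<close> by real_asymp
  hence "((\<lambda>x. R (q * x) * (q * (ln x / ln (q * x))) - R x) \<longlongrightarrow> \<kappa> * (q * 1) - \<kappa>) at_top"
    by (intro tendsto_intros R R2)
  moreover have "\<kappa> * (q * 1) - \<kappa> > \<kappa> * (q - 1) / 2" using assms by (simp add: field_simps)
  ultimately have "\<forall>\<^sub>F x in at_top. R (q * x) * (q * (ln x / ln (q * x))) - R x > \<kappa> * (q - 1) / 2"
    by (rule order_tendstoD)
  hence "\<forall>\<^sub>F x in at_top. \<kappa> * (q - 1) / 2 * x / ln x \<le> (\<Sum>p\<in>{p::nat. prime p \<and> x < real p \<and> real p \<le> q * x}. f p)"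
    using eventually_gt_at_top[of 1]
  proof eventually_elim
    case (elim x)
    have x: "ln x > 0" "q * x > 1" "ln (q * x) > 0" using elim assms by (auto simp: less_1_mult)
    have fin: "finite {p::nat. prime p \<and> real p \<le> y}" for y
      by (rule finite_subset[of _ "{..nat \<lceil>y\<rceil>}"]) (auto simp: le_nat_iff, linarith)
    have "S (q * x) - S x = (\<Sum>p\<in>{p::nat. prime p \<and> real p \<le> q * x} - {p::nat. prime p \<and> real p \<le> x}. f p)"
      unfolding S_def using elim assms by (subst sum_diff[OF fin]) (auto intro: order_trans[of _ x])
    also have "{p::nat. prime p \<and> real p \<le> q * x} - {p::nat. prime p \<and> real p \<le> x} = {p::nat. prime p \<and> x < real p \<and> real p \<le> q * x}"
      by auto
    finally have S: "(\<Sum>p\<in>{p::nat. prime p \<and> x < real p \<and> real p \<le> q * x}. f p) = S (q * x) - S x" ..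
    have "R (q * x) * (q * (ln x / ln (q * x))) - R x = (S (q * x) - S x) * ln x / x"
      using x elim assms by (simp add: R_def field_simps)
    hence "\<kappa> * (q - 1) / 2 < (S (q * x) - S x) * ln x / x" using elim by simp
    hence "\<kappa> * (q - 1) / 2 * (x / ln x) < (S (q * x) - S x) * ln x / x * (x / ln x)"
      using x elim by (intro mult_strict_right_mono) auto
    thus ?case unfolding S using x elim by simp
  qed
  moreover have "\<kappa> * (q - 1) / 2 > 0" using assms by simp
  ultimately show ?thesis by blast
qed

text \<open>A proper power p^k \<le> Y has k \<ge> 2, so p \<le> sqrt Y, and 2^k \<le> Y bounds the
  exponent. In the proof bases are stored as p - 1, hence the \<open>Suc\<close>.\<close>

lemma card_prime_powers_le:
  fixes Y :: real
  assumes "Y \<ge> 1"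
  shows "finite {n. primepow n \<and> \<not> prime n \<and> real n \<le> Y}"
    and "real (card {n. primepow n \<and> \<not> prime n \<and> real n \<le> Y}) \<le> sqrt Y * (log 2 Y + 1)"
proof -
  let ?A = "{..<nat \<lfloor>sqrt Y\<rfloor>} \<times> {..nat \<lfloor>log 2 Y\<rfloor>}"
  have sub: "{n. primepow n \<and> \<not> prime n \<and> real n \<le> Y} \<subseteq> (\<lambda>(p, k). Suc p ^ k) ` ?A"
  proof
    fix n assume n: "n \<in> {n. primepow n \<and> \<not> prime n \<and> real n \<le> Y}"
    then obtain p k where pk: "prime p" "k > 0" "n = p ^ k" unfolding primepow_def by blast
    have k2: "k \<ge> 2" using pk n by (cases "k = 1") auto
    have p2: "p \<ge> 2" using pk prime_ge_2_nat by blast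
    have "real p ^ 2 \<le> real p ^ k" using k2 p2 by (intro power_increasing) auto
    also have "\<dots> \<le> Y" using n pk by simp
    finally have "real p \<le> sqrt Y" by (rule real_le_rsqrt)
    hence a: "p \<le> nat \<lfloor>sqrt Y\<rfloor>" by (simp add: le_nat_floor)
    have "2 ^ k \<le> real p ^ k" using p2 by (intro power_mono) auto
    also have "\<dots> \<le> Y" using n pk by simp
    finally have "real k \<le> log 2 Y" using assms by (subst le_log_iff) (auto simp: powr_realpow)
    hence b: "k \<le> nat \<lfloor>log 2 Y\<rfloor>" by (simp add: le_nat_floor)
    have "n = (\<lambda>(p, k). Suc p ^ k) (p - 1, k)" using pk p2 by simp
    moreover have "(p - 1, k) \<in> ?A" using a b p2 by auto
    ultimately show "n \<in> (\<lambda>(p, k). Suc p ^ k) ` ?A" by (rule image_eqI)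
  qed
  show "finite {n. primepow n \<and> \<not> prime n \<and> real n \<le> Y}" by (rule finite_subset[OF sub]) auto
  have "card {n. primepow n \<and> \<not> prime n \<and> real n \<le> Y} \<le> card ?A"
  proof -
    have "card {n. primepow n \<and> \<not> prime n \<and> real n \<le> Y} \<le> card ((\<lambda>(p, k). Suc p ^ k) ` ?A)"
      by (rule card_mono[OF _ sub]) simp
    also have "\<dots> \<le> card ?A" by (rule card_image_le) simp
    finally show ?thesis .
  qed
  also have "card ?A = nat \<lfloor>sqrt Y\<rfloor> * (nat \<lfloor>log 2 Y\<rfloor> + 1)" by (simp add: card_cartesian_product)
  finally have "real (card {n. primepow n \<and> \<not> prime n \<and> real n \<le> Y}) \<le> real (nat \<lfloor>sqrt Y\<rfloor> * (nat \<lfloor>log 2 Y\<rfloor> + 1))"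
    by (simp only: of_nat_le_iff)
  also have "\<dots> = real (nat \<lfloor>sqrt Y\<rfloor>) * (real (nat \<lfloor>log 2 Y\<rfloor>) + 1)" by (simp add: algebra_simps)
  also have "\<dots> \<le> sqrt Y * (log 2 Y + 1)" using assms by (intro mult_mono add_mono) auto
  finally show "real (card {n. primepow n \<and> \<not> prime n \<and> real n \<le> Y}) \<le> sqrt Y * (log 2 Y + 1)" .
qed

text \<open>The product is at most 4^Y \<le> exp(2Y). Since 2^|P| is at most the product, |P| \<le>
  2Y/ln 2 \<le> 3Y; no saving of log Y is required later.\<close>

lemma prime_set_product_bounds:
  fixes P :: "nat set" and Y :: real
  assumes "finite P" "\<And>p. p \<in> P \<Longrightarrow> prime p \<and> real p \<le> Y" "Y \<ge> 0"
  shows "real (\<Prod>p\<in>P. p) \<le> exp (2 * Y)" "real (card P) \<le> 3 * Y"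
proof -
  let ?n = "nat \<lfloor>Y\<rfloor>"
  have "P \<subseteq> {p. prime p \<and> p \<le> ?n}" using assms by (auto simp: le_nat_floor)
  hence "(\<Prod>p\<in>P. p) dvd (\<Prod>p\<in>{p. prime p \<and> p \<le> ?n}. p)" by (intro prod_dvd_prod_subset) auto
  moreover have "(\<Prod>p\<in>{p. prime p \<and> p \<le> ?n}. p) > 0" by (intro prod_pos) (auto simp: prime_gt_0_nat)
  ultimately have "(\<Prod>p\<in>P. p) \<le> 4 ^ ?n" using prod_primes_le_4_pow[of ?n] dvd_imp_le order_trans by blast
  hence "real (\<Prod>p\<in>P. p) \<le> real (4 ^ ?n)" by (simp only: of_nat_le_iff)
  also have "real (4 ^ ?n) \<le> exp 2 ^ ?n"
  proof -
    have "(4::real) \<le> exp 2" using exp_ge_add_one_self[of "1::real"] power_mono[of 2 "exp 1::real" 2] by (simp flip: exp_of_nat_mult)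
    thus ?thesis by (simp add: power_mono)
  qed
  also have "\<dots> = exp (real ?n * 2)" by (simp add: exp_of_nat_mult)
  also have "\<dots> \<le> exp (2 * Y)" using assms by simp
  finally show 1: "real (\<Prod>p\<in>P. p) \<le> exp (2 * Y)" .
  have "(\<Prod>p\<in>P. 2) \<le> (\<Prod>p\<in>P. p)" using assms by (intro prod_mono) (auto simp: prime_ge_2_nat)
  hence "2 ^ card P \<le> (\<Prod>p\<in>P. p)" by simp
  hence "real (2 ^ card P) \<le> real (\<Prod>p\<in>P. p)" by (simp only: of_nat_le_iff)
  hence "(2::real) ^ card P \<le> exp (2 * Y)" using 1 by simp
  hence "ln (2 ^ card P) \<le> ln (exp (2 * Y))" by (subst ln_le_cancel_iff) auto
  hence "real (card P) * ln 2 \<le> 2 * Y" by (simp add: ln_realpow)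
  moreover have "ln (2::real) \<ge> 2/3" by (rule ln2_ge_two_thirds)
  hence "real (card P) * (2/3) \<le> real (card P) * ln 2" by (intro mult_left_mono) auto
  ultimately show "real (card P) \<le> 3 * Y" by linarith
qed

text \<open>If all values were below X/(2K), a nonnegative weight of mass at most K could produce at
  most X/2. The spare factor 2 avoids strict inequalities under the integral.\<close>

lemma exists_ge_of_weighted_average:
  fixes f :: "real \<Rightarrow> complex" and w :: "real \<Rightarrow> real"
  assumes "continuous_on {-U..U} f" "continuous_on {-U..U} w" "\<And>u. u \<in> {-U..U} \<Longrightarrow> w u \<ge> 0"
    and "integral {-U..U} w \<le> K" "K > 0" "X > 0" and X: "Re (e * integral {-U..U} (\<lambda>u. f u * of_real (w u))) \<ge> X"
  shows "\<exists>u\<in>{-U..U}. Re (e * f u) \<ge> X / (2 * K)"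
proof (rule ccontr)
  assume "\<not> ?thesis"
  hence lt: "Re (e * f u) < X / (2 * K)" if "u \<in> {-U..U}" for u using that by force
  have int: "(\<lambda>u. f u * of_real (w u)) integrable_on {-U..U}"
    by (intro integrable_continuous_real continuous_intros assms)
  have intw: "w integrable_on {-U..U}" by (intro integrable_continuous_real assms)
  have int2: "(\<lambda>u. Re (e * f u) * w u) integrable_on {-U..U}"
    by (intro integrable_continuous_real continuous_intros assms)
  have "bounded_linear (\<lambda>z. Re (e * z))"
    by (intro bounded_linear_compose[OF bounded_linear_Re] bounded_linear_mult_right)
  from integral_linear[OF int this] have "Re (e * integral {-U..U} (\<lambda>u. f u * of_real (w u))) = integral {-U..U} (\<lambda>u. Re (e * f u) * w u)"
    by (simp add: o_def algebra_simps)
  also have "\<dots> \<le> integral {-U..U} (\<lambda>u. X / (2 * K) * w u)"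
    by (intro integral_le int2 integrable_on_mult_right intw mult_right_mono assms less_imp_le lt)
  also have "\<dots> = X / (2 * K) * integral {-U..U} w" by simp
  also have "\<dots> \<le> X / (2 * K) * K" using assms by (intro mult_left_mono) auto
  also have "\<dots> = X / 2" using assms by simp
  finally show False using X \<open>X > 0\<close> by linarith
qed

lemma of_nat_powr_Complex:
  assumes "n \<ge> 1"
  shows "z / of_nat n powr Complex \<sigma> t = z / of_real (real n powr \<sigma>) * cis (- (t * ln (real n)))"
proof -
  have "Ln (of_nat n) = of_real (ln (real n))" using assms Ln_of_real[of "real n"] by simp
  hence "of_nat n powr Complex \<sigma> t = exp (Complex \<sigma> t * of_real (ln (real n)))" using assms by (simp add: powr_def)
  also have "Complex \<sigma> t * of_real (ln (real n)) = of_real (\<sigma> * ln (real n)) + \<i> * of_real (t * ln (real n))"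
    by (simp add: complex_eq_iff)
  also have "exp \<dots> = of_real (real n powr \<sigma>) * cis (t * ln (real n))"
    using assms by (simp only: exp_add cis_conv_exp exp_of_real) (simp add: powr_def)
  finally have "of_nat n powr Complex \<sigma> t = of_real (real n powr \<sigma>) * cis (t * ln (real n))" .
  moreover have "cis (- (t * ln (real n))) = inverse (cis (t * ln (real n)))" by simp
  ultimately show ?thesis by (simp only: divide_inverse inverse_mult_distrib mult.assoc)
qed

text \<open>Take N = c0 x and U = x^(3/4), and compare with N^(1 - \<sigma>)/ln N. Proper prime
  powers contribute N^(\<theta> - 1/2) up to logarithms; the transform and edge errors contribute
  x^(-9/4) and x^(-11/4) times N ln N. All of these tend to 0.\<close>

lemma large_value_error_terms:
  fixes \<sigma> \<theta> C B c c0 :: real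
  assumes "\<theta> < 1/2" "c > 0" "c0 > 0"
  shows "\<forall>\<^sub>F x in at_top.
    sqrt (2 * (c0 * x)) * (log 2 (2 * (c0 * x)) + 1) * (C * (2 * (c0 * x)) powr \<theta> / (c0 * x / 2) powr \<sigma> * (100 * 16 ^ 4)) / 2
     + (B / (x powr (3/4)) ^ 3 + B * x / (x powr (3/4)) ^ 5) * (c0 * x) powr (2 - \<sigma>)
    \<le> c * (c0 * x) powr (1 - \<sigma>) / ln (c0 * x) / 8"
proof -
  define D where "D = sqrt 2 * C * 2 powr \<theta> * 2 powr \<sigma> * (100 * 16 ^ 4) / 2"
  have "((\<lambda>N. N powr (\<theta> - 1/2) * ((log 2 (2 * N) + 1) * ln N)) \<longlongrightarrow> 0) at_top" using assms(1) by real_asymp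
  moreover have "filterlim (\<lambda>x. c0 * x) at_top at_top" using assms by real_asymp
  ultimately have "((\<lambda>x. (c0 * x) powr (\<theta> - 1/2) * ((log 2 (2 * (c0 * x)) + 1) * ln (c0 * x))) \<longlongrightarrow> 0) at_top"
    by (rule filterlim_compose[where f = "\<lambda>x. c0 * x"])
  hence l1: "((\<lambda>x. D * ((c0 * x) powr (\<theta> - 1/2) * ((log 2 (2 * (c0 * x)) + 1) * ln (c0 * x)))) \<longlongrightarrow> 0) at_top"
    by (rule tendsto_mult_right_zero)
  have "((\<lambda>x. (1 / (x powr (3/4)) ^ 3 + x / (x powr (3/4)) ^ 5) * ((c0 * x) * ln (c0 * x))) \<longlongrightarrow> 0) at_top"
    using assms by real_asymp
  hence l2: "((\<lambda>x. B * ((1 / (x powr (3/4)) ^ 3 + x / (x powr (3/4)) ^ 5) * ((c0 * x) * ln (c0 * x)))) \<longlongrightarrow> 0) at_top"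
    by (rule tendsto_mult_right_zero)
  have "((\<lambda>x. D * ((c0 * x) powr (\<theta> - 1/2) * ((log 2 (2 * (c0 * x)) + 1) * ln (c0 * x))) + B * ((1 / (x powr (3/4)) ^ 3 + x / (x powr (3/4)) ^ 5) * ((c0 * x) * ln (c0 * x)))) \<longlongrightarrow> 0 + 0) at_top"
    by (intro tendsto_add l1 l2)
  hence "\<forall>\<^sub>F x in at_top. D * ((c0 * x) powr (\<theta> - 1/2) * ((log 2 (2 * (c0 * x)) + 1) * ln (c0 * x))) + B * ((1 / (x powr (3/4)) ^ 3 + x / (x powr (3/4)) ^ 5) * ((c0 * x) * ln (c0 * x))) < c / 8"
    by (rule order_tendstoD) (use assms in auto)
  thus ?thesis using eventually_gt_at_top[of "max 1 (1 / c0)"]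
  proof eventually_elim
    case (elim x)
    define N where "N = c0 * x"
    have x: "x > 1" "N > 1" using elim assms by (auto simp: N_def field_simps)
    have N0: "N > 0" "ln N > 0" using x by auto
    define W where "W = N powr (1 - \<sigma>) / ln N"
    have W0: "W > 0" using N0 by (simp add: W_def)
    define lg where "lg = log 2 (2 * N) + 1"
    have s1: "sqrt (2 * N) = sqrt 2 * N powr (1/2)" using N0 by (simp add: real_sqrt_mult powr_half_sqrt)
    have s2: "(2 * N) powr \<theta> = 2 powr \<theta> * N powr \<theta>" using N0 by (simp add: powr_mult)
    have s3: "(N / 2) powr \<sigma> = N powr \<sigma> / 2 powr \<sigma>" using N0 by (simp add: powr_divide)
    have "sqrt (2 * N) * lg * (C * (2 * N) powr \<theta> / (N / 2) powr \<sigma> * (100 * 16 ^ 4)) / 2 = D * (lg * (N powr (1/2) * N powr \<theta> / N powr \<sigma>))"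
      unfolding s1 s2 s3 D_def by simp
    also have "N powr (1/2) * N powr \<theta> / N powr \<sigma> = N powr (\<theta> - 1/2) * N powr (1 - \<sigma>)"
    proof -
      have "N powr (1/2) * N powr \<theta> / N powr \<sigma> = N powr (1/2 + \<theta> - \<sigma>)" by (simp only: powr_add powr_diff)
      also have "1/2 + \<theta> - \<sigma> = (\<theta> - 1/2) + (1 - \<sigma>)" by simp
      finally show ?thesis by (simp only: powr_add)
    qed
    also have "\<dots> = N powr (\<theta> - 1/2) * (W * ln N)" using N0 by (simp add: W_def)
    finally have t1: "sqrt (2 * N) * lg * (C * (2 * N) powr \<theta> / (N / 2) powr \<sigma> * (100 * 16 ^ 4)) / 2 = D * (N powr (\<theta> - 1/2) * (lg * ln N)) * W"
      by (simp add: mult_ac)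
    have "N powr (2 - \<sigma>) = N * N powr (1 - \<sigma>)" using N0 by (simp add: powr_diff power2_eq_square)
    also have "\<dots> = N * ln N * W" using N0 by (simp add: W_def)
    finally have t2: "(B / (x powr (3/4)) ^ 3 + B * x / (x powr (3/4)) ^ 5) * N powr (2 - \<sigma>) = B * ((1 / (x powr (3/4)) ^ 3 + x / (x powr (3/4)) ^ 5) * (N * ln N)) * W"
      by (simp add: algebra_simps)
    have "sqrt (2 * N) * lg * (C * (2 * N) powr \<theta> / (N / 2) powr \<sigma> * (100 * 16 ^ 4)) / 2 + (B / (x powr (3/4)) ^ 3 + B * x / (x powr (3/4)) ^ 5) * N powr (2 - \<sigma>)
       = (D * (N powr (\<theta> - 1/2) * (lg * ln N)) + B * ((1 / (x powr (3/4)) ^ 3 + x / (x powr (3/4)) ^ 5) * (N * ln N))) * W"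
      unfolding t1 t2 by (rule distrib_right[symmetric])
    also have "\<dots> \<le> c / 8 * W" using elim(1) W0 unfolding N_def[symmetric] lg_def[symmetric] by (intro mult_right_mono) auto
    also have "\<dots> = c * N powr (1 - \<sigma>) / ln N / 8" by (simp add: W_def)
    finally show ?case unfolding N_def lg_def .
  qed
qed

text \<open>Up to small errors the smoothed, rotated logarithm at t is half a sum over the window
  whose coefficients y(p) do not depend on t: they consist of g(p) p^-\<sigma>, the transform at ln
  p - \<nu> and the rotation. If that sum reaches half of its trivial bound, the average over u is
  large, and so is some value.\<close>

lemma selberg_large_value:
  fixes \<phi> :: real
  assumes L: "selberg_class a L" and sig: "1/2 < \<sigma>" "\<sigma> < 1" and c0: "c0 > 0"
    and win: "\<exists>c>0. \<forall>\<^sub>F x in at_top. c * x / ln x \<le> (\<Sum>p\<in>{p::nat. prime p \<and> x < real p \<and> real p \<le> exp (1/8192) * x}. norm (a p))"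
  shows "\<exists>c>0. \<forall>\<^sub>F T in at_top. \<exists>y::nat \<Rightarrow> complex.
     (\<Sum>p\<in>{p\<in>freq_window (ln (c0 * ln T)). prime p}. norm (y p)) > 0 \<and>
     (\<forall>t. ln T powr (3/4) + 5 \<le> t \<and> t + ln T powr (3/4) + 3 \<le> 2 * T \<and>
        (\<forall>\<rho>. L \<rho> = 0 \<and> Re \<rho> \<ge> \<sigma> \<longrightarrow> \<bar>Im \<rho> - t\<bar> > ln T powr (3/4) + 3) \<and>
        Re (\<Sum>p\<in>{p\<in>freq_window (ln (c0 * ln T)). prime p}. y p * cis (- (t * ln (real p))))
          \<ge> (\<Sum>p\<in>{p\<in>freq_window (ln (c0 * ln T)). prime p}. norm (y p)) / 2 \<longrightarrow>
        (\<exists>u\<in>{- (ln T powr (3/4))..ln T powr (3/4)}.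
           Re (exp (- \<i> * of_real \<phi>) * log_L L (Complex \<sigma> (t + u))) \<ge> c * ln T powr (1 - \<sigma>) / ln (ln T)))"
proof -
  obtain g :: "nat \<Rightarrow> complex" and \<theta> C B :: real where th: "0 \<le> \<theta>" "\<theta> < 1/2" and CB: "C \<ge> 0" "B \<ge> 0"
    and gb: "\<And>n. n \<ge> 1 \<Longrightarrow> norm (g n) \<le> C * real n powr \<theta>"
    and gs: "\<And>n. \<not> primepow n \<Longrightarrow> g n = 0" and ga: "\<And>p. prime p \<Longrightarrow> g p = a p"
    and key: "\<And>T U t \<nu>. U \<ge> 2 \<Longrightarrow> U + 5 \<le> t \<Longrightarrow> t + U + 3 \<le> 2 * T \<Longrightarrow> T \<ge> 3 \<Longrightarrow> \<nu> \<ge> 0 \<Longrightarrow>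
       (\<And>\<rho>. L \<rho> = 0 \<Longrightarrow> Re \<rho> \<ge> \<sigma> \<Longrightarrow> \<bar>Im \<rho> - t\<bar> > U + 3) \<Longrightarrow>
       continuous_on {-U..U} (\<lambda>u. log_L L (Complex \<sigma> (t + u))) \<and>
       norm (\<i> * integral {-U..U} (\<lambda>u. log_L L (Complex \<sigma> (t + u)) * of_real (smoothing_kernel_re U u * (1 + cos (\<nu> * u))))
      - (\<Sum>n\<in>freq_window \<nu>. g n / of_nat n powr Complex \<sigma> t * freq_integral (2 - \<sigma>) U (ln (real n) - \<nu>)) / 2)
       \<le> (B / U ^ 3 + B * ln T / U ^ 5) * exp ((2 - \<sigma>) * \<nu>)"
  proof (rule selberg_smoothed_log[OF L sig], goal_cases)
    case (1 g \<theta> C B)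
    show ?case by (rule that[of \<theta> C B g]) (fact 1)+
  qed
  obtain c1 where c1: "c1 > 0" "\<forall>\<^sub>F x in at_top. c1 * x / ln x \<le> (\<Sum>p\<in>{p::nat. prime p \<and> x < real p \<and> real p \<le> exp (1/8192) * x}. norm (a p))"
    using win by blast
  \<comment> \<open>1/128 is the lower bound 1/64 for the transform near 0 times 1/2 from p^\<sigma>
    \<le> 2 N^\<sigma>.\<close>
  define c2 where "c2 = c1 / 128"
  have c2: "c2 > 0" using c1 by (simp add: c2_def)
  \<comment> \<open>The divisors are 2 for ln N \<le> 2 ln ln T, 8 for the share of m that survives
    the errors, and 2 * 16^5 for the mass of the kernel.\<close>
  define c where "c = c2 * c0 powr (1 - \<sigma>) / 2 / 8 / (2 * 16 ^ 5)"
  have cpos: "c > 0" using c2 c0 by (simp add: c_def)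
  have "filterlim (\<lambda>x. c0 * x) at_top at_top" using c0 by real_asymp
  from eventually_compose_filterlim[OF c1(2) this]
  have ev1: "\<forall>\<^sub>F x in at_top. c1 * (c0 * x) / ln (c0 * x) \<le> (\<Sum>p\<in>{p::nat. prime p \<and> c0 * x < real p \<and> real p \<le> exp (1/8192) * (c0 * x)}. norm (a p))" .
  have ev2: "\<forall>\<^sub>F x in at_top. x powr (3/4) \<ge> (2::real)" by real_asymp
  have ev3: "\<forall>\<^sub>F x in at_top. 3 / 64 - 80 * 16 ^ 4 / (x powr (3/4)) ^ 4 \<ge> (1 / 64 :: real)" by real_asymp
  have ev4: "\<forall>\<^sub>F x in at_top. ln (c0 * x) \<le> 2 * ln x" using c0 by real_asymp
  have ev5: "\<forall>\<^sub>F x in at_top. c0 * x \<ge> 2" using c0 by real_asymp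
  note ev6 = large_value_error_terms[OF th(2) c2 c0, of C \<sigma> B]
  have lnlim: "filterlim ln at_top (at_top :: real filter)" by real_asymp
  have "\<forall>\<^sub>F x in at_top. c1 * (c0 * x) / ln (c0 * x) \<le> (\<Sum>p\<in>{p::nat. prime p \<and> c0 * x < real p \<and> real p \<le> exp (1/8192) * (c0 * x)}. norm (a p))
     \<and> x powr (3/4) \<ge> 2 \<and> 3 / 64 - 80 * 16 ^ 4 / (x powr (3/4)) ^ 4 \<ge> 1 / 64 \<and> ln (c0 * x) \<le> 2 * ln x \<and> c0 * x \<ge> 2 \<and> x \<ge> 2 \<and>
    sqrt (2 * (c0 * x)) * (log 2 (2 * (c0 * x)) + 1) * (C * (2 * (c0 * x)) powr \<theta> / (c0 * x / 2) powr \<sigma> * (100 * 16 ^ 4)) / 2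
     + (B / (x powr (3/4)) ^ 3 + B * x / (x powr (3/4)) ^ 5) * (c0 * x) powr (2 - \<sigma>)
    \<le> c2 * (c0 * x) powr (1 - \<sigma>) / ln (c0 * x) / 8"
    by (intro eventually_conj ev1 ev2 ev3 ev4 ev5 ev6 eventually_ge_at_top)
  from eventually_compose_filterlim[OF this lnlim]
  have ev: "\<forall>\<^sub>F T in at_top. c1 * (c0 * ln T) / ln (c0 * ln T) \<le> (\<Sum>p\<in>{p::nat. prime p \<and> c0 * ln T < real p \<and> real p \<le> exp (1/8192) * (c0 * ln T)}. norm (a p))
     \<and> ln T powr (3/4) \<ge> 2 \<and> 3 / 64 - 80 * 16 ^ 4 / (ln T powr (3/4)) ^ 4 \<ge> 1 / 64 \<and> ln (c0 * ln T) \<le> 2 * ln (ln T) \<and> c0 * ln T \<ge> 2 \<and> ln T \<ge> 2 \<and>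
    sqrt (2 * (c0 * ln T)) * (log 2 (2 * (c0 * ln T)) + 1) * (C * (2 * (c0 * ln T)) powr \<theta> / (c0 * ln T / 2) powr \<sigma> * (100 * 16 ^ 4)) / 2
     + (B / (ln T powr (3/4)) ^ 3 + B * ln T / (ln T powr (3/4)) ^ 5) * (c0 * ln T) powr (2 - \<sigma>)
    \<le> c2 * (c0 * ln T) powr (1 - \<sigma>) / ln (c0 * ln T) / 8" .
  have "\<forall>\<^sub>F T in at_top. \<exists>y::nat \<Rightarrow> complex.
     (\<Sum>p\<in>{p\<in>freq_window (ln (c0 * ln T)). prime p}. norm (y p)) > 0 \<and>
     (\<forall>t. ln T powr (3/4) + 5 \<le> t \<and> t + ln T powr (3/4) + 3 \<le> 2 * T \<and>
        (\<forall>\<rho>. L \<rho> = 0 \<and> Re \<rho> \<ge> \<sigma> \<longrightarrow> \<bar>Im \<rho> - t\<bar> > ln T powr (3/4) + 3) \<and>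
        Re (\<Sum>p\<in>{p\<in>freq_window (ln (c0 * ln T)). prime p}. y p * cis (- (t * ln (real p))))
          \<ge> (\<Sum>p\<in>{p\<in>freq_window (ln (c0 * ln T)). prime p}. norm (y p)) / 2 \<longrightarrow>
        (\<exists>u\<in>{- (ln T powr (3/4))..ln T powr (3/4)}.
           Re (exp (- \<i> * of_real \<phi>) * log_L L (Complex \<sigma> (t + u))) \<ge> c * ln T powr (1 - \<sigma>) / ln (ln T)))"
    using ev eventually_ge_at_top[of 3]
  proof eventually_elim
    case (elim T)
    define X where "X = ln T"
    define N where "N = c0 * X"
    define U where "U = X powr (3/4)"
    define \<nu> where "\<nu> = ln N"
    define F where "F n = freq_integral (2 - \<sigma>) U (ln (real n) - \<nu>)" for n :: nat
    define W where "W = freq_window \<nu>"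
    define Wp where "Wp = {p\<in>W. prime p}"
    define e where "e = exp (- \<i> * of_real \<phi>)"
    \<comment> \<open>The factor -\<i> undoes the \<i> of dz.\<close>
    define y where "y p = e * (- \<i>) * (g p / of_real (real p powr \<sigma>)) * F p" for p
    define M where "M = (\<Sum>p\<in>Wp. norm (y p))"
    define m where "m = c2 * N powr (1 - \<sigma>) / ln N"
    define Err where "Err = (B / U ^ 3 + B * X / U ^ 5) * N powr (2 - \<sigma>)"
    define Q where "Q = C * (2 * N) powr \<theta> / (N / 2) powr \<sigma> * (100 * 16 ^ 4)"
    define PP where "PP = sqrt (2 * N) * (log 2 (2 * N) + 1) * Q"
    have h: "c1 * N / ln N \<le> (\<Sum>p\<in>{p::nat. prime p \<and> N < real p \<and> real p \<le> exp (1/8192) * N}. norm (a p))"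
      "U \<ge> 2" "3 / 64 - 80 * 16 ^ 4 / U ^ 4 \<ge> 1 / 64" "ln N \<le> 2 * ln X" "N \<ge> 2" "X \<ge> 2" "PP / 2 + Err \<le> m / 8" "T \<ge> 3"
      using elim by (simp_all add: X_def N_def U_def PP_def Q_def Err_def m_def)
    have N0: "N > 0" "\<nu> \<ge> 0" "ln N > 0" "exp \<nu> = N" using h(5) by (auto simp: \<nu>_def)
    have nore: "norm e = 1" by (simp add: e_def)
    have d: "0 \<le> 2 - \<sigma>" "2 - \<sigma> \<le> 2" using sig by auto
    have finW: "finite W" "finite Wp" by (auto simp: W_def Wp_def finite_freq_window)
    have e12: "exp (1/2::real) \<le> 2" using exp_bound[of "1/2"] by (simp add: power2_eq_square)
    have Wb: "real n \<le> 2 * N" "real n \<ge> N / 2" "n \<ge> 1" "\<bar>ln (real n) - \<nu>\<bar> \<le> 1/2" if "n \<in> W" for n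
    proof -
      have 1: "real n < exp (\<nu> + 1/2)" "real n > exp (\<nu> - 1/2)" using freq_window_bounds[of n \<nu>] that by (auto simp: W_def)
      have "exp (\<nu> + 1/2) = N * exp (1/2)" using N0 by (simp add: exp_add)
      also have "\<dots> \<le> N * 2" using e12 N0 by (intro mult_left_mono) auto
      finally show "real n \<le> 2 * N" using 1 by simp
      have "N / 2 \<le> N / exp (1/2)" using e12 N0 by (intro divide_left_mono) auto
      also have "\<dots> = exp (\<nu> - 1/2)" using N0 by (simp add: exp_diff)
      finally show "real n \<ge> N / 2" using 1 by simp
      show "n \<ge> 1" "\<bar>ln (real n) - \<nu>\<bar> \<le> 1/2" using that by (auto simp: W_def freq_window_def)
    qed
    have Fup: "norm (F n) \<le> 100 * 16 ^ 4" if "n \<in> W" for n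
      unfolding F_def by (rule freq_integral_near(1)) (use d h(2) Wb[OF that] in auto)
    have ny: "norm (y p) = norm (g p) / real p powr \<sigma> * norm (F p)" for p
      unfolding y_def by (simp add: norm_mult norm_divide nore)
    have Mm: "M \<ge> m"
    proof -
      \<comment> \<open>The ratio exp(1/8192) keeps |ln p - \<nu>| \<le> 1/8192, inside the range
        1/4096 where the transform is bounded below.\<close>
      let ?V = "{p::nat. prime p \<and> N < real p \<and> real p \<le> exp (1/8192) * N}"
      have V: "\<bar>ln (real p) - \<nu>\<bar> \<le> 1/8192" "p \<in> Wp" if p: "p \<in> ?V" for p
      proof -
        have p0: "real p > 0" "p \<ge> 1" using p N0 by auto
        have "ln N \<le> ln (real p)" using p N0 by simp
        moreover have "ln (real p) \<le> ln (exp (1/8192) * N)" using p N0 p0 by (subst ln_le_cancel_iff) auto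
        hence "ln (real p) \<le> 1/8192 + ln N" using N0 by (simp add: ln_mult)
        ultimately show *: "\<bar>ln (real p) - \<nu>\<bar> \<le> 1/8192" unfolding \<nu>_def by linarith
        show "p \<in> Wp" using * p p0 by (auto simp: Wp_def W_def freq_window_def)
      qed
      have "c2 * N powr (1 - \<sigma>) / ln N = (1/64) / (2 * N powr \<sigma>) * (c1 * N / ln N)"
        using N0 by (simp add: c2_def powr_diff)
      also have "\<dots> \<le> (1/64) / (2 * N powr \<sigma>) * (\<Sum>p\<in>?V. norm (a p))" using h(1) by (intro mult_left_mono) auto
      also have "\<dots> = (\<Sum>p\<in>?V. norm (a p) / (2 * N powr \<sigma>) * (1/64))" by (simp add: sum_distrib_left)
      also have "\<dots> \<le> (\<Sum>p\<in>?V. norm (y p))"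
      proof (rule sum_mono)
        fix p assume p: "p \<in> ?V"
        have pW: "p \<in> W" using V(2)[OF p] by (simp add: Wp_def)
        have "norm (F p) \<ge> 3 / 64 - 80 * 16 ^ 4 / U ^ 4"
          unfolding F_def by (rule freq_integral_near(2)) (use d h(2) V(1)[OF p] in auto)
        hence F1: "norm (F p) \<ge> 1 / 64" using h(3) by linarith
        have "real p powr \<sigma> \<le> (2 * N) powr \<sigma>" using Wb[OF pW] sig by (intro powr_mono2) auto
        also have "\<dots> = 2 powr \<sigma> * N powr \<sigma>" using N0 by (simp add: powr_mult)
        also have "\<dots> \<le> 2 powr 1 * N powr \<sigma>" using sig by (intro mult_right_mono powr_mono) auto
        finally have "real p powr \<sigma> \<le> 2 * N powr \<sigma>" by simp
        hence "norm (a p) / (2 * N powr \<sigma>) \<le> norm (a p) / real p powr \<sigma>"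
          using Wb[OF pW] N0 by (intro divide_left_mono) auto
        thus "norm (a p) / (2 * N powr \<sigma>) * (1/64) \<le> norm (y p)"
          unfolding ny using F1 ga[of p] p by (intro mult_mono) auto
      qed
      also have "\<dots> \<le> M" unfolding M_def by (rule sum_mono2[OF finW(2)]) (use V in auto)
      finally show ?thesis by (simp add: m_def)
    qed
    have m0: "m > 0" using c2 N0 by (simp add: m_def)
    have goal: "\<exists>u\<in>{-U..U}. Re (e * log_L L (Complex \<sigma> (t + u))) \<ge> c * X powr (1 - \<sigma>) / ln X"
      if t: "U + 5 \<le> t" "t + U + 3 \<le> 2 * T" and zf: "\<And>\<rho>. L \<rho> = 0 \<Longrightarrow> Re \<rho> \<ge> \<sigma> \<Longrightarrow> \<bar>Im \<rho> - t\<bar> > U + 3"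
        and big: "Re (\<Sum>p\<in>Wp. y p * cis (- (t * ln (real p)))) \<ge> M / 2" for t
    proof -
      define I where "I = integral {-U..U} (\<lambda>u. log_L L (Complex \<sigma> (t + u)) * of_real (smoothing_kernel_re U u * (1 + cos (\<nu> * u))))"
      define Z where "Z = (\<Sum>n\<in>W. g n / of_nat n powr Complex \<sigma> t * F n)"
      have k: "continuous_on {-U..U} (\<lambda>u. log_L L (Complex \<sigma> (t + u)))"
        "norm (\<i> * I - Z / 2) \<le> (B / U ^ 3 + B * ln T / U ^ 5) * exp ((2 - \<sigma>) * \<nu>)"
        using key[OF h(2) t h(8) N0(2) zf] unfolding I_def Z_def W_def F_def by auto
      have "exp ((2 - \<sigma>) * \<nu>) = N powr (2 - \<sigma>)" using N0 by (simp add: powr_def \<nu>_def)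
      hence k2: "norm (\<i> * I - Z / 2) \<le> Err" using k(2) by (simp add: Err_def X_def)
      have split: "e * (- \<i>) * Z = (\<Sum>p\<in>Wp. y p * cis (- (t * ln (real p)))) + (\<Sum>n\<in>W-Wp. y n * cis (- (t * ln (real n))))"
      proof -
        have "e * (- \<i>) * Z = (\<Sum>n\<in>W. y n * cis (- (t * ln (real n))))"
          unfolding Z_def sum_distrib_left
        proof (rule sum.cong[OF refl])
          fix n assume "n \<in> W"
          hence "n \<ge> 1" by (rule Wb)
          show "e * (- \<i>) * (g n / of_nat n powr Complex \<sigma> t * F n) = y n * cis (- (t * ln (real n)))"
            unfolding of_nat_powr_Complex[OF \<open>n \<ge> 1\<close>] y_def by (simp add: mult_ac)
        qed
        also have "\<dots> = (\<Sum>n\<in>W-Wp. y n * cis (- (t * ln (real n)))) + (\<Sum>p\<in>Wp. y p * cis (- (t * ln (real p))))"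
          by (rule sum.subset_diff) (use finW in \<open>auto simp: Wp_def\<close>)
        finally show ?thesis by simp
      qed
      \<comment> \<open>Elements of the window outside \<open>Wp\<close> with nonzero coefficient
        are proper prime powers, few enough to be bounded one by one by Q.\<close>
      have pp: "norm (\<Sum>n\<in>W-Wp. y n * cis (- (t * ln (real n)))) \<le> PP"
      proof -
        let ?R = "{n. primepow n \<and> \<not> prime n \<and> real n \<le> 2 * N}"
        have cR: "finite ?R" "real (card ?R) \<le> sqrt (2 * N) * (log 2 (2 * N) + 1)"
          using card_prime_powers_le[of "2 * N"] h(5) by auto
        have Q0: "Q \<ge> 0" using CB by (simp add: Q_def)
        have yQ: "norm (y n * cis (- (t * ln (real n)))) \<le> Q" if n: "n \<in> W" for n
        proof -
          have "norm (g n) \<le> C * real n powr \<theta>" using gb Wb(3)[OF n] by blast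
          also have "\<dots> \<le> C * (2 * N) powr \<theta>" using Wb[OF n] CB th by (intro mult_left_mono powr_mono2) auto
          finally have g1: "norm (g n) \<le> C * (2 * N) powr \<theta>" .
          have "(N / 2) powr \<sigma> \<le> real n powr \<sigma>" using Wb[OF n] sig N0 by (intro powr_mono2) auto
          hence "norm (g n) / real n powr \<sigma> \<le> C * (2 * N) powr \<theta> / (N / 2) powr \<sigma>"
            using g1 N0 CB by (intro frac_le) auto
          hence "norm (g n) / real n powr \<sigma> * norm (F n) \<le> Q"
            unfolding Q_def using Fup[OF n] CB by (intro mult_mono) auto
          thus ?thesis by (simp add: norm_mult ny)
        qed
        have "norm (\<Sum>n\<in>W-Wp. y n * cis (- (t * ln (real n)))) = norm (\<Sum>n\<in>(W-Wp) \<inter> ?R. y n * cis (- (t * ln (real n))))"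
        proof (rule arg_cong[where f = norm], rule sum.mono_neutral_right)
          show "\<forall>n\<in>W - Wp - (W - Wp) \<inter> ?R. y n * cis (- (t * ln (real n))) = 0"
          proof
            fix n assume n: "n \<in> W - Wp - (W - Wp) \<inter> ?R"
            hence "\<not> primepow n" using Wb(1)[of n] by (auto simp: Wp_def)
            thus "y n * cis (- (t * ln (real n))) = 0" using gs by (simp add: y_def)
          qed
        qed (use finW in auto)
        also have "\<dots> \<le> (\<Sum>n\<in>(W-Wp) \<inter> ?R. Q)" by (rule sum_norm_le) (use yQ in auto)
        also have "\<dots> = real (card ((W-Wp) \<inter> ?R)) * Q" by simp
        also have "\<dots> \<le> real (card ?R) * Q" using cR(1) Q0 by (intro mult_right_mono) (auto intro!: card_mono)
        also have "\<dots> \<le> PP" unfolding PP_def using cR(2) Q0 by (intro mult_right_mono) auto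
        finally show ?thesis .
      qed
      have "e * I = (e * (- \<i>) * Z) / 2 + e * (- \<i>) * (\<i> * I - Z / 2)" by (simp add: algebra_simps)
      hence "Re (e * I) = Re (\<Sum>p\<in>Wp. y p * cis (- (t * ln (real p)))) / 2 + Re (\<Sum>n\<in>W-Wp. y n * cis (- (t * ln (real n)))) / 2 + Re (e * (- \<i>) * (\<i> * I - Z / 2))"
        unfolding split by (simp add: add_divide_distrib del: Re_sum)
      moreover have "\<bar>Re (\<Sum>n\<in>W-Wp. y n * cis (- (t * ln (real n))))\<bar> \<le> PP" using pp abs_Re_le_cmod order_trans by blast
      moreover have "\<bar>Re (e * (- \<i>) * (\<i> * I - Z / 2))\<bar> \<le> Err"
      proof -
        have "norm (e * (- \<i>) * (\<i> * I - Z / 2)) \<le> Err" using k2 by (simp only: norm_mult nore norm_minus_cancel norm_ii)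
        thus ?thesis using abs_Re_le_cmod order_trans by blast
      qed
      ultimately have "Re (e * I) \<ge> M / 4 - PP / 2 - Err" using big by linarith
      \<comment> \<open>Here M/4 \<ge> m/4, while PP/2 + Err \<le> m/8.\<close>
      hence ReI: "Re (e * I) \<ge> m / 8" using h(7) Mm m0 by linarith
      have "\<exists>u\<in>{-U..U}. Re (e * log_L L (Complex \<sigma> (t + u))) \<ge> (m / 8) / (2 * 16 ^ 5)"
      proof (rule exists_ge_of_weighted_average[OF k(1)])
        show "continuous_on {-U..U} (\<lambda>u. smoothing_kernel_re U u * (1 + cos (\<nu> * u)))"
          by (intro continuous_intros continuous_smoothing_kernel_re)
        show nn: "0 \<le> smoothing_kernel_re U u * (1 + cos (\<nu> * u))" if "u \<in> {-U..U}" for u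
        proof (rule mult_nonneg_nonneg)
          show "0 \<le> smoothing_kernel_re U u" using smoothing_kernel_re_bounds(1)[of U u] that h(2) by auto
          show "0 \<le> 1 + cos (\<nu> * u)" using cos_ge_minus_one[of "\<nu> * u"] by linarith
        qed
        have "integral {-U..U} (\<lambda>u. smoothing_kernel_re U u * (1 + cos (\<nu> * u))) \<le> integral {-U..U} (\<lambda>u. smoothing_kernel_re U u * 2)"
        proof (rule integral_le)
          show "smoothing_kernel_re U u * (1 + cos (\<nu> * u)) \<le> smoothing_kernel_re U u * 2" if "u \<in> {-U..U}" for u
            using smoothing_kernel_re_bounds(1)[of U u] that h(2) cos_le_one[of "\<nu> * u"] by (intro mult_left_mono) auto
        qed (intro integrable_continuous_real continuous_intros continuous_smoothing_kernel_re)+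
        also have "\<dots> = integral {-U..U} (smoothing_kernel_re U) * 2" by simp
        also have "\<dots> \<le> 8 * 16 ^ 4 * 2" using integral_smoothing_kernel_re_le(1)[of U] h(2) by simp
        finally show "integral {-U..U} (\<lambda>u. smoothing_kernel_re U u * (1 + cos (\<nu> * u))) \<le> 16 ^ 5" by simp
        show "Re (e * integral {-U..U} (\<lambda>u. log_L L (Complex \<sigma> (t + u)) * of_real (smoothing_kernel_re U u * (1 + cos (\<nu> * u))))) \<ge> m / 8"
          using ReI unfolding I_def .
      qed (use m0 in auto)
      moreover have "c * X powr (1 - \<sigma>) / ln X \<le> (m / 8) / (2 * 16 ^ 5)"
      proof -
        have X0: "ln X > 0" using h(6) by simp
        have "N powr (1 - \<sigma>) = c0 powr (1 - \<sigma>) * X powr (1 - \<sigma>)" unfolding N_def using c0 h(6) by (simp add: powr_mult)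
        hence "c * X powr (1 - \<sigma>) / ln X = c2 * N powr (1 - \<sigma>) / (2 * ln X) / 8 / (2 * 16 ^ 5)"
          by (simp add: c_def)
        also have "\<dots> \<le> c2 * N powr (1 - \<sigma>) / ln N / 8 / (2 * 16 ^ 5)"
          using h(4) N0 X0 c2 by (intro divide_right_mono divide_left_mono) auto
        finally show ?thesis by (simp add: m_def)
      qed
      ultimately show ?thesis by (meson order_trans)
    qed
    show ?case
    proof (intro exI[of _ y] conjI allI impI)
      show "(\<Sum>p\<in>{p\<in>freq_window (ln (c0 * ln T)). prime p}. norm (y p)) > 0"
        using Mm m0 unfolding M_def Wp_def W_def \<nu>_def N_def X_def by linarith
      fix t assume "ln T powr (3/4) + 5 \<le> t \<and> t + ln T powr (3/4) + 3 \<le> 2 * T \<and>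
        (\<forall>\<rho>. L \<rho> = 0 \<and> Re \<rho> \<ge> \<sigma> \<longrightarrow> \<bar>Im \<rho> - t\<bar> > ln T powr (3/4) + 3) \<and>
        Re (\<Sum>p\<in>{p\<in>freq_window (ln (c0 * ln T)). prime p}. y p * cis (- (t * ln (real p))))
          \<ge> (\<Sum>p\<in>{p\<in>freq_window (ln (c0 * ln T)). prime p}. norm (y p)) / 2"
      thus "\<exists>u\<in>{- (ln T powr (3/4))..ln T powr (3/4)}.
           Re (exp (- \<i> * of_real \<phi>) * log_L L (Complex \<sigma> (t + u))) \<ge> c * ln T powr (1 - \<sigma>) / ln (ln T)"
        using goal[of t] unfolding e_def M_def Wp_def W_def \<nu>_def N_def X_def U_def by blast
    qed
  qed
  thus ?thesis using cpos by blast
qed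

text \<open>For \<open>ii = 2\<close> boundedness of a(p) gives |a(p)|^2 \<le> B |a(p)|, so a lower
  bound for the second moment passes to the first.\<close>

lemma selberg_window_lower_bound:
  assumes L: "selberg_class a L" and ii: "if selberg_poly a L \<and> ramanujan a then ii \<in> {1, 2} else ii = 1" and "\<kappa> > 0"
    and lim: "((\<lambda>x. ln x / x * (\<Sum>p\<in>{p::nat. prime p \<and> real p \<le> x}. norm (a p) ^ ii)) \<longlongrightarrow> \<kappa>) at_top" and "q > 1"
  shows "\<exists>c>0. \<forall>\<^sub>F x in at_top. c * x / ln x \<le> (\<Sum>p\<in>{p::nat. prime p \<and> x < real p \<and> real p \<le> q * x}. norm (a p))"
proof -
  obtain B where B: "B > 0" "\<And>p. prime p \<Longrightarrow> norm (a p) ^ ii \<le> B * norm (a p)"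
  proof (cases "ii = 1")
    case True
    thus ?thesis by (intro that[of 1]) auto
  next
    case False
    hence s: "selberg_poly a L" "ramanujan a" and i2: "ii = 2" using ii by (auto split: if_splits)
    obtain B where B: "B > 0" "\<And>p. prime p \<Longrightarrow> norm (a p) \<le> B" using ramanujan_poly_bounded[OF s] by blast
    show ?thesis
      by (rule that[of B]) (use B i2 in \<open>auto simp: power2_eq_square mult_right_mono\<close>)
  qed
  obtain c where c: "c > 0" "\<forall>\<^sub>F x in at_top. c * x / ln x \<le> (\<Sum>p\<in>{p::nat. prime p \<and> x < real p \<and> real p \<le> q * x}. norm (a p) ^ ii)"
    using prime_window_sum[OF lim \<open>\<kappa> > 0\<close> \<open>q > 1\<close>] by blast
  from c(2) have "\<forall>\<^sub>F x in at_top. c / B * x / ln x \<le> (\<Sum>p\<in>{p::nat. prime p \<and> x < real p \<and> real p \<le> q * x}. norm (a p))"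
  proof eventually_elim
    case (elim x)
    have "c * x / ln x \<le> (\<Sum>p\<in>{p::nat. prime p \<and> x < real p \<and> real p \<le> q * x}. B * norm (a p))"
      using elim by (rule order_trans) (intro sum_mono, use B in auto)
    hence "c * x / ln x \<le> B * (\<Sum>p\<in>{p::nat. prime p \<and> x < real p \<and> real p \<le> q * x}. norm (a p))" by (simp add: sum_distrib_left)
    hence "c * x / ln x / B \<le> (\<Sum>p\<in>{p::nat. prime p \<and> x < real p \<and> real p \<le> q * x}. norm (a p))"
      by (subst pos_divide_le_eq[OF B(1)]) (simp only: mult.commute)
    moreover have "c / B * x / ln x = c * x / ln x / B" by simp
    ultimately show ?case by (simp only:)
  qed
  thus ?thesis using c B by (intro exI[of _ "c / B"]) auto
qed

text \<open>The centres differ by multiples of ln 3 \<ge> 1, and each open window has width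
  1.\<close>

lemma freq_windows_disjoint:
  assumes "c > 0" "p \<in> freq_window (ln (c * 3 ^ g * x))" "p \<in> freq_window (ln (c * 3 ^ h * x))" "x > 0"
  shows "g = h"
proof -
  have l: "ln (c * 3 ^ j * x) = ln c + real j * ln 3 + ln x" for j using assms by (simp add: ln_mult ln_realpow)
  have "\<bar>real g * ln 3 - real h * ln 3\<bar> < 1"
  proof -
    have "\<bar>ln (real p) - (ln c + real g * ln 3 + ln x)\<bar> < 1/2" "\<bar>ln (real p) - (ln c + real h * ln 3 + ln x)\<bar> < 1/2"
      using assms(2,3) unfolding freq_window_def l by auto
    thus ?thesis by linarith
  qed
  hence "\<bar>real g - real h\<bar> * ln 3 < 1" by (simp add: abs_mult left_diff_distrib[symmetric])
  moreover have "ln (3::real) \<ge> 1" using exp_le by (subst ln_ge_iff) auto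
  hence "\<bar>real g - real h\<bar> * 1 \<le> \<bar>real g - real h\<bar> * ln 3" by (intro mult_left_mono) auto
  ultimately have "\<bar>real g - real h\<bar> < 1" by (metis le_less_trans mult.right_neutral)
  thus ?thesis by linarith
qed

section \<open>Simultaneous large values for all functions\<close>

theorem theorem3:
  fixes H :: nat
    and a :: "nat \<Rightarrow> nat \<Rightarrow> complex"
    and L :: "nat \<Rightarrow> complex \<Rightarrow> complex"
    and \<sigma>\<^sub>0 \<alpha> :: real
    and \<kappa> :: "nat \<Rightarrow> real"
    and ii :: "nat \<Rightarrow> nat"
    and \<phi> :: "nat \<Rightarrow> real"
  assumes "H \<ge> 1"
    and "\<forall>h<H. selberg_class (a h) (L h)"
    and "1/2 < \<sigma>\<^sub>0" "\<sigma>\<^sub>0 < 1" "0 < \<alpha>" "\<alpha> < 1"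
    and "(\<lambda>T. \<Sum>h<H. real (zero_count (L h) \<sigma>\<^sub>0 T)) \<in> o[at_top](\<lambda>T. T powr (1 - \<alpha>))"
    and "\<forall>h<H. (if selberg_poly (a h) (L h) \<and> ramanujan (a h) then ii h \<in> {1, 2} else ii h = 1)"
    and "\<forall>h<H. \<kappa> h > 0"
    and "\<forall>h<H. ((\<lambda>x. ln x / x * (\<Sum>p\<in>{p::nat. prime p \<and> real p \<le> x}. norm (a h p) ^ ii h))
                 \<longlongrightarrow> \<kappa> h) at_top"
  shows "\<exists>c>0. \<exists>T\<^sub>0. \<forall>T\<ge>T\<^sub>0. \<exists>t::nat \<Rightarrow> real.
           (\<forall>h<H. T \<le> t h \<and> t h \<le> 2 * T \<and>
                  (\<forall>\<sigma>\<ge>\<sigma>\<^sub>0. L h (Complex \<sigma> (t h)) \<noteq> 0) \<and>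
                  Re (exp (- \<i> * of_real (\<phi> h)) * log_L (L h) (Complex \<sigma>\<^sub>0 (t h)))
                    \<ge> c * ln T powr (1 - \<sigma>\<^sub>0) / ln (ln T)) \<and>
           (\<forall>g<H. \<forall>h<H. \<bar>t h - t g\<bar> \<le> 2 * ln T powr ((1 + \<sigma>\<^sub>0) / 2) * sqrt (ln (ln T)))"
proof -
  \<comment> \<open>The mean defect of the H windows is about H/k, and the averaging argument allows
    1/8.\<close>
  define k where "k = 8 * H"
  have k: "k \<ge> 1" "real k \<ge> 1" using assms(1) by (auto simp: k_def)
  \<comment> \<open>Makes every prime in use at most Y = \<alpha> log T / (32 k), which will give
    k^|P| \<le> T^(\<alpha>/4). The factor 2 between 64 and 32 absorbs exp(1/2), the upper end of a
    window.\<close>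
  define c0 where "c0 = \<alpha> / (64 * real k * 3 ^ H)"
  have c0: "c0 > 0" using k assms by (simp add: c0_def)
  define good where "good h c T \<longleftrightarrow> (\<exists>y::nat \<Rightarrow> complex.
     (\<Sum>p\<in>{p\<in>freq_window (ln (c0 * 3 ^ h * ln T)). prime p}. norm (y p)) > 0 \<and>
     (\<forall>t. ln T powr (3/4) + 5 \<le> t \<and> t + ln T powr (3/4) + 3 \<le> 2 * T \<and>
        (\<forall>\<rho>. L h \<rho> = 0 \<and> Re \<rho> \<ge> \<sigma>\<^sub>0 \<longrightarrow> \<bar>Im \<rho> - t\<bar> > ln T powr (3/4) + 3) \<and>
        Re (\<Sum>p\<in>{p\<in>freq_window (ln (c0 * 3 ^ h * ln T)). prime p}. y p * cis (- (t * ln (real p))))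
          \<ge> (\<Sum>p\<in>{p\<in>freq_window (ln (c0 * 3 ^ h * ln T)). prime p}. norm (y p)) / 2 \<longrightarrow>
        (\<exists>u\<in>{- (ln T powr (3/4))..ln T powr (3/4)}.
           Re (exp (- \<i> * of_real (\<phi> h)) * log_L (L h) (Complex \<sigma>\<^sub>0 (t + u))) \<ge> c * ln T powr (1 - \<sigma>\<^sub>0) / ln (ln T))))" for h c T
  have "\<exists>c>0. \<forall>\<^sub>F T in at_top. good h c T" if h: "h < H" for h
    unfolding good_def
  proof (rule selberg_large_value)
    show "selberg_class (a h) (L h)" using assms h by blast
    show "0 < c0 * 3 ^ h" using c0 by simp
    show "\<exists>c>0. \<forall>\<^sub>F x in at_top. c * x / ln x \<le> (\<Sum>p\<in>{p::nat. prime p \<and> x < real p \<and> real p \<le> exp (1/8192) * x}. norm (a h p))"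
      by (rule selberg_window_lower_bound[of "a h" "L h" "ii h" "\<kappa> h"]) (use assms h in auto)
  qed (use assms in auto)
  then obtain cf where cf: "\<And>h. h < H \<Longrightarrow> cf h > 0" "\<And>h. h < H \<Longrightarrow> \<forall>\<^sub>F T in at_top. good h (cf h) T" by metis
  define c where "c = Min (cf ` {..<H})"
  have ne: "{..<H} \<noteq> {}" using assms(1) by (auto simp: lessThan_empty_iff)
  have c: "c > 0" "\<And>h. h < H \<Longrightarrow> c \<le> cf h" unfolding c_def using cf(1) ne by auto
  have evgood: "\<forall>\<^sub>F T in at_top. \<forall>h\<in>{..<H}. good h (cf h) T" by (rule eventually_ball_finite) (use cf in auto)
  have "\<forall>\<^sub>F T in at_top. norm (\<Sum>h<H. real (zero_count (L h) \<sigma>\<^sub>0 T)) \<le> 1 * norm (T powr (1 - \<alpha>))"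
    by (rule landau_o.smallD[OF assms(7)]) simp
  hence evz: "\<forall>\<^sub>F T in at_top. (\<Sum>h<H. real (zero_count (L h) \<sigma>\<^sub>0 T)) \<le> T powr (1 - \<alpha>)"
    by eventually_elim simp
  \<comment> \<open>The exceptional t have measure T^(1 - \<alpha>) up to logarithms, so a weight as
    large as T^(\<alpha>/4) cannot make them matter.\<close>
  have "((\<lambda>T. T powr (\<alpha>/4) * ((T powr (1 - \<alpha>) + 2) * (16 * (ln T powr (3/4) + 5))) / T) \<longlongrightarrow> 0) at_top"
    using assms(5,6) by real_asymp
  hence "\<forall>\<^sub>F T in at_top. T powr (\<alpha>/4) * ((T powr (1 - \<alpha>) + 2) * (16 * (ln T powr (3/4) + 5))) / T < 1"
    by (rule order_tendstoD) simp
  moreover have "((\<lambda>T. T powr (1/2) * (32 * real H + 16) / T) \<longlongrightarrow> 0) at_top" by real_asymp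
  hence "\<forall>\<^sub>F T in at_top. T powr (1/2) * (32 * real H + 16) / T < 1" by (rule order_tendstoD) simp
  moreover have "\<forall>\<^sub>F T in at_top. ln (ln T) \<ge> (1::real)" by real_asymp
  moreover have "\<forall>\<^sub>F T in at_top. ln T \<ge> (1::real)" by real_asymp
  ultimately have "\<forall>\<^sub>F T in at_top. \<exists>t::nat \<Rightarrow> real.
           (\<forall>h<H. T \<le> t h \<and> t h \<le> 2 * T \<and>
                  (\<forall>\<sigma>\<ge>\<sigma>\<^sub>0. L h (Complex \<sigma> (t h)) \<noteq> 0) \<and>
                  Re (exp (- \<i> * of_real (\<phi> h)) * log_L (L h) (Complex \<sigma>\<^sub>0 (t h)))
                    \<ge> c * ln T powr (1 - \<sigma>\<^sub>0) / ln (ln T)) \<and>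
           (\<forall>g<H. \<forall>h<H. \<bar>t h - t g\<bar> \<le> 2 * ln T powr ((1 + \<sigma>\<^sub>0) / 2) * sqrt (ln (ln T)))"
    using evgood evz eventually_ge_at_top[of 3]
  proof eventually_elim
    case (elim T)
    define X where "X = ln T"
    define U where "U = X powr (3/4)"
    have X1: "X \<ge> 1" and lX: "ln X \<ge> 1" and T3: "T \<ge> 3" using elim by (auto simp: X_def)
    have U1: "U \<ge> 1" using X1 by (simp add: U_def ge_one_powr_ge_zero)
    have TX: "T powr r = exp (r * X)" for r using T3 by (simp add: powr_def X_def)
    define Wd where "Wd h = {p\<in>freq_window (ln (c0 * 3 ^ h * X)). prime p}" for h
    have "\<forall>h\<in>{..<H}. \<exists>y::nat \<Rightarrow> complex. (\<Sum>p\<in>Wd h. norm (y p)) > 0 \<and>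
      (\<forall>t. U + 5 \<le> t \<and> t + U + 3 \<le> 2 * T \<and> (\<forall>\<rho>. L h \<rho> = 0 \<and> Re \<rho> \<ge> \<sigma>\<^sub>0 \<longrightarrow> \<bar>Im \<rho> - t\<bar> > U + 3) \<and>
        Re (\<Sum>p\<in>Wd h. y p * cis (- (t * ln (real p)))) \<ge> (\<Sum>p\<in>Wd h. norm (y p)) / 2 \<longrightarrow>
        (\<exists>u\<in>{-U..U}. Re (exp (- \<i> * of_real (\<phi> h)) * log_L (L h) (Complex \<sigma>\<^sub>0 (t + u))) \<ge> cf h * X powr (1 - \<sigma>\<^sub>0) / ln X))"
      using elim(5) unfolding good_def Wd_def U_def X_def .
    from bchoice[OF this] obtain y where y: "\<And>h. h < H \<Longrightarrow> (\<Sum>p\<in>Wd h. norm (y h p)) > 0"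
      "\<And>h t. h < H \<Longrightarrow> U + 5 \<le> t \<Longrightarrow> t + U + 3 \<le> 2 * T \<Longrightarrow> (\<forall>\<rho>. L h \<rho> = 0 \<and> Re \<rho> \<ge> \<sigma>\<^sub>0 \<longrightarrow> \<bar>Im \<rho> - t\<bar> > U + 3) \<Longrightarrow>
        Re (\<Sum>p\<in>Wd h. y h p * cis (- (t * ln (real p)))) \<ge> (\<Sum>p\<in>Wd h. norm (y h p)) / 2 \<Longrightarrow>
        (\<exists>u\<in>{-U..U}. Re (exp (- \<i> * of_real (\<phi> h)) * log_L (L h) (Complex \<sigma>\<^sub>0 (t + u))) \<ge> cf h * X powr (1 - \<sigma>\<^sub>0) / ln X)"
      by blast
    define P where "P = (\<Union>h<H. Wd h)"
    define Y where "Y = \<alpha> / (32 * real k) * X"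
    have Y0: "Y \<ge> 0" using assms X1 by (simp add: Y_def)
    have P: "finite P" "\<And>p. p \<in> P \<Longrightarrow> prime p" by (auto simp: P_def Wd_def finite_freq_window)
    have PY: "real p \<le> Y" if pP: "p \<in> P" for p
    proof -
      obtain h where h: "h < H" "p \<in> freq_window (ln (c0 * 3 ^ h * X))" using pP by (auto simp: P_def Wd_def)
      have N0: "c0 * 3 ^ h * X > 0" using c0 X1 by simp
      have "real p < exp (ln (c0 * 3 ^ h * X) + 1/2)" using freq_window_bounds[OF h(2)] by simp
      also have "\<dots> = c0 * 3 ^ h * X * exp (1/2)" using N0 by (simp add: exp_add)
      also have "\<dots> \<le> c0 * 3 ^ H * X * 2"
      proof (intro mult_mono)
        show "exp (1/2::real) \<le> 2" using exp_bound[of "1/2"] by (simp add: power2_eq_square)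
      qed (use c0 X1 h in \<open>auto intro!: power_increasing\<close>)
      also have "\<dots> = Y" using k by (simp add: c0_def Y_def field_simps)
      finally show ?thesis by simp
    qed
    have PB: "real (\<Prod>p\<in>P. p) \<le> exp (2 * Y)" "real (card P) \<le> 3 * Y"
      by (rule prime_set_product_bounds; use P PY Y0 in auto)+
    have kY: "real k * Y = \<alpha> / 32 * X" using k by (simp add: Y_def)
    have KP: "real k ^ card P \<le> exp (3 * (real k * Y))"
    proof -
      have "real k ^ card P = exp (real (card P) * ln (real k))" using k by (simp add: exp_of_nat_mult)
      also have "\<dots> \<le> exp (3 * Y * real k)"
      proof -
        \<comment> \<open>This crude bound is affordable because Y already carries the factor
          1/k.\<close>
        have "ln (real k) \<le> real k" using k ln_le_minus_one[of "real k"] by simp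
        hence "real (card P) * ln (real k) \<le> 3 * Y * real k" using PB k Y0 by (intro mult_mono) auto
        thus ?thesis by simp
      qed
      finally show ?thesis by (simp add: mult_ac)
    qed
    have aX: "0 \<le> \<alpha> * X" "\<alpha> * X \<le> X" using assms X1 by auto
    have KP1: "real k ^ card P \<le> T powr (\<alpha>/4)"
    proof -
      have "exp (3 * (real k * Y)) \<le> exp (\<alpha> / 4 * X)" unfolding kY exp_le_cancel_iff using aX by linarith
      thus ?thesis using KP unfolding TX by linarith
    qed
    have KP2: "real k ^ card P * real (\<Prod>p\<in>P. p) ^ (2 * k) \<le> T powr (1/2)"
    proof -
      have "real (\<Prod>p\<in>P. p) ^ (2 * k) \<le> exp (2 * Y) ^ (2 * k)" by (rule power_mono[OF PB(1) of_nat_0_le_iff])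
      also have "\<dots> = exp (4 * (real k * Y))" by (simp add: mult_ac flip: exp_of_nat_mult)
      finally have "real k ^ card P * real (\<Prod>p\<in>P. p) ^ (2 * k) \<le> exp (3 * (real k * Y)) * exp (4 * (real k * Y))"
        by (intro mult_mono KP) auto
      also have "\<dots> = exp (7 * (real k * Y))" by (simp flip: exp_add)
      also have "\<dots> \<le> exp (1/2 * X)" unfolding kY exp_le_cancel_iff using aX by linarith
      finally show ?thesis unfolding TX .
    qed
    define zs where "zs h = {\<rho>. L h \<rho> = 0 \<and> T \<le> Im \<rho> \<and> Im \<rho> \<le> 2 * T \<and> Re \<rho> \<ge> \<sigma>\<^sub>0}" for h
    have finz: "finite (zs h)" if h: "h < H" for h
    proof -
      have Lh: "selberg_class (a h) (L h)" using assms h by blast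
      obtain g where "\<And>s. Re s > 3/2 \<Longrightarrow> L h s = exp (dirichlet_series g s)"
        using selberg_class_log_coeffs[OF Lh] by metis
      thus ?thesis unfolding zs_def by (intro selberg_finite_zeros[OF Lh]) (use T3 in auto)
    qed
    \<comment> \<open>Including the endpoints keeps t + u inside [T, 2T] and ensures that a zero
      near t in height lies in the range counted by \<open>zero_count\<close>.\<close>
    define Z where "Z = {T, 2 * T} \<union> (\<Union>h<H. Im ` zs h)"
    have finZ: "finite Z" using finz by (auto simp: Z_def)
    have cardZ: "real (card Z) \<le> T powr (1 - \<alpha>) + 2"
    proof -
      have "card (\<Union>h<H. Im ` zs h) \<le> (\<Sum>h<H. card (Im ` zs h))" by (rule card_UN_le) simp
      also have "\<dots> \<le> (\<Sum>h<H. zero_count (L h) \<sigma>\<^sub>0 T)"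
        unfolding zero_count_def zs_def[symmetric] by (intro sum_mono card_image_le finz) auto
      finally have 1: "card (\<Union>h<H. Im ` zs h) \<le> (\<Sum>h<H. zero_count (L h) \<sigma>\<^sub>0 T)" .
      have "card Z \<le> card {T, 2 * T} + card (\<Union>h<H. Im ` zs h)" unfolding Z_def by (rule card_Un_le)
      also have "card {T, 2 * T} \<le> 2" by (simp add: card_insert_if)
      finally have "card Z \<le> 2 + (\<Sum>h<H. zero_count (L h) \<sigma>\<^sub>0 T)" using 1 by simp
      hence "real (card Z) \<le> real (2 + (\<Sum>h<H. zero_count (L h) \<sigma>\<^sub>0 T))" by (simp only: of_nat_le_iff)
      thus ?thesis using elim(6) by simp
    qed
    \<comment> \<open>The radius U + 5 exceeds both the zero-free height U + 3 and the margins
      required at the ends of the interval.\<close>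
    have "\<exists>t\<in>{T..2*T}. (\<forall>z\<in>Z. \<bar>t - z\<bar> > U + 5) \<and>
      (\<forall>h<H. Re (\<Sum>p\<in>Wd h. y h p * cis (- (t * ln (real p)))) \<ge> (\<Sum>p\<in>Wd h. norm (y h p)) / 2)"
    proof (rule resonance_method[OF P])
      show "Wd h \<subseteq> P" if "h < H" for h using that by (auto simp: P_def)
      show "g = h" if "p \<in> Wd g" "p \<in> Wd h" for g h p
        using freq_windows_disjoint[OF c0, of p g X h] that X1 by (auto simp: Wd_def)
      show "k \<ge> 8 * H" by (simp add: k_def)
      have "real k ^ card P * real (\<Prod>p\<in>P. p) ^ (2 * k) * (32 * real H + 16) \<le> T powr (1/2) * (32 * real H + 16)"
        by (intro mult_right_mono KP2) auto
      also have "\<dots> \<le> T" using elim(2) T3 by (simp add: divide_less_eq)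
      finally show "real k ^ card P * real (\<Prod>p\<in>P. p) ^ (2 * k) * (32 * real H + 16) \<le> T" .
      have "real k ^ card P * (real (card Z) * (16 * (U + 5))) \<le> T powr (\<alpha>/4) * ((T powr (1 - \<alpha>) + 2) * (16 * (U + 5)))"
        using U1 by (intro mult_mono KP1 cardZ) auto
      also have "\<dots> \<le> T" using elim(1) T3 unfolding U_def X_def by (simp add: divide_less_eq)
      finally show "real k ^ card P * (real (card Z) * (16 * (U + 5))) \<le> T" .
    qed (use y(1) k T3 U1 finZ in auto)
    then obtain t where t: "T \<le> t" "t \<le> 2 * T" "\<And>z. z \<in> Z \<Longrightarrow> \<bar>t - z\<bar> > U + 5"
      "\<And>h. h < H \<Longrightarrow> Re (\<Sum>p\<in>Wd h. y h p * cis (- (t * ln (real p)))) \<ge> (\<Sum>p\<in>Wd h. norm (y h p)) / 2"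
      by auto
    have tT: "t > T + U + 5" "t < 2 * T - U - 5" using t(1,2) t(3)[of T] t(3)[of "2 * T"] by (auto simp: Z_def abs_if split: if_splits)
    have zf: "\<bar>Im \<rho> - t\<bar> > U + 3" if "h < H" "L h \<rho> = 0" "Re \<rho> \<ge> \<sigma>\<^sub>0" for h \<rho>
    proof (rule ccontr)
      assume n: "\<not> \<bar>Im \<rho> - t\<bar> > U + 3"
      hence "T \<le> Im \<rho>" "Im \<rho> \<le> 2 * T" using tT by auto
      hence "Im \<rho> \<in> Z" using that by (auto simp: Z_def zs_def)
      from t(3)[OF this] show False using n by linarith
    qed
    have "\<forall>h\<in>{..<H}. \<exists>u. u \<in> {-U..U} \<and> Re (exp (- \<i> * of_real (\<phi> h)) * log_L (L h) (Complex \<sigma>\<^sub>0 (t + u))) \<ge> cf h * X powr (1 - \<sigma>\<^sub>0) / ln X"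
    proof
      fix h assume "h \<in> {..<H}"
      hence h: "h < H" by simp
      from y(2)[OF h _ _ _ t(4)[OF h]] zf[OF h] tT T3 U1
      show "\<exists>u. u \<in> {-U..U} \<and> Re (exp (- \<i> * of_real (\<phi> h)) * log_L (L h) (Complex \<sigma>\<^sub>0 (t + u))) \<ge> cf h * X powr (1 - \<sigma>\<^sub>0) / ln X"
        by force
    qed
    from bchoice[OF this] obtain u where u: "\<And>h. h < H \<Longrightarrow> u h \<in> {-U..U}"
      "\<And>h. h < H \<Longrightarrow> Re (exp (- \<i> * of_real (\<phi> h)) * log_L (L h) (Complex \<sigma>\<^sub>0 (t + u h))) \<ge> cf h * X powr (1 - \<sigma>\<^sub>0) / ln X"
      by auto
    show ?case
    proof (intro exI[of _ "\<lambda>h. t + u h"] conjI allI impI)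
      fix h assume h: "h < H"
      show "T \<le> t + u h" "t + u h \<le> 2 * T" using u(1)[OF h] tT by auto
      \<comment> \<open>|u| \<le> U keeps the whole ray to the right of the point within the
        zero-free heights.\<close>
      show "L h (Complex \<sigma> (t + u h)) \<noteq> 0" if "\<sigma> \<ge> \<sigma>\<^sub>0" for \<sigma>
        using zf[OF h, of "Complex \<sigma> (t + u h)"] that u(1)[OF h] by auto
      have "c * X powr (1 - \<sigma>\<^sub>0) / ln X \<le> cf h * X powr (1 - \<sigma>\<^sub>0) / ln X"
        using c(2)[OF h] lX by (intro divide_right_mono mult_right_mono) auto
      thus "c * ln T powr (1 - \<sigma>\<^sub>0) / ln (ln T) \<le> Re (exp (- \<i> * of_real (\<phi> h)) * log_L (L h) (Complex \<sigma>\<^sub>0 (t + u h)))"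
        using u(2)[OF h] unfolding X_def by linarith
    next
      fix g h assume gh: "g < H" "h < H"
      have "\<bar>(t + u h) - (t + u g)\<bar> \<le> 2 * U" using u(1)[OF gh(1)] u(1)[OF gh(2)] by auto
      also have "2 * U \<le> 2 * X powr ((1 + \<sigma>\<^sub>0) / 2) * sqrt (ln X)"
      proof -
        \<comment> \<open>\<open>\<sigma>\<^sub>0\<close> > 1/2 makes the exponent on the right
          larger than 3/4.\<close>
        have "U \<le> X powr ((1 + \<sigma>\<^sub>0) / 2)" unfolding U_def using X1 assms by (intro powr_mono) auto
        hence "(2 * U) * 1 \<le> (2 * X powr ((1 + \<sigma>\<^sub>0) / 2)) * sqrt (ln X)" using lX U1 by (intro mult_mono) auto
        thus ?thesis by simp
      qed
      finally show "\<bar>(t + u h) - (t + u g)\<bar> \<le> 2 * ln T powr ((1 + \<sigma>\<^sub>0) / 2) * sqrt (ln (ln T))" by (simp add: X_def)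
    qed
  qed
  thus ?thesis using c(1) unfolding eventually_at_top_linorder by blast
qed

end
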